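(* Let $\Omega\subset\mathbb{H}$ be a circular domain and let $f,g\in\mathcal{SEM}(\Omega)\setminus\mathcal{SEM}_{\mathbb{R}}(\Omega)$ be such that $f_0+g_0\equiv 1$ and $\mathcal{S}_{f,g}:\mathcal{SEM}(\Omega)\to\mathcal{SEM}(\Omega)$, $\mathcal{S}_{f,g}(\chi)=f*\chi+\chi*g$, is not an isomorphism. If $g_v^s\equiv0$, then $$\ker(\mathcal{S}_{f,g})=\left\{(1-f_v)*X*g_v\,:\, X\in \mathcal{SEM}(\Omega)\right\}$$ and, for $\mathfrak{b}\in\mathcal{SEM}(\Omega)$, the equation $\mathcal{S}_{f,g}(\chi)=\mathfrak{b}$ has a solution if and only if $(1-f_v)*\mathfrak{b}*g_v\equiv0$.
   Context: $\mathbb{H}$ denotes the quaternions, $q^c$ the quaternionic conjugate, $\mathbb{S}=\{q\in\mathbb{H}: q^2=-1\}$, and $\mathbb{C}_I=\mathbb{R}+I\mathbb{R}$ for $I\in\mathbb{S}$. For $q=x+Iy$ put $\mathbb{S}_q=\{x+Jy: J\in\mathbb{S}\}$. A domain (connected open set) $\Omega\subset\mathbb{H}$ is circular if $\mathbb{S}_q\subset\Omega$ for all $q\in\Omega$. A function $f$ on a circular open set $\Omega$ is slice regular ($f\in\mathcal{SR}(\Omega)$) if $f(x+Iy)=F_1(x,y)+IF_2(x,y)$ for all $x+Iy\in\Omega$ ($x,y\in\mathbb{R}$, $I\in\mathbb{S}$), with $\mathbb{H}$-valued $F_1$ even in $y$ and $F_2$ odd in $y$, and each restriction $f|_{\Omega\cap\mathbb{C}_I}$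 is real differentiable with $\frac12(\partial_x+I\partial_y)f|_{\Omega\cap\mathbb{C}_I}\equiv0$. The $*$-product is $(f*g)(q)=0$ if $f(q)=0$ and $(f*g)(q)=f(q)\,g(f(q)^{-1}qf(q))$ otherwise. $f$ is slice preserving if $f(\Omega\cap\mathbb{C}_I)\subset\mathbb{C}_I$ for every $I\in\mathbb{S}$. A function $f$ is slice semi-regular on $\Omega$ ($f\in\mathcal{SEM}(\Omega)$) if there is a circular open $\widetilde\Omega\subseteq\Omega$ with $f\in\mathcal{SR}(\widetilde\Omega)$ and each point of $\Omega\setminus\widetilde\Omega$ is a pole or a removable singularity; i.e. $\Omega\setminus\widetilde\Omega$ consists of isolated real points and isolated spheres $\mathbb{S}_p$, near each of which $\Delta_p^m f$ extends slice regularly for some integer $m\ge0$, where $\Delta_p(q)=q^2-2\mathrm{Re}(p)q+|p|^2$. Functions agreeing where both are defined are identified. $\mathcal{SEM}_{\mathbb{R}}(\Omega)$ is the subset of slice preserving elements; it is a field and the center of the algebra $(\mathcal{SEM}(\Omega),+,* )$, which is a 4-dimensional vector space over it: for an orthonormal basis $(1,I,J,K)$ of $\mathbb{H}$, each $f$ is uniquely $f_0+f_1I+f_2J+f_3K$ with $f_\ell\in\mathcal{SEM}_{\mathbb{R}}(\Omega)$. Set $f^c=f_0-(f_1I+f_2J+f_3K)$, $f^s=f*f^c=f_0^2+f_1^2+f_2^2+f_3^2$, $f_0=(f+f^c)/2$, $f_v=f-f_0$, so $f_v^s=(f_v)^s=f_1^2+f_2^2+f_3^2$. Isomorphism means isomorphism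 of $\mathcal{SEM}_{\mathbb{R}}(\Omega)$-vector spaces. *)

theory Defs
  imports
    "HOL-Analysis.Analysis"
    "HOL-Algebra.Module"
    "HOL-Algebra.AbelCoset"
begin

section \<open>The quaternions\<close>

codatatype quat = Quat (qRe: real) (qI: real) (qJ: real) (qK: real)

lemma quat_eq_iff:
  "x = y \<longleftrightarrow> qRe x = qRe y \<and> qI x = qI y \<and> qJ x = qJ y \<and> qK x = qK y"
  by (auto intro: quat.expand)

lemma quat_eqI:
  "qRe x = qRe y \<Longrightarrow> qI x = qI y \<Longrightarrow> qJ x = qJ y \<Longrightarrow> qK x = qK y \<Longrightarrow> x = y"
  by (simp add: quat_eq_iff)

instantiation quat :: real_vector
begin

primcorec zero_quat where
  "qRe 0 = 0" | "qI 0 = 0" | "qJ 0 = 0" | "qK 0 = 0"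

primcorec plus_quat where
  "qRe (x + y) = qRe x + qRe y"
| "qI (x + y) = qI x + qI y"
| "qJ (x + y) = qJ x + qJ y"
| "qK (x + y) = qK x + qK y"

primcorec uminus_quat where
  "qRe (- x) = - qRe x"
| "qI (- x) = - qI x"
| "qJ (- x) = - qJ x"
| "qK (- x) = - qK x"

primcorec minus_quat where
  "qRe (x - y) = qRe x - qRe y"
| "qI (x - y) = qI x - qI y"
| "qJ (x - y) = qJ x - qJ y"
| "qK (x - y) = qK x - qK y"

primcorec scaleR_quat where
  "qRe (scaleR r x) = r * qRe x"
| "qI (scaleR r x) = r * qI x"
| "qJ (scaleR r x) = r * qJ x"
| "qK (scaleR r x) = r * qK x"

instance
  by standard (simp_all add: quat_eq_iff algebra_simps)

end

instantiation quat :: real_algebra_1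
begin

primcorec one_quat where
  "qRe 1 = 1" | "qI 1 = 0" | "qJ 1 = 0" | "qK 1 = 0"

primcorec times_quat where
  "qRe (x * y) = qRe x * qRe y - qI x * qI y - qJ x * qJ y - qK x * qK y"
| "qI (x * y) = qRe x * qI y + qI x * qRe y + qJ x * qK y - qK x * qJ y"
| "qJ (x * y) = qRe x * qJ y - qI x * qK y + qJ x * qRe y + qK x * qI y"
| "qK (x * y) = qRe x * qK y + qI x * qJ y - qJ x * qI y + qK x * qRe y"

instance
  by standard (simp_all add: quat_eq_iff algebra_simps)

end

instantiation quat :: real_div_algebra
begin

primcorec inverse_quat where
  "qRe (inverse x) = qRe x / ((qRe x)\<^sup>2 + (qI x)\<^sup>2 + (qJ x)\<^sup>2 + (qK x)\<^sup>2)"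
| "qI (inverse x) = - qI x / ((qRe x)\<^sup>2 + (qI x)\<^sup>2 + (qJ x)\<^sup>2 + (qK x)\<^sup>2)"
| "qJ (inverse x) = - qJ x / ((qRe x)\<^sup>2 + (qI x)\<^sup>2 + (qJ x)\<^sup>2 + (qK x)\<^sup>2)"
| "qK (inverse x) = - qK x / ((qRe x)\<^sup>2 + (qI x)\<^sup>2 + (qJ x)\<^sup>2 + (qK x)\<^sup>2)"

definition "x div y = x * inverse y" for x y :: quat

lemma quat_sum_squares_eq_0_iff:
  "(qRe x)\<^sup>2 + (qI x)\<^sup>2 + (qJ x)\<^sup>2 + (qK x)\<^sup>2 = 0 \<longleftrightarrow> x = 0"
  by (simp add: quat_eq_iff add_nonneg_eq_0_iff)

instance
proof
  fix x y :: quat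
  show "inverse x * x = 1" "x * inverse x = 1" if "x \<noteq> 0"
  proof -
    define d where "d = (qRe x)\<^sup>2 + (qI x)\<^sup>2 + (qJ x)\<^sup>2 + (qK x)\<^sup>2"
    have "d \<noteq> 0"
      using that quat_sum_squares_eq_0_iff[of x] by (simp add: d_def)
    moreover have "(qRe x * qRe x + qI x * qI x + qJ x * qJ x + qK x * qK x) / d = 1"
      using \<open>d \<noteq> 0\<close> by (simp add: d_def power2_eq_square)
    ultimately show "inverse x * x = 1" "x * inverse x = 1"
      by (simp_all add: quat_eq_iff add_divide_distrib mult.commute flip: d_def)
  qed
  show "x div y = x * inverse y"
    by (simp add: divide_quat_def)
  show "inverse (0 :: quat) = 0"
    by (simp add: quat_eq_iff)
qed

end

instantiation quat :: real_inner
begin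

definition inner_quat :: "quat \<Rightarrow> quat \<Rightarrow> real" where
  "inner_quat x y = qRe x * qRe y + qI x * qI y + qJ x * qJ y + qK x * qK y"

definition norm_quat :: "quat \<Rightarrow> real" where
  "norm_quat x = sqrt (inner x x)"

definition sgn_quat :: "quat \<Rightarrow> quat" where
  "sgn_quat x = x /\<^sub>R norm x"

definition dist_quat :: "quat \<Rightarrow> quat \<Rightarrow> real" where
  "dist_quat x y = norm (x - y)"

definition uniformity_quat :: "(quat \<times> quat) filter" where
  "uniformity_quat = (INF e\<in>{0 <..}. principal {(x, y). dist x y < e})"

definition open_quat :: "quat set \<Rightarrow> bool" where
  "open_quat U \<longleftrightarrow> (\<forall>x\<in>U. eventually (\<lambda>(x', y). x' = x \<longrightarrow> y \<in> U) uniformity)"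

instance
proof
  fix x :: quat
  have "inner x x = (qRe x)\<^sup>2 + (qI x)\<^sup>2 + (qJ x)\<^sup>2 + (qK x)\<^sup>2"
    by (simp add: inner_quat_def power2_eq_square)
  then show "0 \<le> inner x x" "inner x x = 0 \<longleftrightarrow> x = 0"
    by (simp_all add: quat_sum_squares_eq_0_iff)
qed (simp_all add: inner_quat_def norm_quat_def sgn_quat_def dist_quat_def
      uniformity_quat_def open_quat_def algebra_simps)

end

instance quat :: real_normed_div_algebra
proof
  fix x y :: quat
  have "inner (x * y) (x * y) = inner x x * inner y y"
    by (simp add: inner_quat_def algebra_simps)
  then show "norm (x * y) = norm x * norm y"
    by (simp add: norm_quat_def real_sqrt_mult)
qed

definition quat_i :: quat where "quat_i = Quat 0 1 0 0"
definition quat_j :: quat where "quat_j = Quat 0 0 1 0"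
definition quat_k :: quat where "quat_k = Quat 0 0 0 1"

definition imag_units :: "quat set" where
  "imag_units = {q. q\<^sup>2 = -1}"

definition slice :: "quat \<Rightarrow> quat set" where
  "slice I = {of_real x + I * of_real y | x y. True}"

definition qsphere :: "quat \<Rightarrow> quat set" where
  "qsphere q = {of_real x + J * of_real y | x y J.
     J \<in> imag_units \<and> (\<exists>I\<in>imag_units. q = of_real x + I * of_real y)}"

definition circular :: "quat set \<Rightarrow> bool" where
  "circular \<Omega> \<longleftrightarrow> (\<forall>q\<in>\<Omega>. qsphere q \<subseteq> \<Omega>)"


section \<open>Slice regular functions\<close>

text \<open>
  Functions are total; only their values on the set under consideration matter.
  In particular, the stem functions \<open>F1\<close> and \<open>F2\<close> are unconstrained at the pairs \<open>(x, y)\<close> that do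
  not correspond to points of \<open>\<Omega>\<close>, apart from parity, which can always be arranged there.
\<close>

definition slice_regular_on :: "quat set \<Rightarrow> (quat \<Rightarrow> quat) \<Rightarrow> bool" where
  "slice_regular_on \<Omega> f \<longleftrightarrow>
     (\<exists>F1 F2 :: real \<Rightarrow> real \<Rightarrow> quat.
        (\<forall>x y. F1 x (- y) = F1 x y) \<and> (\<forall>x y. F2 x (- y) = - F2 x y) \<and>
        (\<forall>I\<in>imag_units. \<forall>x y. of_real x + I * of_real y \<in> \<Omega> \<longrightarrow>
           f (of_real x + I * of_real y) = F1 x y + I * F2 x y)) \<and>
     (\<forall>I\<in>imag_units. \<forall>x y. of_real x + I * of_real y \<in> \<Omega> \<longrightarrow>
        (\<exists>D. ((\<lambda>(u, v). f (of_real u + I * of_real v)) has_derivative D) (at (x, y)) \<and>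
             (1 / 2) *\<^sub>R (D (1, 0) + I * D (0, 1)) = 0))"

definition slice_preserving_on :: "quat set \<Rightarrow> (quat \<Rightarrow> quat) \<Rightarrow> bool" where
  "slice_preserving_on \<Omega> f \<longleftrightarrow> (\<forall>I\<in>imag_units. f ` (\<Omega> \<inter> slice I) \<subseteq> slice I)"

definition star :: "(quat \<Rightarrow> quat) \<Rightarrow> (quat \<Rightarrow> quat) \<Rightarrow> quat \<Rightarrow> quat" where
  "star f g q = (if f q = 0 then 0 else f q * g (inverse (f q) * q * f q))"


section \<open>Slice semi-regular functions\<close>

definition sphere_poly :: "quat \<Rightarrow> quat \<Rightarrow> quat" where
  "sphere_poly p q = q\<^sup>2 - of_real (2 * qRe p) * q + of_real ((norm p)\<^sup>2)"

text \<open>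
  \<open>regularity_set \<Omega> f \<Omega>'\<close>: \<open>f\<close> is slice regular on the circular open set \<open>\<Omega>' \<subseteq> \<Omega>\<close>, and every
  \<open>p\<close> in the complement has a circular open neighbourhood \<open>U\<close> that meets the complement only in the
  sphere of \<open>p\<close> (the single point \<open>p\<close> if \<open>p\<close> is real), and on which some \<open>\<Delta>\<^sub>p\<^sup>m f\<close>
  extends to a slice regular function.
\<close>

definition regularity_set :: "quat set \<Rightarrow> (quat \<Rightarrow> quat) \<Rightarrow> quat set \<Rightarrow> bool" where
  "regularity_set \<Omega> f \<Omega>' \<longleftrightarrow>
     \<Omega>' \<subseteq> \<Omega> \<and> open \<Omega>' \<and> circular \<Omega>' \<and> slice_regular_on \<Omega>' f \<and>
     (\<forall>p\<in>\<Omega> - \<Omega>'. \<exists>U (m :: nat) h.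
        open U \<and> circular U \<and> p \<in> U \<and> U \<subseteq> \<Omega> \<and> U - qsphere p \<subseteq> \<Omega>' \<and>
        slice_regular_on U h \<and> (\<forall>q\<in>U - qsphere p. h q = sphere_poly p q ^ m * f q))"

definition semi_regular :: "quat set \<Rightarrow> (quat \<Rightarrow> quat) set" where
  "semi_regular \<Omega> = {f. \<exists>\<Omega>'. regularity_set \<Omega> f \<Omega>'}"

text \<open>
  Identification of semi-regular functions that agree where both are defined. The elements of the
  algebra of semi-regular functions are the equivalence classes.
\<close>

definition sem_rel :: "quat set \<Rightarrow> ((quat \<Rightarrow> quat) \<times> (quat \<Rightarrow> quat)) set" where
  "sem_rel \<Omega> = {(f, g). \<exists>\<Omega>1 \<Omega>2. regularity_set \<Omega> f \<Omega>1 \<and> regularity_set \<Omega> g \<Omega>2 \<and>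
     (\<forall>q\<in>\<Omega>1 \<inter> \<Omega>2. f q = g q)}"

type_synonym sem = "(quat \<Rightarrow> quat) set"

definition sem_class :: "quat set \<Rightarrow> (quat \<Rightarrow> quat) \<Rightarrow> sem" where
  "sem_class \<Omega> f = sem_rel \<Omega> `` {f}"

definition sem_const :: "quat set \<Rightarrow> quat \<Rightarrow> sem" where
  "sem_const \<Omega> c = sem_class \<Omega> (\<lambda>_. c)"

definition sem_add :: "quat set \<Rightarrow> sem \<Rightarrow> sem \<Rightarrow> sem" where
  "sem_add \<Omega> F G = (\<Union>f\<in>F. \<Union>g\<in>G. sem_class \<Omega> (\<lambda>q. f q + g q))"

definition sem_mult :: "quat set \<Rightarrow> sem \<Rightarrow> sem \<Rightarrow> sem" where
  "sem_mult \<Omega> F G = (\<Union>f\<in>F. \<Union>g\<in>G. sem_class \<Omega> (star f g))"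

definition SEM :: "quat set \<Rightarrow> (sem, sem) module" where
  "SEM \<Omega> = \<lparr>carrier = semi_regular \<Omega> // sem_rel \<Omega>,
     mult = sem_mult \<Omega>, one = sem_const \<Omega> 1,
     zero = sem_const \<Omega> 0, add = sem_add \<Omega>,
     smult = sem_mult \<Omega>\<rparr>"

definition SEM_R :: "quat set \<Rightarrow> (sem, sem) module" where
  "SEM_R \<Omega> = SEM \<Omega> \<lparr>carrier := {F \<in> carrier (SEM \<Omega>).
     \<exists>f\<in>F. \<exists>\<Omega>'. regularity_set \<Omega> f \<Omega>' \<and> slice_preserving_on \<Omega>' f}\<rparr>"

text \<open>
  The components of \<open>F\<close> with respect to the standard basis \<open>(1, i, j, k)\<close>. The functions \<open>sem_Re\<close>
  and \<open>sem_vec\<close> give \<open>f\<^sub>0\<close> and \<open>f\<^sub>v = f - f\<^sub>0\<close>, \<open>sem_conj\<close> and \<open>sem_symm\<close> give \<open>f\<^sup>c\<close> and \<open>f\<^sup>s\<close>.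
\<close>

definition sem_components :: "quat set \<Rightarrow> sem \<Rightarrow> sem \<times> sem \<times> sem \<times> sem" where
  "sem_components \<Omega> F = (THE (F0, F1, F2, F3).
     {F0, F1, F2, F3} \<subseteq> carrier (SEM_R \<Omega>) \<and>
     F = F0 \<oplus>\<^bsub>SEM \<Omega>\<^esub> (F1 \<odot>\<^bsub>SEM \<Omega>\<^esub> sem_const \<Omega> quat_i \<oplus>\<^bsub>SEM \<Omega>\<^esub>
       F2 \<odot>\<^bsub>SEM \<Omega>\<^esub> sem_const \<Omega> quat_j \<oplus>\<^bsub>SEM \<Omega>\<^esub> F3 \<odot>\<^bsub>SEM \<Omega>\<^esub> sem_const \<Omega> quat_k))"

definition sem_Re :: "quat set \<Rightarrow> sem \<Rightarrow> sem" where
  "sem_Re \<Omega> F = fst (sem_components \<Omega> F)"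

definition sem_vec :: "quat set \<Rightarrow> sem \<Rightarrow> sem" where
  "sem_vec \<Omega> F = F \<ominus>\<^bsub>SEM \<Omega>\<^esub> sem_Re \<Omega> F"

definition sem_conj :: "quat set \<Rightarrow> sem \<Rightarrow> sem" where
  "sem_conj \<Omega> F = (case sem_components \<Omega> F of (F0, F1, F2, F3) \<Rightarrow>
     F0 \<ominus>\<^bsub>SEM \<Omega>\<^esub> (F1 \<odot>\<^bsub>SEM \<Omega>\<^esub> sem_const \<Omega> quat_i \<oplus>\<^bsub>SEM \<Omega>\<^esub>
       F2 \<odot>\<^bsub>SEM \<Omega>\<^esub> sem_const \<Omega> quat_j \<oplus>\<^bsub>SEM \<Omega>\<^esub> F3 \<odot>\<^bsub>SEM \<Omega>\<^esub> sem_const \<Omega> quat_k))"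

definition sem_symm :: "quat set \<Rightarrow> sem \<Rightarrow> sem" where
  "sem_symm \<Omega> F = F \<otimes>\<^bsub>SEM \<Omega>\<^esub> sem_conj \<Omega> F"


section \<open>The Sylvester operator\<close>

definition sylvester :: "quat set \<Rightarrow> sem \<Rightarrow> sem \<Rightarrow> sem \<Rightarrow> sem" where
  "sylvester \<Omega> F G X = F \<otimes>\<^bsub>SEM \<Omega>\<^esub> X \<oplus>\<^bsub>SEM \<Omega>\<^esub> X \<otimes>\<^bsub>SEM \<Omega>\<^esub> G"

definition module_iso ::
    "('a, 'r) ring_scheme \<Rightarrow> ('a, 'b, 'm) module_scheme \<Rightarrow> ('a, 'c, 'n) module_scheme
      \<Rightarrow> ('b \<Rightarrow> 'c) set" where
  "module_iso R M N = {T \<in> iso (add_monoid M) (add_monoid N).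
     \<forall>a\<in>carrier R. \<forall>x\<in>carrier M. T (a \<odot>\<^bsub>M\<^esub> x) = a \<odot>\<^bsub>N\<^esub> T x}"

end

theory Submission
  imports Defs "HOL-Complex_Analysis.Complex_Analysis"
begin

text \<open>
  Write \<open>v = f\<^sub>v\<close> and \<open>n = g\<^sub>v\<close>. Real parts are central and \<open>f\<^sub>0 + g\<^sub>0 = 1\<close>, so the operator is
  \<open>S(x) = (1 + v) * x + x * n\<close>, a sum of two commuting operators. Since \<open>n\<close> is purely vectorial,
  \<open>n * n\<close> is minus its symmetrization, hence \<open>n * n = 0\<close>. In the same way \<open>v * v\<close> is central, and
  \<open>(1 + v) * (1 - v) = 1 - v * v\<close>. The centre is a field; if \<open>v * v\<close> were different from \<open>1\<close>, then
  \<open>1 + v\<close> would be invertible, and \<open>S\<close>, a nilpotent perturbation of an invertible operator, would be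
  an isomorphism (\<open>sylvester_bij_of_inverse\<close>). So \<open>v * v = 1\<close>, which makes \<open>(1 + v) / 2\<close> and
  \<open>(1 - v) / 2\<close> complementary idempotents. On the image of \<open>1 + v\<close> the operator acts as \<open>2\<close> plus a
  nilpotent operator and is invertible there; on the image of \<open>1 - v\<close> it is right multiplication by
  \<open>n\<close>. Finally, as \<open>g\<close> is not slice preserving, \<open>n\<close> is nonzero, and over the field of central
  elements there is a \<open>w\<close> with \<open>w * n + n * w = 1\<close>. It forces the right annihilator and the right
  multiples of \<open>n\<close> to coincide: if \<open>x * n = 0\<close> then \<open>x = x * w * n\<close>. Both claims follow
  (\<open>sylvester_kernel_and_range\<close>).

  This argument needs the ring of semi-regular functions, its centre, and inverses in the centre. They
  come from complex analysis on one slice. A slice function is determined by its restriction to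
  \<open>\<complex>\<^sub>i\<close>, and writing that restriction as \<open>a + b j\<close> gives a pair of complex functions on the trace of
  \<open>\<Omega>\<close> in \<open>\<complex>\<^sub>i\<close>. Slice regular functions correspond to pairs of holomorphic functions and
  semi-regular functions to pairs of meromorphic ones (\<open>regularity_set_lift\<close>,
  \<open>regularity_set_imp_cosparse\<close>); two of them are identified when the pairs agree off a discrete set.
  With \<open>a'(z) = cnj (a (cnj z))\<close>, the \<open>*\<close>-product becomes
  \<open>(a, b) (c, d) = (a c - b d', a d + b c')\<close> (\<open>star_lift\<close>), that is, the product of the matrices
  with rows \<open>(a, b)\<close> and \<open>(- b', a')\<close>. All ring axioms become identities between complex functions
  (\<open>ring_SEM\<close>), and the slice preserving elements are the pairs \<open>(a, 0)\<close> with \<open>a' = a\<close>. Connectedness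
  of \<open>\<Omega>\<close> enters only through the identity theorem: such an \<open>a\<close>, unless it vanishes almost everywhere,
  has discrete zeros, so that \<open>(1 / a, 0)\<close> is its inverse (\<open>scal_inverse\<close>).
\<close>

section \<open>Quaternions, slices and spheres\<close>

lemma quat_of_real_sel [simp]:
  "qRe (of_real r) = r" "qI (of_real r) = 0" "qJ (of_real r) = 0" "qK (of_real r) = 0"
  by (simp_all add: of_real_def)

lemma quat_i_sel [simp]: "qRe quat_i = 0" "qI quat_i = 1" "qJ quat_i = 0" "qK quat_i = 0"
  by (simp_all add: quat_i_def)

lemma quat_j_sel [simp]: "qRe quat_j = 0" "qI quat_j = 0" "qJ quat_j = 1" "qK quat_j = 0"
  by (simp_all add: quat_j_def)

lemma quat_k_sel [simp]: "qRe quat_k = 0" "qI quat_k = 0" "qJ quat_k = 0" "qK quat_k = 1"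
  by (simp_all add: quat_k_def)

lemma imag_units_iff:
  "I \<in> imag_units \<longleftrightarrow> qRe I = 0 \<and> (qI I)\<^sup>2 + (qJ I)\<^sup>2 + (qK I)\<^sup>2 = 1"
proof
  assume "I \<in> imag_units"
  then have I: "I * I = - 1"
    by (simp add: imag_units_def power2_eq_square)
  have re: "qRe I * qRe I - qI I * qI I - qJ I * qJ I - qK I * qK I = - 1"
    using arg_cong[OF I, of qRe] by simp
  have im: "qRe I * qI I = 0" "qRe I * qJ I = 0" "qRe I * qK I = 0"
    using arg_cong[OF I, of qI] arg_cong[OF I, of qJ] arg_cong[OF I, of qK]
    by (auto simp: algebra_simps)
  have "qRe I = 0"
  proof (rule ccontr)
    assume "qRe I \<noteq> 0"
    with im re have "qRe I * qRe I = - 1"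
      by simp
    moreover have "0 \<le> qRe I * qRe I"
      by simp
    ultimately show False
      by linarith
  qed
  with re show "qRe I = 0 \<and> (qI I)\<^sup>2 + (qJ I)\<^sup>2 + (qK I)\<^sup>2 = 1"
    by (simp add: power2_eq_square)
next
  assume "qRe I = 0 \<and> (qI I)\<^sup>2 + (qJ I)\<^sup>2 + (qK I)\<^sup>2 = 1"
  then show "I \<in> imag_units"
    by (simp add: imag_units_def power2_eq_square quat_eq_iff)
qed

lemma quat_i_imag_unit [simp]: "quat_i \<in> imag_units"
  and quat_j_imag_unit [simp]: "quat_j \<in> imag_units"
  by (simp_all add: imag_units_iff)

lemma imag_unit_mult_self: "I \<in> imag_units \<Longrightarrow> I * I = - 1"
  by (simp add: imag_units_def power2_eq_square)

lemma imag_unit_mult_self_left: "I \<in> imag_units \<Longrightarrow> I * (I * x) = - x" for x :: quat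
  using imag_unit_mult_self[of I] by (simp flip: mult.assoc)

lemma imag_unit_uminus: "I \<in> imag_units \<Longrightarrow> - I \<in> imag_units"
  by (simp add: imag_units_def)

definition slice_point :: "quat \<Rightarrow> complex \<Rightarrow> quat" where
  "slice_point I z = of_real (Re z) + I * of_real (Im z)"

lemma slice_point_sel [simp]:
  assumes "I \<in> imag_units"
  shows "qRe (slice_point I z) = Re z" "qI (slice_point I z) = qI I * Im z"
    "qJ (slice_point I z) = qJ I * Im z" "qK (slice_point I z) = qK I * Im z"
  using assms by (simp_all add: slice_point_def imag_units_iff)

lemma slice_point_Complex: "of_real x + I * of_real y = slice_point I (Complex x y)"
  by (simp add: slice_point_def)

lemma slice_point_uminus: "slice_point (- I) z = slice_point I (cnj z)"
  by (simp add: slice_point_def)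

lemma slice_point_add: "slice_point I (z + w) = slice_point I z + slice_point I w"
  by (simp add: slice_point_def algebra_simps)

lemma slice_point_mult:
  assumes "I \<in> imag_units"
  shows "slice_point I (z * w) = slice_point I z * slice_point I w"
proof -
  have eq: "slice_point I u = Re u *\<^sub>R 1 + Im u *\<^sub>R I" for u
    by (simp add: slice_point_def quat_eq_iff)
  show ?thesis
    by (simp add: eq algebra_simps imag_unit_mult_self[OF assms])
qed

lemma slice_point_power:
  "I \<in> imag_units \<Longrightarrow> slice_point I (z ^ n) = slice_point I z ^ n"
proof (induction n)
  case 0
  then show ?case by (simp add: slice_point_def)
next
  case (Suc n)
  then show ?case by (simp add: slice_point_mult)
qed

lemma slice_point_of_real [simp]: "slice_point I (of_real r) = of_real r"
  by (simp add: slice_point_def)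

lemma slice_eq_range: "slice I = range (slice_point I)"
proof -
  have "of_real x + I * of_real y \<in> range (slice_point I)" for x y
    by (metis range_eqI slice_point_Complex)
  moreover have "slice_point I z \<in> slice I" for z
    by (auto simp: slice_def slice_point_def)
  ultimately show ?thesis
    by (auto simp: slice_def)
qed

text \<open>
  The point of the closed upper half-plane that the sphere of a quaternion meets: two quaternions
  lie on the same sphere if and only if this invariant agrees, so that circular sets and slice
  functions are controlled by it.
\<close>
definition upper :: "quat \<Rightarrow> complex" where
  "upper q = Complex (qRe q) (sqrt ((qI q)\<^sup>2 + (qJ q)\<^sup>2 + (qK q)\<^sup>2))"

lemma upper_sel [simp]: "Re (upper q) = qRe q"
  "Im (upper q) = sqrt ((qI q)\<^sup>2 + (qJ q)\<^sup>2 + (qK q)\<^sup>2)"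
  by (simp_all add: upper_def)

lemma upper_slice_point:
  assumes "I \<in> imag_units"
  shows "upper (slice_point I z) = (if Im z \<ge> 0 then z else cnj z)"
proof -
  have "(qI I * Im z)\<^sup>2 + (qJ I * Im z)\<^sup>2 + (qK I * Im z)\<^sup>2
      = ((qI I)\<^sup>2 + (qJ I)\<^sup>2 + (qK I)\<^sup>2) * (Im z)\<^sup>2"
    by (simp add: algebra_simps power_mult_distrib)
  also have "\<dots> = (Im z)\<^sup>2"
    using assms by (simp add: imag_units_iff)
  finally show ?thesis
    using assms by (auto simp: complex_eq_iff)
qed

lemma upper_slice_point_cases:
  assumes "I \<in> imag_units"
  shows "upper (slice_point I z) = z \<or> upper (slice_point I z) = cnj z"
  using upper_slice_point[OF assms] by auto

lemma obtain_slice_point_upper: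
  obtains I where "I \<in> imag_units" "q = slice_point I (upper q)"
proof (cases "Im (upper q) = 0")
  case True
  have "0 \<le> (qI q)\<^sup>2" "0 \<le> (qJ q)\<^sup>2" "0 \<le> (qK q)\<^sup>2"
    by simp_all
  with True have "(qI q)\<^sup>2 = 0 \<and> (qJ q)\<^sup>2 = 0 \<and> (qK q)\<^sup>2 = 0"
    unfolding upper_sel real_sqrt_eq_zero_cancel_iff by (smt (verit))
  with True have "q = slice_point quat_i (upper q)"
    by (simp add: quat_eq_iff)
  then show ?thesis
    by (rule that[OF quat_i_imag_unit])
next
  case False
  define r where "r = sqrt ((qI q)\<^sup>2 + (qJ q)\<^sup>2 + (qK q)\<^sup>2)"
  define I where "I = (q - of_real (qRe q)) /\<^sub>R r"
  have r: "r \<noteq> 0"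
    using False by (simp add: r_def)
  have rr: "r\<^sup>2 = (qI q)\<^sup>2 + (qJ q)\<^sup>2 + (qK q)\<^sup>2"
    by (simp add: r_def)
  have "(qI I)\<^sup>2 + (qJ I)\<^sup>2 + (qK I)\<^sup>2 = ((qI q)\<^sup>2 + (qJ q)\<^sup>2 + (qK q)\<^sup>2) / r\<^sup>2"
    by (simp add: I_def power_mult_distrib power_divide divide_inverse power_inverse algebra_simps)
  then have "I \<in> imag_units"
    using r by (simp add: imag_units_iff I_def flip: rr)
  moreover have "q = slice_point I (upper q)"
    using r by (simp add: slice_point_def quat_eq_iff I_def flip: r_def)
  ultimately show ?thesis
    using that by blast
qed

lemma qsphere_slice_point_iff:
  assumes I: "I \<in> imag_units"
  shows "q \<in> qsphere (slice_point I z) \<longleftrightarrow> upper q = upper (slice_point I z)"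
proof
  assume "q \<in> qsphere (slice_point I z)"
  then obtain x y J I' where q: "q = slice_point J (Complex x y)" "J \<in> imag_units" "I' \<in> imag_units"
      "slice_point I z = slice_point I' (Complex x y)"
    unfolding qsphere_def by (auto simp: slice_point_Complex)
  then show "upper q = upper (slice_point I z)"
    by (simp add: upper_slice_point)
next
  assume eq: "upper q = upper (slice_point I z)"
  obtain J where J: "J \<in> imag_units" "q = slice_point J (upper q)"
    using obtain_slice_point_upper by blast
  obtain I' where "I' \<in> imag_units" "slice_point I z = slice_point I' (upper q)"
    using obtain_slice_point_upper[of "slice_point I z"] by (auto simp: eq)
  with J show "q \<in> qsphere (slice_point I z)"
    unfolding qsphere_def by (auto simp: slice_point_def)
qed

lemma qsphere_iff: "q \<in> qsphere p \<longleftrightarrow> upper q = upper p"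
  by (metis obtain_slice_point_upper qsphere_slice_point_iff)

lemma circularD: "circular \<Omega> \<Longrightarrow> p \<in> \<Omega> \<Longrightarrow> upper q = upper p \<Longrightarrow> q \<in> \<Omega>"
  unfolding circular_def by (metis qsphere_iff subsetD)

lemma circular_Int: "circular A \<Longrightarrow> circular B \<Longrightarrow> circular (A \<inter> B)"
  unfolding circular_def by blast

lemma circular_upper_vimage: "circular {q. upper q \<in> W}"
  by (simp add: circular_def qsphere_iff subset_iff)

lemma bounded_linear_quat_sel:
  "bounded_linear qRe" "bounded_linear qI" "bounded_linear qJ" "bounded_linear qK"
proof -
  have le: "\<bar>inner u x\<bar> \<le> norm x * 1" if "norm u = 1" for u x :: quat
    using Cauchy_Schwarz_ineq2[of u x] that by simp
  have unit: "norm (1 :: quat) = 1" "norm quat_i = 1" "norm quat_j = 1" "norm quat_k = 1"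
    by (simp_all add: norm_quat_def inner_quat_def)
  have eqs: "qRe x = inner 1 x" "qI x = inner quat_i x" "qJ x = inner quat_j x" "qK x = inner quat_k x"
    for x
    by (simp_all add: inner_quat_def)
  show "bounded_linear qRe" "bounded_linear qI" "bounded_linear qJ" "bounded_linear qK"
    unfolding eqs[abs_def] by (rule bounded_linear_inner_right)+
qed

lemmas continuous_on_quat_sel [continuous_intros] =
  bounded_linear_quat_sel[THEN bounded_linear.continuous_on]

lemma continuous_on_upper: "continuous_on S upper"
  unfolding upper_def Complex_eq by (intro continuous_intros)

lemma continuous_on_slice_point: "continuous_on S (slice_point I)"
  unfolding slice_point_def by (intro continuous_intros)

subsection \<open>The trace of a circular set on one slice\<close>

text \<open>
  By circularity the slice through \<open>i\<close> carries all information about a circular set; the trace there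
  is symmetric under complex conjugation.
\<close>
definition trace_set :: "quat set \<Rightarrow> complex set" where
  "trace_set \<Omega> = slice_point quat_i -` \<Omega>"

lemma open_trace_set: "open \<Omega> \<Longrightarrow> open (trace_set \<Omega>)"
  unfolding trace_set_def by (intro open_vimage continuous_on_slice_point)

lemma trace_set_mono: "A \<subseteq> B \<Longrightarrow> trace_set A \<subseteq> trace_set B"
  by (auto simp: trace_set_def)

lemma trace_set_Int: "trace_set (A \<inter> B) = trace_set A \<inter> trace_set B"
  by (auto simp: trace_set_def)

lemma slice_point_mem_iff:
  assumes "circular \<Omega>" "I \<in> imag_units"
  shows "slice_point I z \<in> \<Omega> \<longleftrightarrow> z \<in> trace_set \<Omega>"
proof -
  have "upper (slice_point I z) = upper (slice_point quat_i z)"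
    using assms by (simp add: upper_slice_point)
  then show ?thesis
    using circularD[OF assms(1)] unfolding trace_set_def vimage_eq by metis
qed

lemma cnj_mem_trace_set_iff:
  assumes "circular \<Omega>"
  shows "cnj z \<in> trace_set \<Omega> \<longleftrightarrow> z \<in> trace_set \<Omega>"
  using slice_point_mem_iff[OF assms imag_unit_uminus[OF quat_i_imag_unit], of z]
  by (simp add: slice_point_uminus) (simp add: trace_set_def)

lemma upper_mem_trace_set_iff:
  assumes "circular \<Omega>"
  shows "upper q \<in> trace_set \<Omega> \<longleftrightarrow> q \<in> \<Omega>"
  by (metis assms obtain_slice_point_upper slice_point_mem_iff)

lemma trace_set_upper_vimage:
  assumes "\<And>z. cnj z \<in> W \<longleftrightarrow> z \<in> W"
  shows "trace_set {q. upper q \<in> W} = W"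
  using assms by (auto simp: trace_set_def upper_slice_point split: if_splits)

lemma open_upper_vimage: "open W \<Longrightarrow> open {q. upper q \<in> W}"
  using open_vimage[OF _ continuous_on_upper[of UNIV], of W] by (simp add: vimage_def)

lemma trace_set_eq_upper_image:
  assumes "circular \<Omega>"
  shows "trace_set \<Omega> = upper ` \<Omega> \<union> cnj ` upper ` \<Omega>"
proof -
  have "z \<in> upper ` \<Omega> \<union> cnj ` upper ` \<Omega>" if z: "z \<in> trace_set \<Omega>" for z
  proof -
    have "slice_point quat_i z \<in> \<Omega>"
      using z by (simp add: trace_set_def)
    moreover have "z = upper (slice_point quat_i z) \<or> z = cnj (upper (slice_point quat_i z))"
      by (simp add: upper_slice_point)
    ultimately show ?thesis
      by blast
  qed
  then show ?thesis
    using assms by (auto simp: upper_mem_trace_set_iff cnj_mem_trace_set_iff)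
qed

section \<open>Slice functions as pairs of complex functions\<close>

definition quat_of :: "complex \<Rightarrow> complex \<Rightarrow> quat" where
  "quat_of \<alpha> \<beta> = Quat (Re \<alpha>) (Im \<alpha>) (Re \<beta>) (Im \<beta>)"

definition quat_fst :: "quat \<Rightarrow> complex" where
  "quat_fst q = Complex (qRe q) (qI q)"

definition quat_snd :: "quat \<Rightarrow> complex" where
  "quat_snd q = Complex (qJ q) (qK q)"

lemma quat_of_sel [simp]: "qRe (quat_of \<alpha> \<beta>) = Re \<alpha>" "qI (quat_of \<alpha> \<beta>) = Im \<alpha>"
  "qJ (quat_of \<alpha> \<beta>) = Re \<beta>" "qK (quat_of \<alpha> \<beta>) = Im \<beta>"
  by (simp_all add: quat_of_def)

lemma quat_fst_sel [simp]: "Re (quat_fst q) = qRe q" "Im (quat_fst q) = qI q"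
  by (simp_all add: quat_fst_def)

lemma quat_snd_sel [simp]: "Re (quat_snd q) = qJ q" "Im (quat_snd q) = qK q"
  by (simp_all add: quat_snd_def)

lemma quat_of_fst_snd [simp]: "quat_of (quat_fst q) (quat_snd q) = q"
  by (simp add: quat_eq_iff)

text \<open>
  If \<open>E(z) = a(z) + b(z) j\<close> are the values of a slice function at \<open>x + i y\<close>, then its even and odd
  stem functions are \<open>(E(z) + E(cnj z)) / 2\<close> and \<open>- i (E(z) - E(cnj z)) / 2\<close>.
\<close>
definition stem_even :: "(complex \<Rightarrow> complex) \<Rightarrow> (complex \<Rightarrow> complex) \<Rightarrow> complex \<Rightarrow> quat" where
  "stem_even a b z = (quat_of (a z) (b z) + quat_of (a (cnj z)) (b (cnj z))) /\<^sub>R 2"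

definition stem_odd :: "(complex \<Rightarrow> complex) \<Rightarrow> (complex \<Rightarrow> complex) \<Rightarrow> complex \<Rightarrow> quat" where
  "stem_odd a b z = (quat_i * (quat_of (a (cnj z)) (b (cnj z)) - quat_of (a z) (b z))) /\<^sub>R 2"

text \<open>
  The unique slice function that equals \<open>a + b j\<close> on the slice through \<open>i\<close>. At a real \<open>q\<close> the
  imaginary unit is replaced by \<open>0\<close>, which is harmless as the odd part vanishes there.
\<close>
definition lift :: "(complex \<Rightarrow> complex) \<Rightarrow> (complex \<Rightarrow> complex) \<Rightarrow> quat \<Rightarrow> quat" where
  "lift a b q = stem_even a b (upper q)
     + ((q - of_real (qRe q)) /\<^sub>R Im (upper q)) * stem_odd a b (upper q)"

text \<open>
  Schwarz reflection. It describes how \<open>j\<close> moves past a holomorphic function: \<open>j\<close> conjugates the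
  coefficients of a power series in \<open>z\<close> but leaves \<open>z\<close> in place, so that \<open>j a = mirror a j\<close>.
\<close>
definition mirror :: "(complex \<Rightarrow> complex) \<Rightarrow> complex \<Rightarrow> complex" where
  "mirror a z = cnj (a (cnj z))"

lemma mirror_mirror [simp]: "mirror (mirror a) = a"
  by (simp add: mirror_def fun_eq_iff)

lemma stem_even_cnj [simp]: "stem_even a b (cnj z) = stem_even a b z"
  by (simp add: stem_even_def add.commute)

lemma stem_odd_cnj [simp]: "stem_odd a b (cnj z) = - stem_odd a b z"
  by (simp add: stem_odd_def algebra_simps)

lemma lift_slice_point:
  assumes I: "I \<in> imag_units"
  shows "lift a b (slice_point I z) = stem_even a b z + I * stem_odd a b z"
proof -
  have vec: "slice_point I z - of_real (qRe (slice_point I z)) = Im z *\<^sub>R I"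
    using I by (simp add: quat_eq_iff imag_units_iff)
  consider "Im z > 0" | "Im z < 0" | "Im z = 0"
    by linarith
  then show ?thesis
  proof cases
    case 1
    then show ?thesis
      unfolding lift_def vec upper_slice_point[OF I] by simp
  next
    case 2
    then show ?thesis
      unfolding lift_def vec upper_slice_point[OF I] by simp
  next
    case 3
    then have "cnj z = z"
      by (simp add: complex_eq_iff)
    then have "stem_odd a b z = 0"
      by (simp add: stem_odd_def)
    with 3 show ?thesis
      unfolding lift_def vec upper_slice_point[OF I] by simp
  qed
qed

lemma lift_slice_point_i [simp]: "lift a b (slice_point quat_i z) = quat_of (a z) (b z)"
  by (simp add: lift_slice_point stem_even_def stem_odd_def quat_eq_iff field_simps)

lemma lift_add: "lift a b q + lift c d q = lift (\<lambda>z. a z + c z) (\<lambda>z. b z + d z) q"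
proof -
  have "quat_of (\<alpha> + \<gamma>) (\<beta> + \<delta>) = quat_of \<alpha> \<beta> + quat_of \<gamma> \<delta>" for \<alpha> \<beta> \<gamma> \<delta>
    by (simp add: quat_eq_iff)
  then show ?thesis
    by (simp add: lift_def stem_even_def stem_odd_def algebra_simps)
qed

lemma lift_cong:
  assumes "a (upper q) = a' (upper q)" "b (upper q) = b' (upper q)"
    "a (cnj (upper q)) = a' (cnj (upper q))" "b (cnj (upper q)) = b' (cnj (upper q))"
  shows "lift a b q = lift a' b' q"
  using assms by (simp add: lift_def stem_even_def stem_odd_def)

text \<open>
  The two components of \<open>(a + b j) * (c + d j)\<close>, obtained from \<open>j c = mirror c j\<close> and \<open>j j = - 1\<close>.
\<close>
definition prod_fst ::
    "(complex \<Rightarrow> complex) \<Rightarrow> (complex \<Rightarrow> complex) \<Rightarrow> (complex \<Rightarrow> complex) \<Rightarrow> (complex \<Rightarrow> complex)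
      \<Rightarrow> complex \<Rightarrow> complex" where
  "prod_fst a b c d z = a z * c z - b z * mirror d z"

definition prod_snd ::
    "(complex \<Rightarrow> complex) \<Rightarrow> (complex \<Rightarrow> complex) \<Rightarrow> (complex \<Rightarrow> complex) \<Rightarrow> (complex \<Rightarrow> complex)
      \<Rightarrow> complex \<Rightarrow> complex" where
  "prod_snd a b c d z = a z * d z + b z * mirror c z"

lemma stem_even_prod:
  "stem_even (prod_fst a b c d) (prod_snd a b c d) z =
     stem_even a b z * stem_even c d z - stem_odd a b z * stem_odd c d z"
  by (simp add: stem_even_def stem_odd_def prod_fst_def prod_snd_def mirror_def quat_eq_iff
      algebra_simps)

lemma stem_odd_prod:
  "stem_odd (prod_fst a b c d) (prod_snd a b c d) z =
     stem_even a b z * stem_odd c d z + stem_odd a b z * stem_even c d z"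
  by (simp add: stem_even_def stem_odd_def prod_fst_def prod_snd_def mirror_def quat_eq_iff
      algebra_simps)

lemma lift_prod_slice_point:
  assumes "I \<in> imag_units"
  shows "lift (prod_fst a b c d) (prod_snd a b c d) (slice_point I z) =
    lift a b (slice_point I z) * stem_even c d z + I * lift a b (slice_point I z) * stem_odd c d z"
  by (simp add: lift_slice_point[OF assms] stem_even_prod stem_odd_prod algebra_simps
      imag_unit_mult_self_left[OF assms])

text \<open>
  For \<open>u = f(q) \<noteq> 0\<close> and \<open>q = x + I y\<close>, conjugating \<open>q\<close> by \<open>u\<close> moves it to \<open>x + J y\<close> with
  \<open>u J = I u\<close>. Hence \<open>u (G\<^sub>1 + J G\<^sub>2) = u G\<^sub>1 + I u G\<^sub>2\<close>, a formula that also gives \<open>0\<close> when \<open>u = 0\<close>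
  and depends on the stem functions only.
\<close>
lemma star_lift:
  assumes "circular B" "q \<in> B" and f: "f q = lift a b q" and g: "\<And>p. p \<in> B \<Longrightarrow> g p = lift c d p"
  shows "star f g q = lift (prod_fst a b c d) (prod_snd a b c d) q"
proof -
  obtain I where I: "I \<in> imag_units" and q: "q = slice_point I (upper q)"
    by (rule obtain_slice_point_upper)
  define z where "z = upper q"
  have prod: "lift (prod_fst a b c d) (prod_snd a b c d) q =
      f q * stem_even c d z + I * f q * stem_odd c d z"
    using lift_prod_slice_point[OF I, of a b c d z] q f by (simp flip: z_def)
  show ?thesis
  proof (cases "f q = 0")
    case True
    then show ?thesis
      by (simp add: star_def prod)
  next
    case False
    define J where "J = inverse (f q) * I * f q"
    have fJ: "f q * J = I * f q"
      using False by (simp add: J_def flip: mult.assoc)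
    have "J * J = inverse (f q) * I * (f q * J)"
      by (simp add: J_def mult.assoc)
    also have "\<dots> = inverse (f q) * (I * I) * f q"
      by (simp only: fJ mult.assoc)
    also have "\<dots> = - 1"
      using False by (simp add: imag_unit_mult_self[OF I])
    finally have J: "J \<in> imag_units"
      by (simp add: imag_units_def power2_eq_square)
    have conj: "inverse (f q) * q * f q = slice_point J z"
    proof -
      have "inverse (f q) * slice_point I z * f q
          = inverse (f q) * (Re z *\<^sub>R f q) + inverse (f q) * (Im z *\<^sub>R (I * f q))"
        by (simp add: slice_point_def of_real_def algebra_simps)
      also have "\<dots> = slice_point J z"
        using False by (simp add: slice_point_def of_real_def J_def mult.assoc)
      finally show ?thesis
        using q by (simp flip: z_def)
    qed
    have "upper (slice_point J z) = upper q"
      using q I J by (metis upper_slice_point z_def)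
    then have "slice_point J z \<in> B"
      using circularD assms(1,2) by blast
    then have "star f g q = f q * (stem_even c d z + J * stem_odd c d z)"
      unfolding star_def conj using False by (simp add: g lift_slice_point[OF J])
    also have "\<dots> = f q * stem_even c d z + (f q * J) * stem_odd c d z"
      by (simp add: algebra_simps)
    finally show ?thesis
      by (simp only: prod fJ)
  qed
qed

section \<open>Slice regularity and holomorphy\<close>

definition slice_fst :: "(quat \<Rightarrow> quat) \<Rightarrow> complex \<Rightarrow> complex" where
  "slice_fst f z = quat_fst (f (slice_point quat_i z))"

definition slice_snd :: "(quat \<Rightarrow> quat) \<Rightarrow> complex \<Rightarrow> complex" where
  "slice_snd f z = quat_snd (f (slice_point quat_i z))"

lemma bounded_linear_quat_fst: "bounded_linear quat_fst"
proof -
  have eq: "quat_fst = (\<lambda>q. of_real (qRe q) + \<i> * of_real (qI q))"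
    by (simp add: fun_eq_iff complex_eq_iff)
  show ?thesis
    unfolding eq by (intro bounded_linear_add bounded_linear_const_mult bounded_linear_quat_sel
        bounded_linear_compose[OF bounded_linear_of_real])
qed

lemma bounded_linear_quat_snd: "bounded_linear quat_snd"
proof -
  have eq: "quat_snd = (\<lambda>q. of_real (qJ q) + \<i> * of_real (qK q))"
    by (simp add: fun_eq_iff complex_eq_iff)
  show ?thesis
    unfolding eq by (intro bounded_linear_add bounded_linear_const_mult bounded_linear_quat_sel
        bounded_linear_compose[OF bounded_linear_of_real])
qed

lemma quat_fst_slice_point_mult [simp]: "quat_fst (slice_point quat_i c * q) = c * quat_fst q"
  by (simp add: complex_eq_iff)

lemma quat_snd_slice_point_mult [simp]: "quat_snd (slice_point quat_i c * q) = c * quat_snd q"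
  by (simp add: complex_eq_iff)

text \<open>
  The slice equation says that the derivative commutes with left multiplication by \<open>i\<close>. Any
  projection \<open>P\<close> to the complex numbers that turns left multiplication by \<open>\<complex>\<^sub>i\<close> into complex
  multiplication therefore makes it complex linear; the lemma is for the two coordinates of
  \<open>\<alpha> + \<beta> j\<close>.
\<close>
lemma holomorphic_of_left_Cauchy_Riemann:
  fixes f :: "quat \<Rightarrow> quat"
  assumes S: "open S" and P: "bounded_linear P" and Pi: "\<And>c q. P (slice_point quat_i c * q) = c * P q"
    and deriv: "\<And>x y. Complex x y \<in> S \<Longrightarrow> \<exists>D.
      ((\<lambda>(u, v). f (of_real u + quat_i * of_real v)) has_derivative D) (at (x, y)) \<and>
        (1 / 2) *\<^sub>R (D (1, 0) + quat_i * D (0, 1)) = 0"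
  shows "(\<lambda>z. P (f (slice_point quat_i z))) holomorphic_on S"
proof -
  have "\<exists>f'. ((\<lambda>z. P (f (slice_point quat_i z))) has_field_derivative f') (at z)" if z: "z \<in> S" for z
  proof -
    obtain D where D: "((\<lambda>(u, v). f (of_real u + quat_i * of_real v)) has_derivative D)
          (at (Re z, Im z))" and cr: "(1 / 2) *\<^sub>R (D (1, 0) + quat_i * D (0, 1)) = 0"
      using deriv[of "Re z" "Im z"] z by (auto simp: complex_surj)
    have lin: "linear D"
      using D has_derivative_linear by blast
    have D01: "D (0, 1) = quat_i * D (1, 0)"
    proof -
      have "D (1, 0) + quat_i * D (0, 1) = 0"
        using cr by simp
      then have "quat_i * (D (1, 0) + quat_i * D (0, 1)) = 0"
        by simp
      then show ?thesis
        by (simp add: distrib_left imag_unit_mult_self_left)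
    qed
    have Dh: "D (Re h, Im h) = slice_point quat_i h * D (1, 0)" for h
    proof -
      have "D (Re h, Im h) = D (Re h *\<^sub>R (1, 0) + Im h *\<^sub>R (0, 1))"
        by simp
      also have "\<dots> = Re h *\<^sub>R D (1, 0) + Im h *\<^sub>R D (0, 1)"
        by (simp only: linear_add[OF lin] linear_scale[OF lin])
      also have "\<dots> = slice_point quat_i h * D (1, 0)"
        by (simp add: D01 slice_point_def of_real_def algebra_simps)
      finally show ?thesis .
    qed
    have "((\<lambda>w. (Re w, Im w)) has_derivative (\<lambda>h. (Re h, Im h))) (at z)"
      by (intro derivative_eq_intros) auto
    then have "((\<lambda>w. (\<lambda>(u, v). f (of_real u + quat_i * of_real v)) (Re w, Im w)) has_derivative
        (\<lambda>h. D (Re h, Im h))) (at z)"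
      using has_derivative_compose[of "\<lambda>w. (Re w, Im w)" _ z UNIV, OF _ D] by simp
    then have "((\<lambda>w. f (slice_point quat_i w)) has_derivative
        (\<lambda>h. slice_point quat_i h * D (1, 0))) (at z)"
      by (simp add: slice_point_def Dh)
    then have "((\<lambda>w. P (f (slice_point quat_i w))) has_derivative
        (\<lambda>h. P (slice_point quat_i h * D (1, 0)))) (at z)"
      by (rule bounded_linear.has_derivative[OF P])
    then have "((\<lambda>w. P (f (slice_point quat_i w))) has_field_derivative P (D (1, 0))) (at z)"
      by (simp add: has_field_derivative_def Pi mult.commute[of _ "P (D (1, 0))"])
    then show ?thesis ..
  qed
  then show ?thesis
    using S by (simp add: holomorphic_on_open)
qed

lemma slice_regular_on_imp_holomorphic:
  assumes "open \<Omega>" "slice_regular_on \<Omega> f"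
  shows "slice_fst f holomorphic_on trace_set \<Omega>" "slice_snd f holomorphic_on trace_set \<Omega>"
proof -
  have deriv: "\<exists>D. ((\<lambda>(u, v). f (of_real u + quat_i * of_real v)) has_derivative D) (at (x, y)) \<and>
      (1 / 2) *\<^sub>R (D (1, 0) + quat_i * D (0, 1)) = 0" if "Complex x y \<in> trace_set \<Omega>" for x y
    using assms(2) that unfolding slice_regular_on_def
    by (simp add: trace_set_def slice_point_Complex)
  note L = holomorphic_of_left_Cauchy_Riemann[OF open_trace_set[OF assms(1)] _ _ deriv]
  show "slice_fst f holomorphic_on trace_set \<Omega>" "slice_snd f holomorphic_on trace_set \<Omega>"
    using L[OF bounded_linear_quat_fst] L[OF bounded_linear_quat_snd]
    by (simp_all add: slice_fst_def[abs_def] slice_snd_def[abs_def])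
qed

lemma slice_regular_on_imp_lift:
  assumes circ: "circular \<Omega>" and reg: "slice_regular_on \<Omega> f" and q: "q \<in> \<Omega>"
  shows "f q = lift (slice_fst f) (slice_snd f) q"
proof -
  obtain F1 F2 :: "real \<Rightarrow> real \<Rightarrow> quat" where
    even: "\<And>x y. F1 x (- y) = F1 x y" and odd: "\<And>x y. F2 x (- y) = - F2 x y" and
    F: "\<And>I x y. I \<in> imag_units \<Longrightarrow> of_real x + I * of_real y \<in> \<Omega> \<Longrightarrow>
           f (of_real x + I * of_real y) = F1 x y + I * F2 x y"
    using reg unfolding slice_regular_on_def by blast
  have F': "f (slice_point I z) = F1 (Re z) (Im z) + I * F2 (Re z) (Im z)"
    if "I \<in> imag_units" "z \<in> trace_set \<Omega>" for I z
    using F[of I "Re z" "Im z"] that slice_point_mem_iff[OF circ] by (simp flip: slice_point_def)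
  obtain I where I: "I \<in> imag_units" and qI: "q = slice_point I (upper q)"
    by (rule obtain_slice_point_upper)
  define z where "z = upper q"
  have z: "z \<in> trace_set \<Omega>" "cnj z \<in> trace_set \<Omega>"
    using q circ by (simp_all add: z_def upper_mem_trace_set_iff cnj_mem_trace_set_iff)
  define G1 G2 where "G1 = F1 (Re z) (Im z)" and "G2 = F2 (Re z) (Im z)"
  have E: "quat_of (slice_fst f z) (slice_snd f z) = G1 + quat_i * G2"
    using z by (simp add: slice_fst_def slice_snd_def F' G1_def G2_def)
  have E': "quat_of (slice_fst f (cnj z)) (slice_snd f (cnj z)) = G1 - quat_i * G2"
    using z by (simp add: slice_fst_def slice_snd_def F' G1_def G2_def even odd)
  have "stem_even (slice_fst f) (slice_snd f) z = G1" "stem_odd (slice_fst f) (slice_snd f) z = G2"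
    by (simp_all add: stem_even_def stem_odd_def E E' algebra_simps quat_eq_iff)
  then have "lift (slice_fst f) (slice_snd f) (slice_point I z) = G1 + I * G2"
    by (simp add: lift_slice_point[OF I])
  moreover have "f (slice_point I z) = G1 + I * G2"
    using z I by (simp add: F' G1_def G2_def)
  ultimately show ?thesis
    using qI by (simp flip: z_def)
qed

lemma bounded_linear_slice_point: "bounded_linear (slice_point I)"
proof -
  have "slice_point I = (\<lambda>z. Re z *\<^sub>R 1 + Im z *\<^sub>R I)"
    by (simp add: fun_eq_iff slice_point_def of_real_def)
  then show ?thesis
    by (simp add: bounded_linear_add bounded_linear_compose[OF bounded_linear_scaleR_left]
        bounded_linear_Re bounded_linear_Im)
qed

lemma quat_of_eq: "quat_of \<alpha> \<beta> = slice_point quat_i \<alpha> + slice_point quat_i \<beta> * quat_j"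
  by (simp add: quat_eq_iff)

text \<open>
  On the slice through \<open>I\<close> the lift is \<open>c\<^sub>1 E(z) + c\<^sub>2 E(cnj z)\<close> with \<open>c\<^sub>1 = (1 - I i) / 2\<close> and
  \<open>c\<^sub>2 = (1 + I i) / 2\<close>. The identities \<open>I c\<^sub>1 = c\<^sub>1 i\<close> and \<open>I c\<^sub>2 = - c\<^sub>2 i\<close> transport the
  holomorphy of \<open>E\<close> to this slice; the sign in the second one is compensated by the conjugation.
\<close>
lemma slice_regular_on_lift:
  assumes opn: "open \<Omega>" and circ: "circular \<Omega>"
    and holo: "a holomorphic_on trace_set \<Omega>" "b holomorphic_on trace_set \<Omega>"
    and f: "\<And>q. q \<in> \<Omega> \<Longrightarrow> f q = lift a b q"
  shows "slice_regular_on \<Omega> f"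
  unfolding slice_regular_on_def
proof (intro conjI ballI allI impI)
  have "f (of_real x + I * of_real y) = stem_even a b (Complex x y) + I * stem_odd a b (Complex x y)"
    if "I \<in> imag_units" "of_real x + I * of_real y \<in> \<Omega>" for I x y
    using that f by (simp add: slice_point_Complex lift_slice_point)
  moreover have "stem_even a b (Complex x (- y)) = stem_even a b (Complex x y)"
    "stem_odd a b (Complex x (- y)) = - stem_odd a b (Complex x y)" for x y
    using stem_even_cnj[of a b "Complex x y"] stem_odd_cnj[of a b "Complex x y"]
    by (simp_all add: complex_cnj)
  ultimately show "\<exists>F1 F2. (\<forall>x y. F1 x (- y) = F1 x y) \<and> (\<forall>x y. F2 x (- y) = - F2 x y) \<and>
      (\<forall>I\<in>imag_units. \<forall>x y. of_real x + I * of_real y \<in> \<Omega> \<longrightarrow>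
        f (of_real x + I * of_real y) = F1 x y + I * F2 x y)"
    by (intro exI[of _ "\<lambda>x y. stem_even a b (Complex x y)"]
        exI[of _ "\<lambda>x y. stem_odd a b (Complex x y)"]) simp
next
  fix I x y
  assume I: "I \<in> imag_units" and xy: "of_real x + I * of_real y \<in> \<Omega>"
  define z where "z = Complex x y"
  have z: "z \<in> trace_set \<Omega>" "cnj z \<in> trace_set \<Omega>"
    using xy circ I by (simp_all add: z_def slice_point_Complex slice_point_mem_iff cnj_mem_trace_set_iff)
  define E where "E w = quat_of (a w) (b w)" for w
  define E' where "E' w = quat_of (deriv a w) (deriv b w)" for w
  have E: "(E has_derivative (\<lambda>h. slice_point quat_i h * E' w)) (at w)" if w: "w \<in> trace_set \<Omega>" for w
  proof -
    have "(a has_derivative (\<lambda>h. deriv a w * h)) (at w)" "(b has_derivative (\<lambda>h. deriv b w * h)) (at w)"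
      using holomorphic_derivI[OF holo(1) open_trace_set[OF opn] w, of UNIV]
        holomorphic_derivI[OF holo(2) open_trace_set[OF opn] w, of UNIV]
      by (simp_all add: has_field_derivative_def)
    then have "((\<lambda>w. slice_point quat_i (a w) + slice_point quat_i (b w) * quat_j) has_derivative
        (\<lambda>h. slice_point quat_i (deriv a w * h) + slice_point quat_i (deriv b w * h) * quat_j)) (at w)"
      by (intro has_derivative_add bounded_linear.has_derivative[OF bounded_linear_slice_point]
          bounded_linear.has_derivative[OF bounded_linear_mult_left])
    moreover have "slice_point quat_i (deriv a w * h) + slice_point quat_i (deriv b w * h) * quat_j =
        slice_point quat_i h * E' w" for h
      unfolding mult.commute[of _ h]
      by (simp add: E'_def quat_of_eq slice_point_mult distrib_left mult.assoc)
    ultimately show ?thesis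
      unfolding E_def[abs_def] quat_of_eq by simp
  qed
  define c1 c2 where "c1 = (1 - I * quat_i) /\<^sub>R 2" and "c2 = (1 + I * quat_i) /\<^sub>R 2"
  define T T' where "T p = Complex (fst p) (snd p)" and "T' p = Complex (fst p) (- snd p)"
    for p :: "real \<times> real"
  define D where "D p = c1 * (slice_point quat_i (T p) * E' z) + c2 * (slice_point quat_i (T' p) * E' (cnj z))"
    for p
  have T: "(T has_derivative T) (at p)" "(T' has_derivative T') (at p)" for p
    unfolding T_def[abs_def] T'_def[abs_def] Complex_eq
    by (rule derivative_eq_intros refl | simp)+
  have z_eq: "T (x, y) = z" "T' (x, y) = cnj z"
    by (simp_all add: T_def T'_def z_def complex_cnj)
  have E1: "((\<lambda>p. E (T p)) has_derivative (\<lambda>p. slice_point quat_i (T p) * E' z)) (at (x, y))"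
    using has_derivative_compose[OF T(1), of E _ "(x, y)", unfolded z_eq, OF E[OF z(1)]] .
  have E2: "((\<lambda>p. E (T' p)) has_derivative (\<lambda>p. slice_point quat_i (T' p) * E' (cnj z))) (at (x, y))"
    using has_derivative_compose[OF T(2), of E _ "(x, y)", unfolded z_eq, OF E[OF z(2)]] .
  have "((\<lambda>p. c1 * E (T p) + c2 * E (T' p)) has_derivative D) (at (x, y))"
    unfolding D_def[abs_def]
    by (intro has_derivative_add bounded_linear.has_derivative[OF bounded_linear_mult_right] E1 E2)
  moreover have "open (T -` trace_set \<Omega>)"
    by (intro open_vimage open_trace_set opn)
      (auto intro!: has_derivative_continuous_on[of UNIV T "\<lambda>_. T"] has_derivative_at_withinI T)
  moreover have "(x, y) \<in> T -` trace_set \<Omega>"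
    using z by (simp add: z_eq)
  moreover have "c1 * E (T p) + c2 * E (T' p) = (case p of (u, v) \<Rightarrow> f (of_real u + I * of_real v))"
    if "p \<in> T -` trace_set \<Omega>" for p
  proof -
    have T': "T' p = cnj (T p)"
      by (simp add: T_def T'_def complex_cnj)
    have "slice_point I (T p) \<in> \<Omega>"
      using that slice_point_mem_iff[OF circ I] by simp
    then have "f (slice_point I (T p)) = stem_even a b (T p) + I * stem_odd a b (T p)"
      using f by (simp add: lift_slice_point[OF I])
    also have "\<dots> = c1 * E (T p) + c2 * E (T' p)"
      by (simp add: c1_def c2_def E_def T' stem_even_def stem_odd_def algebra_simps)
    finally show ?thesis
      by (simp add: slice_point_def T_def split_beta)
  qed
  ultimately have "((\<lambda>(u, v). f (of_real u + I * of_real v)) has_derivative D) (at (x, y))"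
    by (rule has_derivative_transform_within_open)
  moreover have "D (1, 0) + I * D (0, 1) = 0"
  proof -
    have 1: "T (1, 0) = 1" "T' (1, 0) = 1" "T (0, 1) = \<i>" "T' (0, 1) = - \<i>"
      by (simp_all add: T_def T'_def complex_eq_iff)
    have 2: "slice_point quat_i 1 = 1" "slice_point quat_i \<i> = quat_i" "slice_point quat_i (- \<i>) = - quat_i"
      by (simp_all add: slice_point_def)
    have 3: "c1 + I * (c1 * quat_i) = 0" "c2 - I * (c2 * quat_i) = 0"
      using imag_unit_mult_self[OF I] imag_unit_mult_self[OF quat_i_imag_unit]
      by (simp_all add: c1_def c2_def algebra_simps imag_unit_mult_self_left[OF I])
    have "D (1, 0) + I * D (0, 1) =
        (c1 + I * (c1 * quat_i)) * E' z + (c2 - I * (c2 * quat_i)) * E' (cnj z)"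
      by (simp add: D_def 1 2 algebra_simps)
    then show ?thesis
      by (simp add: 3)
  qed
  ultimately show "\<exists>D. ((\<lambda>(u, v). f (of_real u + I * of_real v)) has_derivative D) (at (x, y)) \<and>
      (1 / 2) *\<^sub>R (D (1, 0) + I * D (0, 1)) = 0"
    by (intro exI[of _ D]) simp
qed

section \<open>Semi-regularity and meromorphy\<close>

text \<open>
  A bound that holds for all large exponents lets one exponent serve both components at both
  conjugate points of a singular sphere.
\<close>
lemma meromorphic_at_tendsto_power_mult:
  assumes "f meromorphic_on {z0}"
  shows "\<exists>m0. \<forall>m\<ge>m0. \<exists>c. (\<lambda>z. (z - z0) ^ m * f z) \<midarrow>z0\<rightarrow> c"
proof (cases "\<exists>\<^sub>F z in at z0. f z \<noteq> 0")
  case False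
  then have ev: "\<forall>\<^sub>F z in at z0. f z = 0"
    by (simp add: frequently_def)
  have "(\<lambda>z. (z - z0) ^ m * f z) \<midarrow>z0\<rightarrow> 0" for m
    by (rule tendsto_eventually) (use ev in eventually_elim, simp)
  then show ?thesis
    by blast
next
  case True
  define n where "n = zorder f z0"
  define g where "g = zor_poly f z0"
  obtain r where r: "r > 0" "g holomorphic_on cball z0 r"
    "\<And>w. w \<in> cball z0 r - {z0} \<Longrightarrow> f w = g w * (w - z0) powi n"
    using zorder_exist[of f z0] True assms unfolding meromorphic_at_iff n_def g_def by metis
  have "\<exists>c. (\<lambda>z. (z - z0) ^ m * f z) \<midarrow>z0\<rightarrow> c" if m: "m \<ge> nat (- n)" for m
  proof -
    define k where "k = nat (int m + n)"
    have k: "int m + n = int k"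
      using m by (simp add: k_def)
    have "continuous_on (ball z0 r) g"
      by (intro holomorphic_on_imp_continuous_on holomorphic_on_subset[OF r(2)] ball_subset_cball)
    then have "isCont g z0"
      using r(1) by (simp add: continuous_on_eq_continuous_at)
    then have "(\<lambda>z. (z - z0) ^ k * g z) \<midarrow>z0\<rightarrow> (z0 - z0) ^ k * g z0"
      by (intro tendsto_intros) (simp add: isCont_def)
    moreover have "\<forall>\<^sub>F z in at z0. (z - z0) ^ k * g z = (z - z0) ^ m * f z"
    proof -
      have "\<forall>\<^sub>F z in at z0. z \<in> ball z0 r - {z0}"
        using r(1) by (intro eventually_at_in_open) auto
      then show ?thesis
      proof eventually_elim
        case (elim z)
        then have "z - z0 \<noteq> 0"
          by auto
        then have "(z - z0) ^ k = (z - z0) ^ m * (z - z0) powi n"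
          using power_int_add[of "z - z0" "int m" n] k by simp
        then show ?case
          using r(3)[of z] elim by auto
      qed
    qed
    ultimately have "(\<lambda>z. (z - z0) ^ m * f z) \<midarrow>z0\<rightarrow> (z0 - z0) ^ k * g z0"
      by (rule Lim_transform_eventually)
    then show ?thesis ..
  qed
  then show ?thesis
    by blast
qed

text \<open>
  The sphere polynomial on a slice: it has real coefficients, so it is the same polynomial for every
  imaginary unit.
\<close>
definition char_poly :: "complex \<Rightarrow> complex \<Rightarrow> complex" where
  "char_poly w z = (z - w) * (z - cnj w)"

lemma char_poly_cnj: "char_poly w (cnj z) = cnj (char_poly w z)"
  by (simp add: char_poly_def mult.commute)

lemma sphere_poly_slice_point:
  assumes I: "I \<in> imag_units"
  shows "sphere_poly p (slice_point I z) = slice_point I (char_poly (upper p) z)"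
proof -
  define w where "w = upper p"
  have "(norm p)\<^sup>2 = (Re w)\<^sup>2 + (Im w)\<^sup>2"
    by (simp add: norm_quat_def inner_quat_def w_def power2_eq_square)
  moreover define t where "t = 2 * Re w"
  have "char_poly w z = z\<^sup>2 + of_real (- t) * z + of_real ((Re w)\<^sup>2 + (Im w)\<^sup>2)"
    by (simp add: t_def char_poly_def complex_eq_iff power2_eq_square algebra_simps)
  moreover have "2 * qRe p = t"
    by (simp add: w_def t_def)
  ultimately show ?thesis
    unfolding sphere_poly_def w_def[symmetric]
    by (simp only: slice_point_add slice_point_mult[OF I] slice_point_power[OF I] slice_point_of_real)
       simp
qed

lemma lift_mult_real:
  assumes real: "\<And>z. c (cnj z) = cnj (c z)" and I: "I \<in> imag_units"
  shows "lift (\<lambda>z. c z * a z) (\<lambda>z. c z * b z) (slice_point I z) = slice_point I (c z) * lift a b (slice_point I z)"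
proof -
  have "stem_even c (\<lambda>_. 0) w = of_real (Re (c w))" "stem_odd c (\<lambda>_. 0) w = of_real (Im (c w))" for w
    by (simp_all add: stem_even_def stem_odd_def real quat_eq_iff)
  then have "lift c (\<lambda>_. 0) (slice_point I w) = slice_point I (c w)" for w
    by (simp add: lift_slice_point[OF I]) (simp add: slice_point_def)
  moreover have "prod_fst c (\<lambda>_. 0) a b = (\<lambda>z. c z * a z)" "prod_snd c (\<lambda>_. 0) a b = (\<lambda>z. c z * b z)"
    by (simp_all add: prod_fst_def prod_snd_def fun_eq_iff)
  moreover have "I * slice_point I w = slice_point I w * I" for w
    by (simp add: slice_point_def algebra_simps of_real_def)
  ultimately show ?thesis
    using lift_prod_slice_point[OF I, of c "\<lambda>_. 0" a b z]
    by (simp add: lift_slice_point[OF I] distrib_left mult.assoc)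
qed

text \<open>
  Around a point \<open>p\<close> outside of \<open>\<Omega>'\<close>, the set \<open>\<Omega>'\<close> together with the sphere of \<open>p\<close> is already an
  admissible neighbourhood: the complement of \<open>\<Omega>'\<close> is discrete on the slice, so adding two conjugate
  points to the trace keeps it open. After multiplication by a power of the sphere polynomial the
  components have removable singularities at these two points, and the lift of the extended pair is
  the required extension.
\<close>
lemma regularity_set_lift:
  assumes opn: "open \<Omega>" and circ: "circular \<Omega>"
    and opn': "open \<Omega>'" and circ': "circular \<Omega>'" and sub: "\<Omega>' \<subseteq> \<Omega>"
    and mero: "a meromorphic_on trace_set \<Omega>" "b meromorphic_on trace_set \<Omega>"
    and holo: "a holomorphic_on trace_set \<Omega>'" "b holomorphic_on trace_set \<Omega>'"
    and dense: "\<forall>\<^sub>F z in cosparse (trace_set \<Omega>). z \<in> trace_set \<Omega>'"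
    and f: "\<And>q. q \<in> \<Omega>' \<Longrightarrow> f q = lift a b q"
  shows "regularity_set \<Omega> f \<Omega>'"
  unfolding regularity_set_def
proof (intro conjI ballI)
  show "slice_regular_on \<Omega>' f"
    by (rule slice_regular_on_lift[OF opn' circ' holo f])
next
  fix p assume p: "p \<in> \<Omega> - \<Omega>'"
  define z0 where "z0 = upper p"
  have z0: "z0 \<in> trace_set \<Omega>" "cnj z0 \<in> trace_set \<Omega>"
    using p circ by (simp_all add: z0_def upper_mem_trace_set_iff cnj_mem_trace_set_iff)
  \<comment> \<open>the trace of \<open>\<Omega>'\<close> together with the sphere of \<open>p\<close>\<close>
  define W where "W = trace_set \<Omega>' \<union> {z0, cnj z0}"
  have W_sub: "W \<subseteq> trace_set \<Omega>"
    using z0 trace_set_mono[OF sub] by (auto simp: W_def)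
  have W_cnj: "cnj z \<in> W \<longleftrightarrow> z \<in> W" for z
    by (auto simp: W_def cnj_mem_trace_set_iff[OF circ'])
  have "{z. z \<notin> trace_set \<Omega>'} sparse_in trace_set \<Omega>"
    using dense by (simp add: eventually_cosparse)
  then have "open (trace_set \<Omega> - ({z. z \<notin> trace_set \<Omega>'} - {z0, cnj z0}))"
    by (intro open_diff_sparse_pts open_trace_set opn sparse_in_subset2[OF _ Diff_subset])
  also have "trace_set \<Omega> - ({z. z \<notin> trace_set \<Omega>'} - {z0, cnj z0}) = W"
    using W_sub by (auto simp: W_def)
  finally have W_open: "open W" .
  have mero0: "c meromorphic_on {z0}" "c meromorphic_on {cnj z0}" if "c \<in> {a, b}" for c
    using mero z0 that by (auto intro: meromorphic_on_subset)
  have "\<exists>m0. \<forall>m\<ge>m0. \<exists>l. (\<lambda>z. (z - z1) ^ m * c z) \<midarrow>z1\<rightarrow> l"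
    if "z1 \<in> {z0, cnj z0}" "c \<in> {a, b}" for z1 c
    using mero0[OF that(2)] that(1) meromorphic_at_tendsto_power_mult by auto
  note ex = this
  define M where "M z1 c = (SOME m0. \<forall>m\<ge>m0. \<exists>l. (\<lambda>z. (z - z1) ^ m * c z) \<midarrow>z1\<rightarrow> l)"
    for z1 and c :: "complex \<Rightarrow> complex"
  have M: "\<exists>l. (\<lambda>z. (z - z1) ^ m * c z) \<midarrow>z1\<rightarrow> l"
    if "z1 \<in> {z0, cnj z0}" "c \<in> {a, b}" "m \<ge> M z1 c" for z1 c m
    using someI_ex[OF ex[OF that(1,2)]] that(3) unfolding M_def by blast
  define m where "m = Max {M z0 a, M z0 b, M (cnj z0) a, M (cnj z0) b}"
  have m: "m \<ge> M z1 c" if "z1 \<in> {z0, cnj z0}" "c \<in> {a, b}" for z1 c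
    using that by (auto simp: m_def)
  define ext where "ext c = remove_sings (\<lambda>z. char_poly z0 z ^ m * c z)"
    for c :: "complex \<Rightarrow> complex"
  have ana': "(\<lambda>z. char_poly z0 z ^ m * c z) analytic_on trace_set \<Omega>'" if "c \<in> {a, b}" for c
  proof -
    have "c analytic_on trace_set \<Omega>'"
      using that holo analytic_on_open[OF open_trace_set[OF opn']] by auto
    then show ?thesis
      unfolding char_poly_def by (intro analytic_intros)
  qed
  have ext_holo: "ext c holomorphic_on W" if c: "c \<in> {a, b}" for c
  proof -
    have "ext c analytic_on {z}" if z: "z \<in> W" for z
    proof (cases "z \<in> trace_set \<Omega>'")
      case True
      then show ?thesis
        unfolding ext_def
        by (intro remove_sings_analytic_on analytic_on_subset[OF ana'[OF c]]) auto
    next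
      case False
      then have z: "z \<in> {z0, cnj z0}"
        using z by (auto simp: W_def)
      then have "(\<lambda>z. char_poly z0 z ^ m * c z) meromorphic_on {z}"
        unfolding char_poly_def using mero0[OF c] by (auto intro!: meromorphic_intros)
      then have iso: "isolated_singularity_at (\<lambda>z. char_poly z0 z ^ m * c z) z"
        by (simp add: meromorphic_at_iff)
      obtain l where l: "(\<lambda>w. (w - z) ^ m * c w) \<midarrow>z\<rightarrow> l"
        using M[OF z c m[OF z c]] by blast
      have "(\<lambda>w. (w - cnj z) ^ m * ((w - z) ^ m * c w)) \<midarrow>z\<rightarrow> (z - cnj z) ^ m * l"
        by (intro tendsto_intros l)
      moreover have "(w - cnj z) ^ m * ((w - z) ^ m * c w) = char_poly z0 w ^ m * c w" for w
        using z by (auto simp: char_poly_def power_mult_distrib)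
      ultimately have "(\<lambda>w. char_poly z0 w ^ m * c w) \<midarrow>z\<rightarrow> (z - cnj z) ^ m * l"
        by simp
      then show ?thesis
        unfolding ext_def by (rule remove_sings_analytic_at[OF iso])
    qed
    then show ?thesis
      using analytic_on_analytic_at analytic_imp_holomorphic by blast
  qed
  have ext_eq: "ext c z = char_poly z0 z ^ m * c z" if "c \<in> {a, b}" "z \<in> trace_set \<Omega>'" for c z
    unfolding ext_def
    by (rule remove_sings_at_analytic) (use ana'[OF that(1)] that(2) analytic_on_subset in blast)
  define U where "U = {q. upper q \<in> W}"
  have U: "open U" "circular U" "trace_set U = W"
    unfolding U_def using W_open W_cnj
    by (simp_all add: open_upper_vimage circular_upper_vimage trace_set_upper_vimage)
  have "U \<subseteq> \<Omega>"
    using W_sub upper_mem_trace_set_iff[OF circ] by (auto simp: U_def)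
  moreover have U': "q \<in> \<Omega>'" if "q \<in> U - qsphere p" for q
  proof -
    have "upper q \<noteq> z0"
      using that by (simp add: qsphere_iff z0_def)
    moreover have "upper q \<noteq> cnj z0"
    proof
      assume q: "upper q = cnj z0"
      have "0 \<le> Im (upper q)" "0 \<le> Im z0"
        by (simp_all add: z0_def)
      with q have "cnj z0 = z0"
        by (simp add: complex_eq_iff)
      with q \<open>upper q \<noteq> z0\<close> show False
        by simp
    qed
    ultimately show ?thesis
      using that upper_mem_trace_set_iff[OF circ'] by (auto simp: U_def W_def)
  qed
  moreover have "slice_regular_on U (lift (ext a) (ext b))"
    using U ext_holo by (intro slice_regular_on_lift) auto
  moreover have "lift (ext a) (ext b) q = sphere_poly p q ^ m * f q" if q: "q \<in> U - qsphere p" for q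
  proof -
    obtain I where I: "I \<in> imag_units" and qI: "q = slice_point I (upper q)"
      by (rule obtain_slice_point_upper)
    have up: "upper q \<in> trace_set \<Omega>'" "cnj (upper q) \<in> trace_set \<Omega>'"
      using U'[OF q] circ' by (simp_all add: upper_mem_trace_set_iff cnj_mem_trace_set_iff)
    have "lift (ext a) (ext b) q =
        lift (\<lambda>z. char_poly z0 z ^ m * a z) (\<lambda>z. char_poly z0 z ^ m * b z) q"
      using up by (intro lift_cong) (simp_all add: ext_eq)
    also have "\<dots> = slice_point I (char_poly z0 (upper q) ^ m) * lift a b q"
      using lift_mult_real[of "\<lambda>z. char_poly z0 z ^ m" I a b "upper q"] I
      by (simp add: char_poly_cnj flip: qI)
    also have "slice_point I (char_poly z0 (upper q) ^ m) = sphere_poly p q ^ m"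
      using sphere_poly_slice_point[OF I, of p "upper q"]
      by (simp add: slice_point_power[OF I] z0_def flip: qI)
    finally show ?thesis
      using f U'[OF q] by simp
  qed
  moreover have "p \<in> U"
    by (simp add: U_def W_def z0_def)
  ultimately show "\<exists>U (m :: nat) h. open U \<and> circular U \<and> p \<in> U \<and> U \<subseteq> \<Omega> \<and> U - qsphere p \<subseteq> \<Omega>' \<and>
      slice_regular_on U h \<and> (\<forall>q\<in>U - qsphere p. h q = sphere_poly p q ^ m * f q)"
    using U(1,2) by (intro exI[of _ U] exI[of _ m] exI[of _ "lift (ext a) (ext b)"]) blast
qed (use assms in auto)

text \<open>
  The converse: near a singular sphere the pair of the function is the pair of the extension divided
  by a power of the sphere polynomial, and so it is meromorphic.
\<close>
lemma regularity_set_imp_cosparse: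
  assumes opn: "open \<Omega>" and reg: "regularity_set \<Omega> f \<Omega>'"
  shows "\<forall>\<^sub>F z in cosparse (trace_set \<Omega>). z \<in> trace_set \<Omega>'"
    and "slice_fst f meromorphic_on trace_set \<Omega>" "slice_snd f meromorphic_on trace_set \<Omega>"
proof -
  have opn': "open \<Omega>'" and sr: "slice_regular_on \<Omega>' f"
    using reg by (simp_all add: regularity_set_def)
  have main: "(\<forall>\<^sub>F w in at z. w \<in> trace_set \<Omega>') \<and> slice_fst f meromorphic_on {z} \<and>
      slice_snd f meromorphic_on {z}" if z: "z \<in> trace_set \<Omega>" for z
  proof (cases "z \<in> trace_set \<Omega>'")
    case True
    have "c meromorphic_on {z}" if "c holomorphic_on trace_set \<Omega>'" for c
      using that True open_trace_set[OF opn']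
      by (intro analytic_on_imp_meromorphic_on) (auto simp: analytic_at)
    then show ?thesis
      using True slice_regular_on_imp_holomorphic[OF opn' sr] open_trace_set[OF opn']
      by (auto intro: eventually_at_in_open')
  next
    case False
    define p where "p = slice_point quat_i z"
    have p: "p \<in> \<Omega> - \<Omega>'"
      using z False by (simp add: p_def trace_set_def)
    obtain U m h where U: "open U" "p \<in> U" "U - qsphere p \<subseteq> \<Omega>'" "slice_regular_on U h"
        and h: "\<And>q. q \<in> U - qsphere p \<Longrightarrow> h q = sphere_poly p q ^ m * f q"
      using bspec[OF reg[unfolded regularity_set_def, THEN conjunct2, THEN conjunct2,
            THEN conjunct2, THEN conjunct2] p]
      by (elim exE conjE) (rule that, assumption+, erule bspec)
    have zU: "z \<in> trace_set U"
      using U(2) by (simp add: trace_set_def p_def)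
    have ne: "\<forall>\<^sub>F w in at z. w \<noteq> z \<and> w \<noteq> cnj z"
    proof (cases "cnj z = z")
      case True
      then show ?thesis
        by (simp add: eventually_neq_at_within)
    next
      case False
      then show ?thesis
        using eventually_neq_at_within[of z z UNIV] t1_space_nhds[of z "cnj z"]
        by (auto intro!: eventually_conj simp: eventually_at_filter elim: eventually_mono)
    qed
    have ev: "\<forall>\<^sub>F w in at z. slice_point quat_i w \<in> U - qsphere p \<and> char_poly (upper p) w \<noteq> 0"
      using eventually_at_in_open'[OF open_trace_set[OF U(1)] zU] ne
    proof eventually_elim
      case (elim w)
      have "upper p = z \<or> upper p = cnj z"
        using upper_slice_point_cases[of quat_i z] by (simp add: p_def)
      moreover have "upper (slice_point quat_i w) \<noteq> upper p"
        using elim by (auto simp: p_def upper_slice_point complex_eq_iff split: if_splits)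
      ultimately show ?case
        using elim by (auto simp: trace_set_def qsphere_iff char_poly_def)
    qed
    have "\<forall>\<^sub>F w in at z. w \<in> trace_set \<Omega>'"
      using ev by eventually_elim (use U(3) in \<open>auto simp: trace_set_def\<close>)
    moreover have "c meromorphic_on {z}"
      if d: "d holomorphic_on trace_set U"
        and dc: "\<And>w. slice_point quat_i w \<in> U - qsphere p \<Longrightarrow> d w = char_poly (upper p) w ^ m * c w"
      for c d
    proof -
      have "d meromorphic_on {z}"
        using d zU open_trace_set[OF U(1)]
        by (intro analytic_on_imp_meromorphic_on) (auto simp: analytic_at)
      then have "(\<lambda>w. d w / char_poly (upper p) w ^ m) meromorphic_on {z}"
        unfolding char_poly_def by (intro meromorphic_intros)
      moreover have "\<forall>\<^sub>F w in at z. d w / char_poly (upper p) w ^ m = c w"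
        using ev by eventually_elim (simp add: dc)
      ultimately show ?thesis
        using meromorphic_on_cong[of "{z}" "\<lambda>w. d w / char_poly (upper p) w ^ m" c "{z}"] by simp
    qed
    note mero = this
    have "slice_fst f meromorphic_on {z}"
      by (rule mero[OF slice_regular_on_imp_holomorphic(1)[OF U(1,4)]])
         (simp add: slice_fst_def h sphere_poly_slice_point flip: slice_point_power)
    moreover have "slice_snd f meromorphic_on {z}"
      by (rule mero[OF slice_regular_on_imp_holomorphic(2)[OF U(1,4)]])
         (simp add: slice_snd_def h sphere_poly_slice_point flip: slice_point_power)
    ultimately show ?thesis
      by blast
  qed
  show "\<forall>\<^sub>F z in cosparse (trace_set \<Omega>). z \<in> trace_set \<Omega>'"
    using main by (simp add: eventually_cosparse_open_eq open_trace_set[OF opn])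
  show "slice_fst f meromorphic_on trace_set \<Omega>" "slice_snd f meromorphic_on trace_set \<Omega>"
    using main meromorphic_on_meromorphic_at by blast+
qed

section \<open>Classes of semi-regular functions\<close>

lemma filterlim_cnj_at: "filterlim cnj (at (cnj z)) (at z)"
  unfolding filterlim_at
  by (auto intro!: tendsto_intros eventually_neq_at_within simp: eventually_at_filter)

lemma eventually_cosparse_cnj:
  assumes S: "open S" "\<And>z. cnj z \<in> S \<longleftrightarrow> z \<in> S" and P: "\<forall>\<^sub>F z in cosparse S. P z"
  shows "\<forall>\<^sub>F z in cosparse S. P (cnj z)"
  unfolding eventually_cosparse_open_eq[OF S(1)]
proof
  fix z assume "z \<in> S"
  then have "\<forall>\<^sub>F w in at (cnj z). P w"
    using P S by (simp add: eventually_cosparse_open_eq)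
  then show "\<forall>\<^sub>F w in at z. P (cnj w)"
    by (rule eventually_compose_filterlim[OF _ filterlim_cnj_at])
qed

lemma open_analytic_points: "open {z. f analytic_on {z}}"
proof (rule openI)
  fix z assume "z \<in> {z. f analytic_on {z}}"
  then obtain S where "open S" "z \<in> S" "f holomorphic_on S"
    by (auto simp: analytic_at)
  then have "S \<subseteq> {z. f analytic_on {z}}" "\<exists>e>0. ball z e \<subseteq> S"
    by (auto simp: analytic_at open_contains_ball)
  then show "\<exists>e>0. ball z e \<subseteq> {z. f analytic_on {z}}"
    by blast
qed

lemma eventually_eq_imp_eq_isCont:
  fixes f g :: "complex \<Rightarrow> complex"
  assumes "isCont f z" "isCont g z" "\<forall>\<^sub>F w in at z. f w = g w"
  shows "f z = g z"
proof -
  have "f \<midarrow>z\<rightarrow> g z"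
    using assms Lim_transform_eventually[of g "g z" "at z" f]
    by (auto simp: isCont_def eq_commute)
  then show ?thesis
    using assms(1) LIM_unique by (auto simp: isCont_def)
qed

lemma prod_assoc:
  "prod_fst (prod_fst a b c d) (prod_snd a b c d) e f =
     prod_fst a b (prod_fst c d e f) (prod_snd c d e f)"
  "prod_snd (prod_fst a b c d) (prod_snd a b c d) e f =
     prod_snd a b (prod_fst c d e f) (prod_snd c d e f)"
  by (simp_all add: fun_eq_iff prod_fst_def prod_snd_def mirror_def algebra_simps)

lemma prod_distrib:
  "prod_fst (\<lambda>z. a z + a' z) (\<lambda>z. b z + b' z) c d = (\<lambda>z. prod_fst a b c d z + prod_fst a' b' c d z)"
  "prod_snd (\<lambda>z. a z + a' z) (\<lambda>z. b z + b' z) c d = (\<lambda>z. prod_snd a b c d z + prod_snd a' b' c d z)"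
  "prod_fst a b (\<lambda>z. c z + c' z) (\<lambda>z. d z + d' z) = (\<lambda>z. prod_fst a b c d z + prod_fst a b c' d' z)"
  "prod_snd a b (\<lambda>z. c z + c' z) (\<lambda>z. d z + d' z) = (\<lambda>z. prod_snd a b c d z + prod_snd a b c' d' z)"
  by (simp_all add: fun_eq_iff prod_fst_def prod_snd_def mirror_def algebra_simps)

lemma prod_one:
  "prod_fst (\<lambda>_. 1) (\<lambda>_. 0) a b = a" "prod_snd (\<lambda>_. 1) (\<lambda>_. 0) a b = b"
  "prod_fst a b (\<lambda>_. 1) (\<lambda>_. 0) = a" "prod_snd a b (\<lambda>_. 1) (\<lambda>_. 0) = b"
  by (simp_all add: fun_eq_iff prod_fst_def prod_snd_def mirror_def)

locale circular_open =
  fixes \<Omega> :: "quat set"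
  assumes opn: "open \<Omega>" and circ: "circular \<Omega>"
begin

abbreviation D :: "complex set" where
  "D \<equiv> trace_set \<Omega>"

abbreviation mer :: "(complex \<Rightarrow> complex) \<Rightarrow> bool" where
  "mer a \<equiv> a meromorphic_on D"

text \<open>
  Equality off a discrete subset of the trace, the relation that identifies semi-regular functions.
\<close>
definition ae_eq :: "(complex \<Rightarrow> complex) \<Rightarrow> (complex \<Rightarrow> complex) \<Rightarrow> bool" (infix "\<doteq>" 50) where
  "a \<doteq> a' \<longleftrightarrow> (\<forall>\<^sub>F z in cosparse D. a z = a' z)"

lemma open_D: "open D"
  by (rule open_trace_set[OF opn])

lemma cnj_D: "cnj z \<in> D \<longleftrightarrow> z \<in> D"
  by (rule cnj_mem_trace_set_iff[OF circ])

lemma ae_eq_refl [simp]: "a \<doteq> a"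
  by (simp add: ae_eq_def)

lemma ae_eq_sym: "a \<doteq> b \<Longrightarrow> b \<doteq> a"
  by (simp add: ae_eq_def eq_commute)

lemma ae_eq_trans: "a \<doteq> b \<Longrightarrow> b \<doteq> c \<Longrightarrow> a \<doteq> c"
  unfolding ae_eq_def by (auto elim: eventually_elim2)

lemma ae_eq_mirror: "a \<doteq> b \<Longrightarrow> mirror a \<doteq> mirror b"
  using eventually_cosparse_cnj[OF open_D cnj_D, of "\<lambda>z. a z = b z"]
  by (simp add: ae_eq_def mirror_def)

lemma ae_eq_add:
  assumes "a \<doteq> a'" "b \<doteq> b'"
  shows "(\<lambda>z. a z + b z) \<doteq> (\<lambda>z. a' z + b' z)"
  using assms unfolding ae_eq_def by eventually_elim simp

lemma ae_eq_prod:
  assumes "a \<doteq> a'" "b \<doteq> b'" "c \<doteq> c'" "d \<doteq> d'"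
  shows "prod_fst a b c d \<doteq> prod_fst a' b' c' d'" "prod_snd a b c d \<doteq> prod_snd a' b' c' d'"
  using assms(1,2) assms(3,4)[THEN ae_eq_mirror] assms(3,4) unfolding ae_eq_def
  by (eventually_elim, simp add: prod_fst_def prod_snd_def)+

text \<open>
  Off the singularities this is the holomorphy of \<open>cnj \<circ> a \<circ> cnj\<close>; limits and poles at the
  singularities are carried over by conjugation.
\<close>
lemma mer_mirror: "mer a \<Longrightarrow> mer (mirror a)"
proof -
  assume a: "mer a"
  have "mirror a meromorphic_on {z}" if z: "z \<in> D" for z
  proof -
    note fm = filterlim_cnj_at[of z]
    have a': "a meromorphic_on {cnj z}"
      using a z cnj_D by (auto intro: meromorphic_on_subset)
    have an: "mirror a analytic_on {w}" if aw: "a analytic_on {cnj w}" for w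
    proof -
      obtain S where S: "open S" "cnj w \<in> S" "a holomorphic_on S"
        using aw by (auto simp: analytic_at)
      have "cnj ` cnj ` S = S"
        by (simp add: image_image)
      moreover have "open (cnj ` S)"
        using S(1) by (simp add: image_cnj_conv_vimage_cnj open_vimage continuous_on_cnj)
      ultimately have "cnj \<circ> a \<circ> cnj holomorphic_on cnj ` S"
        using S(3) by (intro holomorphic_on_compose_cnj_cnj) auto
      moreover have "cnj \<circ> a \<circ> cnj = mirror a"
        by (simp add: fun_eq_iff mirror_def)
      moreover have "w \<in> cnj ` S"
        using S(2) by (metis complex_cnj_cnj image_eqI)
      ultimately show ?thesis
        using \<open>open (cnj ` S)\<close> by (auto simp: analytic_at)
    qed
    have "\<forall>\<^sub>F w in at (cnj z). a analytic_on {w}"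
      using a' by (simp add: meromorphic_at_iff isolated_singularity_at_altdef)
    then have "\<forall>\<^sub>F w in at z. mirror a analytic_on {w}"
      by (rule eventually_mono[OF eventually_compose_filterlim[OF _ fm] an])
    then have "isolated_singularity_at (mirror a) z"
      by (simp add: isolated_singularity_at_altdef)
    moreover have "not_essential (mirror a) z"
    proof -
      have "not_essential a (cnj z)"
        using a' by (simp add: meromorphic_at_iff)
      then consider c where "a \<midarrow>cnj z\<rightarrow> c" | "is_pole a (cnj z)"
        by (auto simp: not_essential_def)
      then show ?thesis
      proof cases
        case 1
        then have "(\<lambda>w. cnj (a (cnj w))) \<midarrow>z\<rightarrow> cnj c"
          by (intro tendsto_cnj filterlim_compose[OF _ fm])
        then show ?thesis
          by (auto simp: not_essential_def mirror_def[abs_def])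
      next
        case 2
        then have "filterlim (\<lambda>w. a (cnj w)) at_infinity (at z)"
          unfolding is_pole_def by (rule filterlim_compose[OF _ fm])
        then have "filterlim (\<lambda>w. norm (a (cnj w))) at_top (at z)"
          by (rule filterlim_at_infinity_imp_norm_at_top)
        then have "filterlim (mirror a) at_infinity (at z)"
          by (intro filterlim_norm_at_top_imp_at_infinity) (simp add: mirror_def)
        then show ?thesis
          by (simp add: not_essential_def is_pole_def)
      qed
    qed
    ultimately show ?thesis
      by (simp add: meromorphic_at_iff)
  qed
  then show ?thesis
    using meromorphic_on_meromorphic_at by blast
qed

lemma mer_prod:
  assumes "mer a" "mer b" "mer c" "mer d"
  shows "mer (prod_fst a b c d)" "mer (prod_snd a b c d)"
  unfolding prod_fst_def[abs_def] prod_snd_def[abs_def]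
  by (intro meromorphic_intros assms mer_mirror)+

subsection \<open>Semi-regular functions\<close>

lemma regularity_setD:
  assumes "regularity_set \<Omega> f \<Omega>'"
  shows "open \<Omega>'" "circular \<Omega>'" "\<Omega>' \<subseteq> \<Omega>" "mer (slice_fst f)" "mer (slice_snd f)"
    "slice_fst f holomorphic_on trace_set \<Omega>'" "slice_snd f holomorphic_on trace_set \<Omega>'"
    "\<forall>\<^sub>F z in cosparse D. z \<in> trace_set \<Omega>'"
    "\<And>q. q \<in> \<Omega>' \<Longrightarrow> f q = lift (slice_fst f) (slice_snd f) q"
  using assms regularity_set_imp_cosparse[OF opn assms]
    slice_regular_on_imp_holomorphic[of \<Omega>' f] slice_regular_on_imp_lift[of \<Omega>' f]
  by (auto simp: regularity_set_def)

lemma semi_regularE: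
  assumes "f \<in> semi_regular \<Omega>"
  obtains \<Omega>' where "regularity_set \<Omega> f \<Omega>'"
  using assms by (auto simp: semi_regular_def)

lemma semi_regularI: "regularity_set \<Omega> f \<Omega>' \<Longrightarrow> f \<in> semi_regular \<Omega>"
  by (auto simp: semi_regular_def)

lemma semi_regular_mer:
  assumes "f \<in> semi_regular \<Omega>"
  shows "mer (slice_fst f)" "mer (slice_snd f)"
  using assms by (auto elim!: semi_regularE dest: regularity_setD)

lemma slice_fst_lift [simp]: "slice_fst (lift a b) = a"
  and slice_snd_lift [simp]: "slice_snd (lift a b) = b"
  by (simp_all add: fun_eq_iff slice_fst_def slice_snd_def complex_eq_iff)

text \<open>
  A regularity set is given by the spheres at whose two points on the trace both functions are analytic.
\<close>
lemma lift_semi_regular: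
  assumes a: "mer a" and b: "mer b"
  shows "lift a b \<in> semi_regular \<Omega>"
proof -
  define V where "V = {z. a analytic_on {z}} \<inter> {z. b analytic_on {z}}"
  define W where "W = D \<inter> V \<inter> cnj -` V"
  have W_open: "open W"
    unfolding W_def V_def
    by (intro open_Int open_D open_vimage open_analytic_points continuous_intros)
  have W_cnj: "cnj z \<in> W \<longleftrightarrow> z \<in> W" for z
    by (auto simp: W_def cnj_D)
  define \<Omega>' where "\<Omega>' = {q. upper q \<in> W}"
  have tr: "trace_set \<Omega>' = W"
    unfolding \<Omega>'_def by (rule trace_set_upper_vimage[OF W_cnj])
  have "\<forall>\<^sub>F z in cosparse D. z \<in> V"
    using meromorphic_on_imp_analytic_cosparse[OF a] meromorphic_on_imp_analytic_cosparse[OF b]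
    by eventually_elim (simp add: V_def)
  moreover from this have "\<forall>\<^sub>F z in cosparse D. cnj z \<in> V"
    by (rule eventually_cosparse_cnj[OF open_D cnj_D])
  moreover have "\<forall>\<^sub>F z in cosparse D. z \<in> D"
    by (rule eventually_in_cosparse[OF order_refl open_D])
  ultimately have "\<forall>\<^sub>F z in cosparse D. z \<in> W"
    by eventually_elim (simp add: W_def)
  moreover have "c holomorphic_on W" if "c \<in> {a, b}" for c
  proof -
    have "c analytic_on {z}" if "z \<in> W" for z
      using that \<open>c \<in> {a, b}\<close> by (auto simp: W_def V_def)
    then show ?thesis
      using analytic_on_analytic_at analytic_imp_holomorphic by blast
  qed
  moreover have "\<Omega>' \<subseteq> \<Omega>"
    using upper_mem_trace_set_iff[OF circ] by (auto simp: \<Omega>'_def W_def)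
  ultimately have "regularity_set \<Omega> (lift a b) \<Omega>'"
    using W_open assms
    by (intro regularity_set_lift[of \<Omega> \<Omega>' a b] opn circ)
       (auto simp: tr, auto simp: \<Omega>'_def open_upper_vimage circular_upper_vimage)
  then show ?thesis
    by (rule semi_regularI)
qed

text \<open>
  Sums and products of semi-regular functions are known only on the intersection of the two
  regularity sets; that is enough to find their class.
\<close>
lemma regularity_sets_Int:
  assumes "regularity_set \<Omega> f A" "regularity_set \<Omega> g B"
    and mer: "mer a" "mer b"
    and holo: "a holomorphic_on trace_set (A \<inter> B)" "b holomorphic_on trace_set (A \<inter> B)"
    and h: "\<And>q. q \<in> A \<inter> B \<Longrightarrow> h q = lift a b q"
  shows "h \<in> semi_regular \<Omega>" "slice_fst h \<doteq> a" "slice_snd h \<doteq> b"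
proof -
  note A = regularity_setD[OF assms(1)] and B = regularity_setD[OF assms(2)]
  have dense: "\<forall>\<^sub>F z in cosparse D. z \<in> trace_set (A \<inter> B)"
    using A(8) B(8) by eventually_elim (simp add: trace_set_Int)
  have "regularity_set \<Omega> h (A \<inter> B)"
    using A B by (intro regularity_set_lift[OF opn circ _ _ _ mer holo dense h])
      (auto intro: circular_Int)
  then show "h \<in> semi_regular \<Omega>"
    by (rule semi_regularI)
  show "slice_fst h \<doteq> a" "slice_snd h \<doteq> b"
    unfolding ae_eq_def using dense
    by (eventually_elim, simp add: slice_fst_def slice_snd_def trace_set_def h complex_eq_iff)+
qed

lemma semi_regular_add:
  assumes "f \<in> semi_regular \<Omega>" "g \<in> semi_regular \<Omega>"
  shows "(\<lambda>q. f q + g q) \<in> semi_regular \<Omega>"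
    "slice_fst (\<lambda>q. f q + g q) \<doteq> (\<lambda>z. slice_fst f z + slice_fst g z)"
    "slice_snd (\<lambda>q. f q + g q) \<doteq> (\<lambda>z. slice_snd f z + slice_snd g z)"
proof -
  obtain A B where AB: "regularity_set \<Omega> f A" "regularity_set \<Omega> g B"
    using assms by (meson semi_regularE)
  note A = regularity_setD[OF AB(1)] and B = regularity_setD[OF AB(2)]
  have "f q + g q = lift (\<lambda>z. slice_fst f z + slice_fst g z) (\<lambda>z. slice_snd f z + slice_snd g z) q"
    if "q \<in> A \<inter> B" for q
    using that A(9)[of q] B(9)[of q] by (simp add: lift_add[symmetric])
  moreover have "c holomorphic_on trace_set (A \<inter> B)" if "c holomorphic_on trace_set A \<or> c holomorphic_on trace_set B" for c
    using that by (auto intro: holomorphic_on_subset simp: trace_set_Int)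
  ultimately show "(\<lambda>q. f q + g q) \<in> semi_regular \<Omega>"
    "slice_fst (\<lambda>q. f q + g q) \<doteq> (\<lambda>z. slice_fst f z + slice_fst g z)"
    "slice_snd (\<lambda>q. f q + g q) \<doteq> (\<lambda>z. slice_snd f z + slice_snd g z)"
    using A B
    by (intro regularity_sets_Int[OF AB, where a = "\<lambda>z. slice_fst f z + slice_fst g z"
        and b = "\<lambda>z. slice_snd f z + slice_snd g z"] meromorphic_intros holomorphic_intros; simp)+
qed

lemma holomorphic_mirror:
  assumes "open S" "\<And>z. cnj z \<in> S \<longleftrightarrow> z \<in> S" "a holomorphic_on S"
  shows "mirror a holomorphic_on S"
proof -
  have "cnj ` S = S"
    using assms(2) by (auto simp: image_cnj_conv_vimage_cnj)
  then have "cnj \<circ> a \<circ> cnj holomorphic_on S"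
    using assms(1,3) by (intro holomorphic_on_compose_cnj_cnj) auto
  moreover have "cnj \<circ> a \<circ> cnj = mirror a"
    by (simp add: fun_eq_iff mirror_def)
  ultimately show ?thesis
    by simp
qed

lemma semi_regular_star:
  assumes "f \<in> semi_regular \<Omega>" "g \<in> semi_regular \<Omega>"
  shows "star f g \<in> semi_regular \<Omega>"
    "slice_fst (star f g) \<doteq> prod_fst (slice_fst f) (slice_snd f) (slice_fst g) (slice_snd g)"
    "slice_snd (star f g) \<doteq> prod_snd (slice_fst f) (slice_snd f) (slice_fst g) (slice_snd g)"
proof -
  obtain A B where AB: "regularity_set \<Omega> f A" "regularity_set \<Omega> g B"
    using assms by (meson semi_regularE)
  note A = regularity_setD[OF AB(1)] and B = regularity_setD[OF AB(2)]
  let ?a = "prod_fst (slice_fst f) (slice_snd f) (slice_fst g) (slice_snd g)"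
  let ?b = "prod_snd (slice_fst f) (slice_snd f) (slice_fst g) (slice_snd g)"
  have "star f g q = lift ?a ?b q" if "q \<in> A \<inter> B" for q
    using that A(9) B(9) B(2) by (intro star_lift[of B]) auto
  moreover have holo: "c holomorphic_on trace_set (A \<inter> B)" if "c holomorphic_on trace_set A \<or> c holomorphic_on trace_set B" for c
    using that by (auto intro: holomorphic_on_subset simp: trace_set_Int)
  moreover have "mirror c holomorphic_on trace_set (A \<inter> B)" if "c holomorphic_on trace_set (A \<inter> B)" for c
    using that A(1,2) B(1,2)
    by (intro holomorphic_mirror open_trace_set open_Int cnj_mem_trace_set_iff circular_Int)
  ultimately have "?a holomorphic_on trace_set (A \<inter> B)" "?b holomorphic_on trace_set (A \<inter> B)"
      "\<And>q. q \<in> A \<inter> B \<Longrightarrow> star f g q = lift ?a ?b q"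
    using A(6,7) B(6,7) unfolding prod_fst_def[abs_def] prod_snd_def[abs_def]
    by (auto intro!: holomorphic_intros)
  with regularity_sets_Int[OF AB mer_prod[OF A(4,5) B(4,5)]]
  show "star f g \<in> semi_regular \<Omega>" "slice_fst (star f g) \<doteq> ?a" "slice_snd (star f g) \<doteq> ?b"
    by blast+
qed

text \<open>
  Agreement off a discrete set gives agreement on the whole intersection of the regularity sets by
  continuity. In this form the relation is visibly transitive.
\<close>
lemma sem_rel_iff:
  "(f, g) \<in> sem_rel \<Omega> \<longleftrightarrow> f \<in> semi_regular \<Omega> \<and> g \<in> semi_regular \<Omega> \<and>
     slice_fst f \<doteq> slice_fst g \<and> slice_snd f \<doteq> slice_snd g"
proof
  assume "(f, g) \<in> sem_rel \<Omega>"
  then obtain A B where AB: "regularity_set \<Omega> f A" "regularity_set \<Omega> g B"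
      and eq: "\<And>q. q \<in> A \<inter> B \<Longrightarrow> f q = g q"
    unfolding sem_rel_def mem_Collect_eq prod.case by (elim exE conjE) (rule that, assumption+, erule bspec)
  note A = regularity_setD[OF AB(1)] and B = regularity_setD[OF AB(2)]
  have "\<forall>\<^sub>F z in cosparse D. slice_point quat_i z \<in> A \<inter> B"
    using A(8) B(8) by eventually_elim (simp add: trace_set_def)
  then have "slice_fst f \<doteq> slice_fst g" "slice_snd f \<doteq> slice_snd g"
    unfolding ae_eq_def by (eventually_elim, simp add: slice_fst_def slice_snd_def eq)+
  then show "f \<in> semi_regular \<Omega> \<and> g \<in> semi_regular \<Omega> \<and>
     slice_fst f \<doteq> slice_fst g \<and> slice_snd f \<doteq> slice_snd g"
    using AB semi_regularI by blast
next
  assume *: "f \<in> semi_regular \<Omega> \<and> g \<in> semi_regular \<Omega> \<and>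
     slice_fst f \<doteq> slice_fst g \<and> slice_snd f \<doteq> slice_snd g"
  then obtain A B where AB: "regularity_set \<Omega> f A" "regularity_set \<Omega> g B"
    by (meson semi_regularE)
  note A = regularity_setD[OF AB(1)] and B = regularity_setD[OF AB(2)]
  have eq: "c z = d z" if cd: "c \<doteq> d" "c holomorphic_on trace_set A" "d holomorphic_on trace_set B"
    and z: "z \<in> trace_set (A \<inter> B)" for c d z
  proof (rule eventually_eq_imp_eq_isCont[where f = c and g = d and z = z])
    show "isCont c z" "isCont d z"
      using cd z A(1) B(1) open_trace_set
      by (auto simp: trace_set_Int continuous_on_eq_continuous_at dest!: holomorphic_on_imp_continuous_on)
    have "z \<in> D"
      using z A(3) by (auto simp: trace_set_def)
    then show "\<forall>\<^sub>F w in at z. c w = d w"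
      using cd(1) by (simp add: ae_eq_def eventually_cosparse_open_eq[OF open_D])
  qed
  have "f q = g q" if q: "q \<in> A \<inter> B" for q
  proof -
    have AB': "circular (A \<inter> B)"
      using A(2) B(2) by (rule circular_Int)
    have "upper q \<in> trace_set (A \<inter> B)" "cnj (upper q) \<in> trace_set (A \<inter> B)"
      using q by (simp_all only: cnj_mem_trace_set_iff[OF AB'] upper_mem_trace_set_iff[OF AB'])
    then have "lift (slice_fst f) (slice_snd f) q = lift (slice_fst g) (slice_snd g) q"
      using eq[OF _ A(6) B(6)] eq[OF _ A(7) B(7)] * by (intro lift_cong) simp_all
    then show ?thesis
      using q A(9) B(9) by simp
  qed
  then show "(f, g) \<in> sem_rel \<Omega>"
    using AB unfolding sem_rel_def by blast
qed

lemma equiv_sem_rel: "equiv (semi_regular \<Omega>) (sem_rel \<Omega>)"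
proof (rule equivI)
  show "sem_rel \<Omega> \<subseteq> semi_regular \<Omega> \<times> semi_regular \<Omega>"
    by (auto simp: sem_rel_iff)
  show "refl_on (semi_regular \<Omega>) (sem_rel \<Omega>)"
    by (auto simp: refl_on_def sem_rel_iff)
  show "sym (sem_rel \<Omega>)"
    by (auto simp: sym_def sem_rel_iff intro: ae_eq_sym)
  show "trans (sem_rel \<Omega>)"
    unfolding trans_def by (meson sem_rel_iff ae_eq_trans)
qed

text \<open>
  Every class has this form, and the operations on classes are computed on the pairs. No choice of
  representatives is needed from here on.
\<close>
definition cls :: "(complex \<Rightarrow> complex) \<Rightarrow> (complex \<Rightarrow> complex) \<Rightarrow> sem" where
  "cls a b = sem_class \<Omega> (lift a b)"

lemma mem_cls_iff:
  assumes "mer a" "mer b"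
  shows "f \<in> cls a b \<longleftrightarrow> f \<in> semi_regular \<Omega> \<and> slice_fst f \<doteq> a \<and> slice_snd f \<doteq> b"
  using assms lift_semi_regular by (auto simp: cls_def sem_class_def sem_rel_iff intro: ae_eq_sym)

lemma cls_eq_iff:
  assumes "mer a" "mer b" "mer c" "mer d"
  shows "cls a b = cls c d \<longleftrightarrow> a \<doteq> c \<and> b \<doteq> d"
  using eq_equiv_class_iff[OF equiv_sem_rel lift_semi_regular[OF assms(1,2)] lift_semi_regular[OF assms(3,4)]]
  by (simp add: cls_def sem_class_def sem_rel_iff lift_semi_regular assms)

lemma sem_class_eq_cls:
  assumes "f \<in> semi_regular \<Omega>" "mer a" "mer b" "slice_fst f \<doteq> a" "slice_snd f \<doteq> b"
  shows "sem_class \<Omega> f = cls a b"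
  unfolding sem_class_def cls_def
  by (intro equiv_class_eq[OF equiv_sem_rel]) (simp add: sem_rel_iff assms lift_semi_regular)

lemma carrier_SEM_iff: "F \<in> carrier (SEM \<Omega>) \<longleftrightarrow> (\<exists>a b. mer a \<and> mer b \<and> F = cls a b)"
proof
  assume "F \<in> carrier (SEM \<Omega>)"
  then obtain f where f: "f \<in> semi_regular \<Omega>" "F = sem_class \<Omega> f"
    by (auto simp: SEM_def quotient_def sem_class_def)
  then have "F = cls (slice_fst f) (slice_snd f)"
    by (simp add: sem_class_eq_cls semi_regular_mer)
  then show "\<exists>a b. mer a \<and> mer b \<and> F = cls a b"
    using semi_regular_mer[OF f(1)] by blast
next
  assume "\<exists>a b. mer a \<and> mer b \<and> F = cls a b"
  then show "F \<in> carrier (SEM \<Omega>)"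
    using lift_semi_regular by (auto simp: SEM_def cls_def sem_class_def intro: quotientI)
qed

lemma UN_sem_classes_eq:
  assumes "\<And>f g. f \<in> F \<Longrightarrow> g \<in> G \<Longrightarrow> h f g = C" "F \<noteq> {}" "G \<noteq> {}"
  shows "(\<Union>f\<in>F. \<Union>g\<in>G. h f g) = C"
  using assms by auto

lemma cls_nonempty: "mer a \<Longrightarrow> mer b \<Longrightarrow> cls a b \<noteq> {}"
  using mem_cls_iff[of a b "lift a b"] lift_semi_regular[of a b] by auto

lemma add_cls:
  assumes "mer a" "mer b" "mer c" "mer d"
  shows "cls a b \<oplus>\<^bsub>SEM \<Omega>\<^esub> cls c d = cls (\<lambda>z. a z + c z) (\<lambda>z. b z + d z)"
proof -
  have "sem_class \<Omega> (\<lambda>q. f q + g q) = cls (\<lambda>z. a z + c z) (\<lambda>z. b z + d z)"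
    if "f \<in> cls a b" "g \<in> cls c d" for f g
  proof -
    have f: "f \<in> semi_regular \<Omega>" "slice_fst f \<doteq> a" "slice_snd f \<doteq> b"
      and g: "g \<in> semi_regular \<Omega>" "slice_fst g \<doteq> c" "slice_snd g \<doteq> d"
      using that assms by (simp_all add: mem_cls_iff)
    show ?thesis
      by (rule sem_class_eq_cls[OF semi_regular_add(1)[OF f(1) g(1)] _ _
            ae_eq_trans[OF semi_regular_add(2)[OF f(1) g(1)] ae_eq_add[OF f(2) g(2)]]
            ae_eq_trans[OF semi_regular_add(3)[OF f(1) g(1)] ae_eq_add[OF f(3) g(3)]]])
         (intro meromorphic_on_add assms)+
  qed
  then show ?thesis
    unfolding SEM_def ring_record_simps sem_add_def
    by (simp add: UN_sem_classes_eq cls_nonempty assms)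
qed

lemma sem_mult_cls:
  assumes "mer a" "mer b" "mer c" "mer d"
  shows "sem_mult \<Omega> (cls a b) (cls c d) = cls (prod_fst a b c d) (prod_snd a b c d)"
proof -
  have "sem_class \<Omega> (star f g) = cls (prod_fst a b c d) (prod_snd a b c d)"
    if "f \<in> cls a b" "g \<in> cls c d" for f g
  proof -
    have f: "f \<in> semi_regular \<Omega>" "slice_fst f \<doteq> a" "slice_snd f \<doteq> b"
      and g: "g \<in> semi_regular \<Omega>" "slice_fst g \<doteq> c" "slice_snd g \<doteq> d"
      using that assms by (simp_all add: mem_cls_iff)
    show ?thesis
      by (rule sem_class_eq_cls[OF semi_regular_star(1)[OF f(1) g(1)] mer_prod[OF assms]
            ae_eq_trans[OF semi_regular_star(2)[OF f(1) g(1)] ae_eq_prod(1)[OF f(2,3) g(2,3)]]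
            ae_eq_trans[OF semi_regular_star(3)[OF f(1) g(1)] ae_eq_prod(2)[OF f(2,3) g(2,3)]]])
  qed
  then show ?thesis
    unfolding sem_mult_def by (simp add: UN_sem_classes_eq cls_nonempty assms)
qed

lemma mult_cls:
  assumes "mer a" "mer b" "mer c" "mer d"
  shows "cls a b \<otimes>\<^bsub>SEM \<Omega>\<^esub> cls c d = cls (prod_fst a b c d) (prod_snd a b c d)"
    "cls a b \<odot>\<^bsub>SEM \<Omega>\<^esub> cls c d = cls (prod_fst a b c d) (prod_snd a b c d)"
  using sem_mult_cls[OF assms] by (simp_all add: SEM_def)

lemma smult_SEM: "x \<odot>\<^bsub>SEM \<Omega>\<^esub> y = x \<otimes>\<^bsub>SEM \<Omega>\<^esub> y"
  by (simp add: SEM_def)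

lemma sem_const_eq_cls: "sem_const \<Omega> c = cls (\<lambda>_. quat_fst c) (\<lambda>_. quat_snd c)"
proof -
  have "lift (\<lambda>_. quat_fst c) (\<lambda>_. quat_snd c) = (\<lambda>_. c)"
    by (simp add: fun_eq_iff lift_def stem_even_def stem_odd_def scaleR_2[symmetric])
  then show ?thesis
    by (simp add: sem_const_def cls_def)
qed

lemma zero_SEM: "\<zero>\<^bsub>SEM \<Omega>\<^esub> = cls (\<lambda>_. 0) (\<lambda>_. 0)"
proof -
  have "quat_fst 0 = 0" "quat_snd 0 = 0"
    by (simp_all add: complex_eq_iff)
  then show ?thesis
    by (simp add: SEM_def sem_const_eq_cls)
qed

lemma one_SEM: "\<one>\<^bsub>SEM \<Omega>\<^esub> = cls (\<lambda>_. 1) (\<lambda>_. 0)"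
proof -
  have "quat_fst 1 = 1" "quat_snd 1 = 0"
    by (simp_all add: complex_eq_iff)
  then show ?thesis
    by (simp add: SEM_def sem_const_eq_cls)
qed

lemma cls_closed: "mer a \<Longrightarrow> mer b \<Longrightarrow> cls a b \<in> carrier (SEM \<Omega>)"
  by (auto simp: carrier_SEM_iff)


lemma mer_const: "mer (\<lambda>_. c)"
  by (rule meromorphic_on_const)

text \<open>
  Each axiom holds for pairs as an identity between functions, and hence for the classes.
\<close>
lemma ring_SEM: "ring (SEM \<Omega>)"
proof (rule ringI)
  show "abelian_group (SEM \<Omega>)"
  proof (rule abelian_groupI)
    fix x assume "x \<in> carrier (SEM \<Omega>)"
    then obtain a b where x: "mer a" "mer b" "x = cls a b"
      by (auto simp: carrier_SEM_iff)
    show "\<exists>y\<in>carrier (SEM \<Omega>). y \<oplus>\<^bsub>SEM \<Omega>\<^esub> x = \<zero>\<^bsub>SEM \<Omega>\<^esub>"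
      using x by (intro bexI[of _ "cls (\<lambda>z. - a z) (\<lambda>z. - b z)"])
        (simp_all add: add_cls zero_SEM cls_closed meromorphic_on_uminus)
  next
    fix x y z assume "x \<in> carrier (SEM \<Omega>)" "y \<in> carrier (SEM \<Omega>)" "z \<in> carrier (SEM \<Omega>)"
    then show "x \<oplus>\<^bsub>SEM \<Omega>\<^esub> y \<oplus>\<^bsub>SEM \<Omega>\<^esub> z = x \<oplus>\<^bsub>SEM \<Omega>\<^esub> (y \<oplus>\<^bsub>SEM \<Omega>\<^esub> z)"
      by (auto simp: carrier_SEM_iff add_cls meromorphic_on_add add.assoc)
  next
    fix x y assume "x \<in> carrier (SEM \<Omega>)" "y \<in> carrier (SEM \<Omega>)"
    then obtain a b c d where x: "mer a" "mer b" "x = cls a b" and y: "mer c" "mer d" "y = cls c d"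
      by (auto simp: carrier_SEM_iff)
    then show "x \<oplus>\<^bsub>SEM \<Omega>\<^esub> y \<in> carrier (SEM \<Omega>)" "x \<oplus>\<^bsub>SEM \<Omega>\<^esub> y = y \<oplus>\<^bsub>SEM \<Omega>\<^esub> x"
      by (simp_all add: add_cls cls_closed meromorphic_on_add add.commute)
  next
    fix x assume "x \<in> carrier (SEM \<Omega>)"
    then show "\<zero>\<^bsub>SEM \<Omega>\<^esub> \<oplus>\<^bsub>SEM \<Omega>\<^esub> x = x"
      by (auto simp: carrier_SEM_iff add_cls zero_SEM mer_const)
  next
    show "\<zero>\<^bsub>SEM \<Omega>\<^esub> \<in> carrier (SEM \<Omega>)"
      by (simp add: zero_SEM cls_closed mer_const)
  qed
next
  show "monoid (SEM \<Omega>)"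
  proof (rule monoidI)
    fix x y z assume "x \<in> carrier (SEM \<Omega>)" "y \<in> carrier (SEM \<Omega>)" "z \<in> carrier (SEM \<Omega>)"
    then show "x \<otimes>\<^bsub>SEM \<Omega>\<^esub> y \<otimes>\<^bsub>SEM \<Omega>\<^esub> z = x \<otimes>\<^bsub>SEM \<Omega>\<^esub> (y \<otimes>\<^bsub>SEM \<Omega>\<^esub> z)"
      by (auto simp: carrier_SEM_iff mult_cls mer_prod prod_assoc)
  next
    fix x assume "x \<in> carrier (SEM \<Omega>)"
    then show "\<one>\<^bsub>SEM \<Omega>\<^esub> \<otimes>\<^bsub>SEM \<Omega>\<^esub> x = x" "x \<otimes>\<^bsub>SEM \<Omega>\<^esub> \<one>\<^bsub>SEM \<Omega>\<^esub> = x"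
      by (auto simp: carrier_SEM_iff mult_cls one_SEM mer_const prod_one)
  next
    fix x y assume "x \<in> carrier (SEM \<Omega>)" "y \<in> carrier (SEM \<Omega>)"
    then obtain a b c d where x: "mer a" "mer b" "x = cls a b" and y: "mer c" "mer d" "y = cls c d"
      by (auto simp: carrier_SEM_iff)
    then show "x \<otimes>\<^bsub>SEM \<Omega>\<^esub> y \<in> carrier (SEM \<Omega>)"
      by (simp add: mult_cls cls_closed mer_prod)
  next
    show "\<one>\<^bsub>SEM \<Omega>\<^esub> \<in> carrier (SEM \<Omega>)"
      by (simp add: one_SEM cls_closed mer_const)
  qed
next
  fix x y z assume "x \<in> carrier (SEM \<Omega>)" "y \<in> carrier (SEM \<Omega>)" "z \<in> carrier (SEM \<Omega>)"
  then show "(x \<oplus>\<^bsub>SEM \<Omega>\<^esub> y) \<otimes>\<^bsub>SEM \<Omega>\<^esub> z = x \<otimes>\<^bsub>SEM \<Omega>\<^esub> z \<oplus>\<^bsub>SEM \<Omega>\<^esub> y \<otimes>\<^bsub>SEM \<Omega>\<^esub> z"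
    "z \<otimes>\<^bsub>SEM \<Omega>\<^esub> (x \<oplus>\<^bsub>SEM \<Omega>\<^esub> y) = z \<otimes>\<^bsub>SEM \<Omega>\<^esub> x \<oplus>\<^bsub>SEM \<Omega>\<^esub> z \<otimes>\<^bsub>SEM \<Omega>\<^esub> y"
    by (auto simp: carrier_SEM_iff mult_cls add_cls mer_prod meromorphic_on_add prod_distrib)
qed

end

section \<open>The centre and the four components\<close>

lemma mirror_simps [simp]: "mirror (\<lambda>z. a z + b z) = (\<lambda>z. mirror a z + mirror b z)"
  "mirror (\<lambda>z. a z - b z) = (\<lambda>z. mirror a z - mirror b z)"
  "mirror (\<lambda>z. - a z) = (\<lambda>z. - mirror a z)"
  "mirror (\<lambda>z. a z * b z) = (\<lambda>z. mirror a z * mirror b z)"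
  "mirror (\<lambda>z. a z / b z) = (\<lambda>z. mirror a z / mirror b z)"
  "mirror (\<lambda>_. c) = (\<lambda>_. cnj c)"
  by (simp_all add: fun_eq_iff mirror_def)

text \<open>
  The decomposition \<open>a = a\<^sub>0 + i a\<^sub>1\<close> into two functions invariant under \<open>mirror\<close>. Applied to both
  members of a pair it yields the four components of a semi-regular function.
\<close>
definition re_part :: "(complex \<Rightarrow> complex) \<Rightarrow> complex \<Rightarrow> complex" where
  "re_part a z = (a z + mirror a z) / 2"

definition im_part :: "(complex \<Rightarrow> complex) \<Rightarrow> complex \<Rightarrow> complex" where
  "im_part a z = (a z - mirror a z) / (2 * \<i>)"

lemma mirror_re_part [simp]: "mirror (re_part a) = re_part a"
  by (simp add: fun_eq_iff re_part_def[abs_def] add.commute)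

lemma mirror_im_part [simp]: "mirror (im_part a) = im_part a"
  by (simp add: fun_eq_iff im_part_def[abs_def] field_simps)

context circular_open
begin

interpretation ring "SEM \<Omega>"
  by (rule ring_SEM)

lemma mer_parts: "mer a \<Longrightarrow> mer (re_part a)" "mer a \<Longrightarrow> mer (im_part a)"
  unfolding re_part_def[abs_def] im_part_def[abs_def] by (intro meromorphic_intros mer_mirror; assumption)+

lemma a_inv_cls: "mer a \<Longrightarrow> mer b \<Longrightarrow> \<ominus>\<^bsub>SEM \<Omega>\<^esub> cls a b = cls (\<lambda>z. - a z) (\<lambda>z. - b z)"
  by (rule minus_equality) (simp_all add: add_cls zero_SEM cls_closed meromorphic_on_uminus)

lemma minus_cls:
  assumes "mer a" "mer b" "mer c" "mer d"
  shows "cls a b \<ominus>\<^bsub>SEM \<Omega>\<^esub> cls c d = cls (\<lambda>z. a z - c z) (\<lambda>z. b z - d z)"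
  using assms by (simp add: minus_eq a_inv_cls add_cls meromorphic_on_uminus)

text \<open>
  Scalars are the pairs \<open>(a, 0)\<close>; the slice preserving classes are those with \<open>mirror a = a\<close>.
\<close>
abbreviation scal :: "(complex \<Rightarrow> complex) \<Rightarrow> sem" where
  "scal a \<equiv> cls a (\<lambda>_. 0)"

lemma scal_mem_SEM_R:
  assumes a: "mer a" "mirror a = a"
  shows "scal a \<in> carrier (SEM_R \<Omega>)"
proof -
  have cnj: "a (cnj z) = cnj (a z)" for z
    using fun_cong[OF a(2), of "cnj z"] by (simp add: mirror_def)
  define f where "f = lift a (\<lambda>_. 0)"
  obtain \<Omega>' where reg: "regularity_set \<Omega> f \<Omega>'"
    unfolding f_def using semi_regularE[OF lift_semi_regular[OF a(1) mer_const]] by blast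
  have "f (slice_point I z) = slice_point I (a z)" if "I \<in> imag_units" for I z
  proof -
    have "stem_even a (\<lambda>_. 0) z = of_real (Re (a z))" "stem_odd a (\<lambda>_. 0) z = of_real (Im (a z))"
      by (simp_all add: stem_even_def stem_odd_def cnj quat_eq_iff)
    then show ?thesis
      unfolding f_def lift_slice_point[OF that] by (simp add: slice_point_def)
  qed
  then have "slice_preserving_on \<Omega>' f"
    by (auto simp: slice_preserving_on_def slice_eq_range)
  moreover have "f \<in> scal a"
    using a lift_semi_regular[OF a(1) mer_const] by (simp add: mem_cls_iff mer_const f_def)
  ultimately show ?thesis
    using reg cls_closed[OF a(1) mer_const, of 0] by (auto simp: SEM_R_def)
qed

text \<open>
  Preservation of the slice through \<open>i\<close> gives \<open>b = 0\<close>. Preservation of the slice through \<open>j\<close> then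
  forces both stem functions, which have values in \<open>\<complex>\<^sub>i\<close>, to be real, and this is the symmetry of \<open>a\<close>.
\<close>
lemma SEM_R_memE:
  assumes "F \<in> carrier (SEM_R \<Omega>)"
  obtains a where "mer a" "mirror a = a" "F = scal a"
proof -
  have F: "F \<in> carrier (SEM \<Omega>)"
    using assms by (simp add: SEM_R_def)
  obtain f \<Omega>' where f: "f \<in> F" and reg: "regularity_set \<Omega> f \<Omega>'" and sp: "slice_preserving_on \<Omega>' f"
    using assms by (auto simp: SEM_R_def)
  note R = regularity_setD[OF reg]
  define a b where "a = slice_fst f" and "b = slice_snd f"
  have mer: "mer a" "mer b"
    using R(4,5) by (simp_all add: a_def b_def)
  have pres: "f (slice_point I z) \<in> range (slice_point I)"
    if "I \<in> imag_units" "z \<in> trace_set \<Omega>'" for I z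
  proof -
    have "slice_point I z \<in> \<Omega>' \<inter> slice I"
      using that slice_point_mem_iff[OF R(2)] by (auto simp: slice_eq_range)
    then have "f (slice_point I z) \<in> slice I"
      using sp that(1) unfolding slice_preserving_on_def by blast
    then show ?thesis
      by (simp add: slice_eq_range)
  qed
  have b0: "b z = 0" if "z \<in> trace_set \<Omega>'" for z
    using pres[OF quat_i_imag_unit that] by (auto simp: b_def slice_snd_def complex_eq_iff)
  have a0: "mirror a z = a z" if z: "z \<in> trace_set \<Omega>'" for z
  proof -
    have cz: "cnj z \<in> trace_set \<Omega>'"
      using z cnj_mem_trace_set_iff[OF R(2)] by simp
    have "f (slice_point quat_j z) = lift a b (slice_point quat_j z)"
      using z slice_point_mem_iff[OF R(2) quat_j_imag_unit] R(9) by (simp add: a_def b_def)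
    then have eq: "f (slice_point quat_j z) = stem_even a b z + quat_j * stem_odd a b z"
      by (simp add: lift_slice_point)
    obtain w where w: "f (slice_point quat_j z) = slice_point quat_j w"
      using pres[OF quat_j_imag_unit z] by auto
    have "qI (stem_even a b z + quat_j * stem_odd a b z) = 0"
      "qK (stem_even a b z + quat_j * stem_odd a b z) = 0"
      by (simp_all add: w flip: eq)
    then show ?thesis
      using b0[OF z] b0[OF cz] by (simp add: stem_even_def stem_odd_def mirror_def complex_eq_iff)
  qed
  have "a \<doteq> re_part a" "b \<doteq> (\<lambda>_. 0)"
    unfolding ae_eq_def using R(8) by (eventually_elim, simp add: re_part_def a0 b0)+
  then have "F = scal (re_part a)"
  proof -
    assume ab: "a \<doteq> re_part a" "b \<doteq> (\<lambda>_. 0)"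
    obtain c d where cd: "mer c" "mer d" "F = cls c d"
      using F by (auto simp: carrier_SEM_iff)
    then have "a \<doteq> c" "b \<doteq> d"
      using f by (simp_all add: mem_cls_iff a_def b_def)
    then have "c \<doteq> re_part a" "d \<doteq> (\<lambda>_. 0)"
      using ab ae_eq_sym ae_eq_trans by blast+
    then show ?thesis
      using cd mer by (simp add: cls_eq_iff mer_parts mer_const)
  qed
  then show ?thesis
    using that[of "re_part a"] mer by (simp add: mer_parts)
qed

lemma prod_scal:
  assumes "mirror c = c"
  shows "prod_fst c (\<lambda>_. 0) a b = (\<lambda>z. c z * a z)" "prod_snd c (\<lambda>_. 0) a b = (\<lambda>z. c z * b z)"
    "prod_fst a b c (\<lambda>_. 0) = (\<lambda>z. a z * c z)" "prod_snd a b c (\<lambda>_. 0) = (\<lambda>z. b z * c z)"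
  by (simp_all add: fun_eq_iff prod_fst_def prod_snd_def assms)

lemma SEM_R_central:
  assumes "F \<in> carrier (SEM_R \<Omega>)" "G \<in> carrier (SEM \<Omega>)"
  shows "F \<otimes>\<^bsub>SEM \<Omega>\<^esub> G = G \<otimes>\<^bsub>SEM \<Omega>\<^esub> F"
proof -
  obtain c where c: "mer c" "mirror c = c" "F = scal c"
    using assms(1) by (rule SEM_R_memE)
  obtain a b where "mer a" "mer b" "G = cls a b"
    using assms(2) by (auto simp: carrier_SEM_iff)
  with c show ?thesis
    by (simp add: mult_cls mer_const prod_scal mult.commute)
qed

lemma SEM_R_subset: "F \<in> carrier (SEM_R \<Omega>) \<Longrightarrow> F \<in> carrier (SEM \<Omega>)"
  by (simp add: SEM_R_def)

lemma quaternion_combination: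
  assumes "mer a" "mer b" "mer c" "mer d"
  shows "scal a \<oplus>\<^bsub>SEM \<Omega>\<^esub> (scal b \<odot>\<^bsub>SEM \<Omega>\<^esub> sem_const \<Omega> quat_i \<oplus>\<^bsub>SEM \<Omega>\<^esub>
       scal c \<odot>\<^bsub>SEM \<Omega>\<^esub> sem_const \<Omega> quat_j \<oplus>\<^bsub>SEM \<Omega>\<^esub> scal d \<odot>\<^bsub>SEM \<Omega>\<^esub> sem_const \<Omega> quat_k)
     = cls (\<lambda>z. a z + \<i> * b z) (\<lambda>z. c z + \<i> * d z)"
    "scal a \<ominus>\<^bsub>SEM \<Omega>\<^esub> (scal b \<odot>\<^bsub>SEM \<Omega>\<^esub> sem_const \<Omega> quat_i \<oplus>\<^bsub>SEM \<Omega>\<^esub>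
       scal c \<odot>\<^bsub>SEM \<Omega>\<^esub> sem_const \<Omega> quat_j \<oplus>\<^bsub>SEM \<Omega>\<^esub> scal d \<odot>\<^bsub>SEM \<Omega>\<^esub> sem_const \<Omega> quat_k)
     = cls (\<lambda>z. a z - \<i> * b z) (\<lambda>z. - (c z + \<i> * d z))"
proof -
  have eq: "quat_fst quat_i = \<i>" "quat_snd quat_i = 0" "quat_fst quat_j = 0" "quat_snd quat_j = 1"
    "quat_fst quat_k = 0" "quat_snd quat_k = \<i>"
    by (simp_all add: complex_eq_iff)
  have smult: "scal c \<odot>\<^bsub>SEM \<Omega>\<^esub> sem_const \<Omega> q = cls (\<lambda>z. c z * quat_fst q) (\<lambda>z. c z * quat_snd q)"
    if "mer c" for c q
    using that by (simp add: sem_const_eq_cls mult_cls mer_const prod_fst_def[abs_def] prod_snd_def[abs_def])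
  have *: "scal b \<odot>\<^bsub>SEM \<Omega>\<^esub> sem_const \<Omega> quat_i \<oplus>\<^bsub>SEM \<Omega>\<^esub>
       scal c \<odot>\<^bsub>SEM \<Omega>\<^esub> sem_const \<Omega> quat_j \<oplus>\<^bsub>SEM \<Omega>\<^esub> scal d \<odot>\<^bsub>SEM \<Omega>\<^esub> sem_const \<Omega> quat_k
     = cls (\<lambda>z. b z * \<i>) (\<lambda>z. c z + d z * \<i>)"
    using assms by (simp add: smult eq add_cls mer_const meromorphic_on_add meromorphic_on_mult)
  show "scal a \<oplus>\<^bsub>SEM \<Omega>\<^esub> (scal b \<odot>\<^bsub>SEM \<Omega>\<^esub> sem_const \<Omega> quat_i \<oplus>\<^bsub>SEM \<Omega>\<^esub>
       scal c \<odot>\<^bsub>SEM \<Omega>\<^esub> sem_const \<Omega> quat_j \<oplus>\<^bsub>SEM \<Omega>\<^esub> scal d \<odot>\<^bsub>SEM \<Omega>\<^esub> sem_const \<Omega> quat_k)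
     = cls (\<lambda>z. a z + \<i> * b z) (\<lambda>z. c z + \<i> * d z)"
    unfolding * using assms
    by (simp add: add_cls mer_const meromorphic_on_add meromorphic_on_mult mult.commute)
  show "scal a \<ominus>\<^bsub>SEM \<Omega>\<^esub> (scal b \<odot>\<^bsub>SEM \<Omega>\<^esub> sem_const \<Omega> quat_i \<oplus>\<^bsub>SEM \<Omega>\<^esub>
       scal c \<odot>\<^bsub>SEM \<Omega>\<^esub> sem_const \<Omega> quat_j \<oplus>\<^bsub>SEM \<Omega>\<^esub> scal d \<odot>\<^bsub>SEM \<Omega>\<^esub> sem_const \<Omega> quat_k)
     = cls (\<lambda>z. a z - \<i> * b z) (\<lambda>z. - (c z + \<i> * d z))"
    unfolding * using assms
    by (simp add: minus_cls mer_const meromorphic_on_add meromorphic_on_mult mult.commute)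
qed

lemma re_im_part_unique:
  assumes "a \<doteq> (\<lambda>z. c z + \<i> * d z)" "mirror c = c" "mirror d = d"
  shows "c \<doteq> re_part a" "d \<doteq> im_part a"
proof -
  have "mirror a \<doteq> (\<lambda>z. c z - \<i> * d z)"
    using ae_eq_mirror[OF assms(1)] by (simp add: assms(2,3))
  with assms(1) show "c \<doteq> re_part a" "d \<doteq> im_part a"
    unfolding ae_eq_def by (eventually_elim, simp add: re_part_def im_part_def field_simps)+
qed

text \<open>
  Uniqueness holds because \<open>mirror\<close> turns \<open>c + i d\<close> into \<open>c - i d\<close> for invariant \<open>c\<close> and \<open>d\<close>, so
  that both can be recovered.
\<close>
lemma sem_components_cls:
  assumes "mer a" "mer b"
  shows "sem_components \<Omega> (cls a b) =
    (scal (re_part a), scal (im_part a), scal (re_part b), scal (im_part b))"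
proof -
  let ?P = "\<lambda>(F0, F1, F2, F3). {F0, F1, F2, F3} \<subseteq> carrier (SEM_R \<Omega>) \<and>
     cls a b = F0 \<oplus>\<^bsub>SEM \<Omega>\<^esub> (F1 \<odot>\<^bsub>SEM \<Omega>\<^esub> sem_const \<Omega> quat_i \<oplus>\<^bsub>SEM \<Omega>\<^esub>
       F2 \<odot>\<^bsub>SEM \<Omega>\<^esub> sem_const \<Omega> quat_j \<oplus>\<^bsub>SEM \<Omega>\<^esub> F3 \<odot>\<^bsub>SEM \<Omega>\<^esub> sem_const \<Omega> quat_k)"
  let ?c = "(scal (re_part a), scal (im_part a), scal (re_part b), scal (im_part b))"
  have split: "(\<lambda>z. re_part c z + \<i> * im_part c z) = c" for c
    by (simp add: fun_eq_iff re_part_def im_part_def field_simps)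
  have "?P ?c"
    using assms by (simp add: scal_mem_SEM_R mer_parts quaternion_combination split)
  moreover have "C = ?c" if C: "?P C" for C
  proof -
    obtain F0 F1 F2 F3 where C_eq: "C = (F0, F1, F2, F3)"
      by (cases C) auto
    have "F0 \<in> carrier (SEM_R \<Omega>)" "F1 \<in> carrier (SEM_R \<Omega>)" "F2 \<in> carrier (SEM_R \<Omega>)"
      "F3 \<in> carrier (SEM_R \<Omega>)"
      using C by (simp_all add: C_eq)
    then obtain c0 c1 c2 c3 where c: "mer c0" "mer c1" "mer c2" "mer c3"
        "mirror c0 = c0" "mirror c1 = c1" "mirror c2 = c2" "mirror c3 = c3"
        "F0 = scal c0" "F1 = scal c1" "F2 = scal c2" "F3 = scal c3"
      by (metis SEM_R_memE)
    have "cls a b = cls (\<lambda>z. c0 z + \<i> * c1 z) (\<lambda>z. c2 z + \<i> * c3 z)"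
      using C c by (simp add: C_eq quaternion_combination)
    then have "a \<doteq> (\<lambda>z. c0 z + \<i> * c1 z)" "b \<doteq> (\<lambda>z. c2 z + \<i> * c3 z)"
      using assms c by (simp_all add: cls_eq_iff mer_const meromorphic_on_add meromorphic_on_mult)
    from re_im_part_unique[OF this(1) c(5,6)] re_im_part_unique[OF this(2) c(7,8)]
    show ?thesis
      using assms c by (simp add: C_eq cls_eq_iff mer_const mer_parts)
  qed
  ultimately show ?thesis
    unfolding sem_components_def by (rule the_equality)
qed

lemma sem_Re_cls: "mer a \<Longrightarrow> mer b \<Longrightarrow> sem_Re \<Omega> (cls a b) = scal (re_part a)"
  by (simp add: sem_Re_def sem_components_cls)

lemma sem_vec_cls:
  assumes "mer a" "mer b"
  shows "sem_vec \<Omega> (cls a b) = cls (\<lambda>z. a z - re_part a z) b"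
  using assms by (simp add: sem_vec_def sem_Re_cls minus_cls mer_parts mer_const)

lemma mirror_vec: "mirror (\<lambda>z. a z - re_part a z) = (\<lambda>z. - (a z - re_part a z))"
  by (simp add: fun_eq_iff re_part_def field_simps)

lemma mer_vec: "mer a \<Longrightarrow> mer (\<lambda>z. a z - re_part a z)"
  by (intro meromorphic_on_diff mer_parts)

lemma sem_conj_cls:
  assumes "mer a" "mer b"
  shows "sem_conj \<Omega> (cls a b) = cls (mirror a) (\<lambda>z. - b z)"
proof -
  have "(\<lambda>z. re_part a z - \<i> * im_part a z) = mirror a"
    "(\<lambda>z. - (re_part b z + \<i> * im_part b z)) = (\<lambda>z. - b z)"
    by (simp_all add: fun_eq_iff re_part_def im_part_def field_simps)
  then show ?thesis
    using assms by (simp add: sem_conj_def sem_components_cls quaternion_combination mer_parts)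
qed

text \<open>
  Conjugation is \<open>(a, b) \<mapsto> (mirror a, - b)\<close>, which is negation on purely vectorial elements.
\<close>
lemma sem_symm_vec:
  assumes "mer a" "mirror a = (\<lambda>z. - a z)" "mer b"
  shows "sem_symm \<Omega> (cls a b) = \<ominus>\<^bsub>SEM \<Omega>\<^esub> (cls a b \<otimes>\<^bsub>SEM \<Omega>\<^esub> cls a b)"
proof -
  have "sem_conj \<Omega> (cls a b) = \<ominus>\<^bsub>SEM \<Omega>\<^esub> cls a b"
    using assms by (simp add: sem_conj_cls a_inv_cls)
  then show ?thesis
    using assms by (simp add: sem_symm_def r_minus cls_closed)
qed

end

section \<open>The Sylvester equation in a ring\<close>

context ring
begin

lemma add_swap:
  assumes "s \<in> carrier R" "t \<in> carrier R" "x \<in> carrier R" "y \<in> carrier R"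
  shows "s \<oplus> t \<oplus> (x \<oplus> y) = s \<oplus> x \<oplus> (t \<oplus> y)"
  using assms by (simp add: a_ac)

lemma plus_times_add_minus_times:
  assumes "v \<in> carrier R" "x \<in> carrier R"
  shows "(\<one> \<oplus> v) \<otimes> x \<oplus> (\<one> \<ominus> v) \<otimes> x = x \<oplus> x"
proof -
  have "(\<one> \<oplus> v) \<otimes> x \<oplus> (\<one> \<ominus> v) \<otimes> x = x \<oplus> v \<otimes> x \<oplus> (x \<ominus> v \<otimes> x)"
    using assms by (simp add: l_distr l_minus minus_eq)
  also have "\<dots> = x \<oplus> x"
    using assms by algebra
  finally show ?thesis .
qed

lemma diff_squares:
  assumes v: "v \<in> carrier R"
  shows "(\<one> \<oplus> v) \<otimes> (\<one> \<ominus> v) = \<one> \<ominus> v \<otimes> v" "(\<one> \<ominus> v) \<otimes> (\<one> \<oplus> v) = \<one> \<ominus> v \<otimes> v"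
proof -
  define q where "q = \<one> \<ominus> v"
  have q: "q \<in> carrier R"
    using v by (simp add: q_def)
  have vq: "v \<otimes> q = v \<ominus> v \<otimes> v" "q \<otimes> v = v \<ominus> v \<otimes> v"
    unfolding q_def using v by (simp_all add: minus_eq l_distr r_distr l_minus r_minus)
  have "(\<one> \<oplus> v) \<otimes> q = q \<oplus> v \<otimes> q" "q \<otimes> (\<one> \<oplus> v) = q \<oplus> q \<otimes> v"
    using v q by (simp_all add: l_distr r_distr)
  moreover have "\<one> \<ominus> v \<oplus> (v \<ominus> y) = \<one> \<ominus> y" if "y \<in> carrier R" for y
    using v that by algebra
  ultimately show "(\<one> \<oplus> v) \<otimes> (\<one> \<ominus> v) = \<one> \<ominus> v \<otimes> v"
    "(\<one> \<ominus> v) \<otimes> (\<one> \<oplus> v) = \<one> \<ominus> v \<otimes> v"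
    using v by (simp_all add: vq) (simp_all add: q_def)
qed

lemma half_double:
  assumes "h \<in> carrier R" "h \<oplus> h = \<one>" "x \<in> carrier R"
  shows "h \<otimes> (x \<oplus> x) = x"
  using assms l_distr[of h h x] by (simp add: r_distr)

text \<open>
  With \<open>u\<close> the inverse of \<open>1 + v\<close>, the first two terms of the geometric series,
  \<open>y \<mapsto> u y - u u y n\<close>, are the whole inverse operator: right multiplication by \<open>n\<close> squares to \<open>0\<close>.
\<close>
lemma sylvester_bij_of_inverse:
  assumes v: "v \<in> carrier R" and n: "n \<in> carrier R" "n \<otimes> n = \<zero>"
    and u: "u \<in> carrier R" "u \<otimes> (\<one> \<oplus> v) = \<one>" "(\<one> \<oplus> v) \<otimes> u = \<one>"
  shows "bij_betw (\<lambda>x. (\<one> \<oplus> v) \<otimes> x \<oplus> x \<otimes> n) (carrier R) (carrier R)"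
proof -
  define p where "p = \<one> \<oplus> v"
  have p: "p \<in> carrier R" and up: "u \<otimes> p = \<one>" "p \<otimes> u = \<one>"
    using v u by (simp_all add: p_def)
  have up': "u \<otimes> (p \<otimes> x) = x" "p \<otimes> (u \<otimes> x) = x" if "x \<in> carrier R" for x
    using that p u(1) up m_assoc[of u p x] m_assoc[of p u x] by simp_all
  have nn: "x \<otimes> n \<otimes> n = \<zero>" if "x \<in> carrier R" for x
    using that n by (simp add: m_assoc)
  show ?thesis
    unfolding p_def[symmetric]
  proof (rule bij_betw_byWitness[where f' = "\<lambda>y. u \<otimes> y \<ominus> u \<otimes> (u \<otimes> (y \<otimes> n))"])
    show "\<forall>x\<in>carrier R. u \<otimes> (p \<otimes> x \<oplus> x \<otimes> n) \<ominus> u \<otimes> (u \<otimes> ((p \<otimes> x \<oplus> x \<otimes> n) \<otimes> n)) = x"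
    proof
      fix x assume x: "x \<in> carrier R"
      have "u \<otimes> (p \<otimes> x \<oplus> x \<otimes> n) = x \<oplus> u \<otimes> (x \<otimes> n)"
        using x p u(1) n(1) by (simp add: r_distr up')
      moreover have "u \<otimes> (u \<otimes> ((p \<otimes> x \<oplus> x \<otimes> n) \<otimes> n)) = u \<otimes> (x \<otimes> n)"
        using x p u(1) n(1) by (simp add: l_distr nn m_assoc[of p] up')
      ultimately show "u \<otimes> (p \<otimes> x \<oplus> x \<otimes> n) \<ominus> u \<otimes> (u \<otimes> ((p \<otimes> x \<oplus> x \<otimes> n) \<otimes> n)) = x"
        using x u(1) n(1) by (simp add: minus_eq a_assoc r_neg)
    qed
    show "\<forall>y\<in>carrier R. p \<otimes> (u \<otimes> y \<ominus> u \<otimes> (u \<otimes> (y \<otimes> n))) \<oplus>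
        (u \<otimes> y \<ominus> u \<otimes> (u \<otimes> (y \<otimes> n))) \<otimes> n = y"
    proof
      fix y assume y: "y \<in> carrier R"
      have "p \<otimes> (u \<otimes> y \<ominus> u \<otimes> (u \<otimes> (y \<otimes> n))) = y \<ominus> u \<otimes> (y \<otimes> n)"
        using y p u(1) n(1) by (simp add: minus_eq r_distr r_minus up')
      moreover have "(u \<otimes> y \<ominus> u \<otimes> (u \<otimes> (y \<otimes> n))) \<otimes> n = u \<otimes> (y \<otimes> n)"
        using y u(1) n by (simp add: minus_eq l_distr l_minus m_assoc)
      ultimately show "p \<otimes> (u \<otimes> y \<ominus> u \<otimes> (u \<otimes> (y \<otimes> n))) \<oplus>
          (u \<otimes> y \<ominus> u \<otimes> (u \<otimes> (y \<otimes> n))) \<otimes> n = y"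
        using y u(1) n(1) by (simp add: minus_eq a_assoc l_neg)
    qed
  qed (use p u(1) n(1) in auto)
qed

text \<open>
  Here \<open>h\<close> is one half. With \<open>p = 1 + v\<close> and \<open>q = 1 - v\<close> one has \<open>p q = q p = 0\<close> and \<open>p p = 2 p\<close>, so
  the equation splits along \<open>x = h p x + h q x\<close>. The element \<open>w\<close> turns \<open>x n = 0\<close> into \<open>x = (x w) n\<close>.
\<close>
lemma sylvester_kernel_and_range:
  assumes v: "v \<in> carrier R" "v \<otimes> v = \<one>" and n: "n \<in> carrier R" "n \<otimes> n = \<zero>"
    and w: "w \<in> carrier R" "w \<otimes> n \<oplus> n \<otimes> w = \<one>"
    and h: "h \<in> carrier R" "h \<oplus> h = \<one>" "\<forall>x\<in>carrier R. h \<otimes> x = x \<otimes> h"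
  shows "{x \<in> carrier R. (\<one> \<oplus> v) \<otimes> x \<oplus> x \<otimes> n = \<zero>} =
      {(\<one> \<ominus> v) \<otimes> x \<otimes> n | x. x \<in> carrier R}" (is ?ker)
    and "b \<in> carrier R \<Longrightarrow> (\<exists>x\<in>carrier R. (\<one> \<oplus> v) \<otimes> x \<oplus> x \<otimes> n = b) \<longleftrightarrow>
      (\<one> \<ominus> v) \<otimes> b \<otimes> n = \<zero>" (is "_ \<Longrightarrow> ?range")
proof -
  define p q where "p = \<one> \<oplus> v" and "q = \<one> \<ominus> v"
  have pq: "p \<in> carrier R" "q \<in> carrier R"
    using v by (simp_all add: p_def q_def)
  have pq0: "p \<otimes> q = \<zero>" "q \<otimes> p = \<zero>"
    unfolding p_def q_def diff_squares[OF v(1)] by (simp_all add: v(2) minus_eq r_neg)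
  have "p \<otimes> p = p \<oplus> v \<otimes> p"
    using v(1) pq by (simp add: p_def l_distr)
  also have "v \<otimes> p = p"
    using v by (simp add: p_def r_distr a_comm)
  finally have pp: "p \<otimes> p = p \<oplus> p" .
  have pq_half: "h \<otimes> (p \<otimes> x) \<oplus> h \<otimes> (q \<otimes> x) = x" if "x \<in> carrier R" for x
  proof -
    have "h \<otimes> (p \<otimes> x) \<oplus> h \<otimes> (q \<otimes> x) = h \<otimes> (p \<otimes> x \<oplus> q \<otimes> x)"
      using that pq h(1) by (simp add: r_distr)
    also have "p \<otimes> x \<oplus> q \<otimes> x = x \<oplus> x"
      unfolding p_def q_def by (rule plus_times_add_minus_times[OF v(1) that])
    finally show ?thesis
      by (simp only: half_double[OF h(1,2) that])
  qed
  have h_assoc: "y \<otimes> (h \<otimes> x) = h \<otimes> (y \<otimes> x)" if "x \<in> carrier R" "y \<in> carrier R" for x y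
  proof -
    have "y \<otimes> (h \<otimes> x) = y \<otimes> h \<otimes> x"
      by (rule m_assoc[symmetric, OF that(2) h(1) that(1)])
    also have "\<dots> = h \<otimes> y \<otimes> x"
      by (simp only: bspec[OF h(3) that(2)])
    also have "\<dots> = h \<otimes> (y \<otimes> x)"
      by (rule m_assoc[OF h(1) that(2,1)])
    finally show ?thesis .
  qed
  have zero_assoc: "p \<otimes> (q \<otimes> x) = \<zero>" "q \<otimes> (p \<otimes> x) = \<zero>" "x \<otimes> n \<otimes> n = \<zero>" if "x \<in> carrier R" for x
    using that pq n m_assoc[of p q x, symmetric] m_assoc[of q p x, symmetric] m_assoc[of x n n]
    by (simp_all add: pq0)
  have right_n: "x \<otimes> w \<otimes> n \<oplus> x \<otimes> n \<otimes> w = x" if "x \<in> carrier R" for x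
    using that w n(1) r_distr[of "w \<otimes> n" "n \<otimes> w" x] by (simp add: m_assoc)
  have q_kill: "q \<otimes> (p \<otimes> x \<oplus> x \<otimes> n) \<otimes> n = \<zero>" if x: "x \<in> carrier R" for x
    using x pq n by (simp add: r_distr zero_assoc m_assoc)

  show ?ker
    unfolding p_def[symmetric] q_def[symmetric]
  proof (intro equalityI subsetI)
    fix x assume "x \<in> {x \<in> carrier R. p \<otimes> x \<oplus> x \<otimes> n = \<zero>}"
    then have x: "x \<in> carrier R" and eq: "p \<otimes> x \<oplus> x \<otimes> n = \<zero>"
      by auto
    have "q \<otimes> (p \<otimes> x \<oplus> x \<otimes> n) = \<zero>" "(p \<otimes> x \<oplus> x \<otimes> n) \<otimes> n = \<zero>"
      using pq n by (simp_all add: eq)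
    then have "q \<otimes> (x \<otimes> n) = \<zero>" "p \<otimes> (x \<otimes> n) = \<zero>"
      using x pq n(1) by (simp_all add: r_distr l_distr zero_assoc) (simp add: m_assoc)
    then have xn: "x \<otimes> n = \<zero>"
      using pq_half[of "x \<otimes> n"] x n(1) h(1) by simp
    then have px: "p \<otimes> x = \<zero>"
      using eq x pq by simp
    have "x \<otimes> w \<otimes> n = x"
      using right_n[OF x] xn x w(1) n(1) by simp
    then have "h \<otimes> (q \<otimes> x) = h \<otimes> (q \<otimes> (x \<otimes> w \<otimes> n))"
      by simp
    also have "\<dots> = q \<otimes> (h \<otimes> x \<otimes> w) \<otimes> n"
      using x pq w(1) n(1) h(1) by (simp add: m_assoc h_assoc[where y = q])
    also have "h \<otimes> (q \<otimes> x) = x"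
      using pq_half[OF x] px x pq h(1) by simp
    finally have "x = q \<otimes> (h \<otimes> x \<otimes> w) \<otimes> n" .
    then show "x \<in> {q \<otimes> x \<otimes> n | x. x \<in> carrier R}"
      using x w(1) h(1) by blast
  next
    fix y assume "y \<in> {q \<otimes> x \<otimes> n | x. x \<in> carrier R}"
    then obtain x where "x \<in> carrier R" "y = q \<otimes> x \<otimes> n"
      by blast
    then show "y \<in> {x \<in> carrier R. p \<otimes> x \<oplus> x \<otimes> n = \<zero>}"
      using pq n by (simp add: zero_assoc) (simp add: m_assoc zero_assoc)
  qed

  show ?range if b: "b \<in> carrier R"
    unfolding p_def[symmetric] q_def[symmetric]
  proof
    assume "\<exists>x\<in>carrier R. p \<otimes> x \<oplus> x \<otimes> n = b"
    then show "q \<otimes> b \<otimes> n = \<zero>"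
      using q_kill by blast
  next
    assume qbn: "q \<otimes> b \<otimes> n = \<zero>"
    define c where "c = h \<otimes> (p \<otimes> b)"
    \<comment> \<open>On the image of \<open>p\<close> the operator is \<open>2 + N\<close>, where \<open>N\<close> is right multiplication by \<open>n\<close>,
      and its inverse is \<open>(2 - N) / 4\<close>; on the image of \<open>q\<close> it is \<open>N\<close>, and right multiplication by \<open>w\<close> provides a preimage.\<close>
    define x1 where "x1 = h \<otimes> (c \<ominus> h \<otimes> (c \<otimes> n))"
    define x2 where "x2 = h \<otimes> (q \<otimes> b \<otimes> w)"
    have c: "c \<in> carrier R" and x1: "x1 \<in> carrier R" and x2: "x2 \<in> carrier R"
      using b pq n w h by (simp_all add: c_def x1_def x2_def)
    have pc: "p \<otimes> c = c \<oplus> c"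
      using b pq h(1) by (simp add: c_def h_assoc[where y = p] r_distr l_distr pp flip: m_assoc[of p p])
    have pcn: "p \<otimes> (c \<otimes> n) = c \<otimes> n \<oplus> c \<otimes> n"
      using c n(1) pq pc by (simp add: l_distr flip: m_assoc[of p])
    have "p \<otimes> x1 = h \<otimes> (p \<otimes> c) \<ominus> h \<otimes> (h \<otimes> (p \<otimes> (c \<otimes> n)))"
      using c n(1) pq h(1) by (simp add: x1_def h_assoc[where y = p] minus_eq r_distr r_minus)
    also have "\<dots> = c \<ominus> h \<otimes> (c \<otimes> n)"
      using c n(1) h by (simp add: pc pcn half_double)
    finally have "p \<otimes> x1 = c \<ominus> h \<otimes> (c \<otimes> n)" .
    moreover have "x1 \<otimes> n = h \<otimes> (c \<otimes> n)"
      using c n h(1) by (simp add: x1_def minus_eq l_distr l_minus r_distr m_assoc)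
    ultimately have S1: "p \<otimes> x1 \<oplus> x1 \<otimes> n = c"
      using c n(1) h(1) by (simp add: minus_eq a_assoc l_neg)
    have "p \<otimes> x2 = \<zero>"
      using b pq w(1) h(1) by (simp add: x2_def h_assoc[where y = p] m_assoc zero_assoc)
    moreover have "x2 \<otimes> n = h \<otimes> (q \<otimes> b)"
      using right_n[of "q \<otimes> b"] qbn b pq w(1) n(1) h(1) by (simp add: x2_def m_assoc)
    ultimately have S2: "p \<otimes> x2 \<oplus> x2 \<otimes> n = h \<otimes> (q \<otimes> b)"
      using b pq h(1) by simp
    have "p \<otimes> (x1 \<oplus> x2) \<oplus> (x1 \<oplus> x2) \<otimes> n = (p \<otimes> x1 \<oplus> x1 \<otimes> n) \<oplus> (p \<otimes> x2 \<oplus> x2 \<otimes> n)"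
      using x1 x2 pq n(1) add_swap[of "p \<otimes> x1" "p \<otimes> x2" "x1 \<otimes> n" "x2 \<otimes> n"]
      by (simp only: l_distr r_distr m_closed)
    also have "\<dots> = b"
      using pq_half[OF b] by (simp add: S1 S2 c_def)
    finally show "\<exists>x\<in>carrier R. p \<otimes> x \<oplus> x \<otimes> n = b"
      using x1 x2 by blast
  qed
qed

end

section \<open>Inverting central elements\<close>


text \<open>
  A punctured neighbourhood on which a property holds is a neighbourhood of each of its points.
\<close>
lemma open_eventually_at:
  fixes P :: "'a::t1_space \<Rightarrow> bool"
  shows "open {z. \<forall>\<^sub>F w in at z. P w}"
proof (subst open_subopen, intro ballI)
  fix z assume "z \<in> {z. \<forall>\<^sub>F w in at z. P w}"
  then obtain S where S: "open S" "z \<in> S" "\<And>w. w \<in> S \<Longrightarrow> w \<noteq> z \<Longrightarrow> P w"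
    by (auto simp: eventually_at_topological)
  have "\<forall>\<^sub>F w in at y. P w" if "y \<in> S" for y
  proof (cases "y = z")
    case True
    then show ?thesis
      using S by (auto simp: eventually_at_topological)
  next
    case False
    have "open (S - {z})" "y \<in> S - {z}"
      using S(1) that False by (auto intro: open_Diff)
    then show ?thesis
      using S(3) by (auto simp: eventually_at_topological)
  qed
  then show "\<exists>T. open T \<and> z \<in> T \<and> T \<subseteq> {z. \<forall>\<^sub>F w in at z. P w}"
    using S by blast
qed

locale circular_domain = circular_open +
  assumes conn: "connected \<Omega>"
begin

text \<open>
  The trace itself may have two conjugate components, so the identity theorem is applied to its upper
  half, the continuous image of the connected \<open>\<Omega>\<close>; the symmetry of \<open>a\<close> gives the lower half.
\<close>
lemma nonzero_of_mirror_invariant: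
  assumes a: "mer a" "mirror a = a" and nz: "\<not> a \<doteq> (\<lambda>_. 0)"
  shows "\<forall>\<^sub>F z in cosparse D. a z \<noteq> 0"
proof -
  define Z where "Z = {z. \<forall>\<^sub>F w in at z. a w = 0}"
  define N where "N = {z. \<forall>\<^sub>F w in at z. a w \<noteq> 0}"
  have op: "open Z" "open N"
    unfolding Z_def N_def by (rule open_eventually_at)+
  have "Z \<inter> N = {}"
  proof -
    have False if "\<forall>\<^sub>F w in at z. a w = 0" "\<forall>\<^sub>F w in at z. a w \<noteq> 0" for z
      using eventually_conj[OF that] by simp
    then show ?thesis
      by (auto simp: Z_def N_def)
  qed
  have cover: "D \<subseteq> Z \<union> N"
  proof
    fix z assume "z \<in> D"
    then have "a meromorphic_on {z}"
      using a(1) by (auto intro: meromorphic_on_subset)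
    then have "isolated_singularity_at a z" "not_essential a z"
      by (simp_all add: meromorphic_at_iff)
    then show "z \<in> Z \<union> N"
      using non_zero_neighbour[of a z] by (auto simp: Z_def N_def frequently_def)
  qed
  have cnj0: "a (cnj z) = 0 \<longleftrightarrow> a z = 0" for z
    using fun_cong[OF a(2), of z] by (simp add: mirror_def) (metis complex_cnj_zero_iff)
  have cnj_Z: "cnj z \<in> Z" if "z \<in> Z" for z
    using eventually_compose_filterlim[OF _ filterlim_cnj_at[of "cnj z"], of "\<lambda>w. a w = 0"] that
    by (simp add: Z_def cnj0)
  have cnj_N: "cnj z \<in> N" if "z \<in> N" for z
    using eventually_compose_filterlim[OF _ filterlim_cnj_at[of "cnj z"], of "\<lambda>w. a w \<noteq> 0"] that
    by (simp add: N_def cnj0)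
  have "connected (upper ` \<Omega>)"
    by (rule connected_continuous_image[OF continuous_on_upper conn])
  moreover have "upper ` \<Omega> \<subseteq> Z \<union> N"
    using cover trace_set_eq_upper_image[OF circ] by blast
  ultimately have "Z \<inter> upper ` \<Omega> = {} \<or> N \<inter> upper ` \<Omega> = {}"
    using op \<open>Z \<inter> N = {}\<close> by (intro connectedD) auto
  then have "upper ` \<Omega> \<subseteq> N \<or> upper ` \<Omega> \<subseteq> Z"
    using \<open>upper ` \<Omega> \<subseteq> Z \<union> N\<close> by blast
  then have "D \<subseteq> N \<or> D \<subseteq> Z"
    unfolding trace_set_eq_upper_image[OF circ] using cnj_Z cnj_N by blast
  moreover have "\<not> D \<subseteq> Z"
    using nz by (auto simp: ae_eq_def eventually_cosparse_open_eq[OF open_D] Z_def)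
  ultimately show ?thesis
    by (auto simp: eventually_cosparse_open_eq[OF open_D] N_def)
qed

lemma scal_inverse:
  assumes c: "mer c" "mirror c = c" "\<not> c \<doteq> (\<lambda>_. 0)"
  shows "scal (\<lambda>z. 1 / c z) \<otimes>\<^bsub>SEM \<Omega>\<^esub> scal c = \<one>\<^bsub>SEM \<Omega>\<^esub>"
proof -
  have "(\<lambda>z. 1 / c z * c z) \<doteq> (\<lambda>_. 1)"
    unfolding ae_eq_def using nonzero_of_mirror_invariant[OF c] by eventually_elim simp
  moreover have "mer (\<lambda>z. 1 / c z * c z)"
    by (intro meromorphic_intros c(1) mer_const)
  ultimately have "scal (\<lambda>z. 1 / c z * c z) = scal (\<lambda>_. 1)"
    using cls_eq_iff[OF _ mer_const mer_const mer_const] by blast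
  moreover have "scal (\<lambda>z. 1 / c z) \<otimes>\<^bsub>SEM \<Omega>\<^esub> scal c = scal (\<lambda>z. 1 / c z * c z)"
    using c(1) by (subst mult_cls) (auto intro!: meromorphic_intros simp: prod_scal(3,4)[OF c(2)])
  ultimately show ?thesis
    by (simp only: one_SEM)
qed

text \<open>
  For vectorial elements \<open>x y + y x\<close> is minus twice the scalar product of the components. If some
  component of \<open>(a, b)\<close> is nonzero, the corresponding basis vector divided by \<open>- 2\<close> times that
  component is a solution. The three cases below are the components along \<open>i\<close>, \<open>j\<close> and \<open>k\<close>.
\<close>
lemma vec_anticommutator_one:
  assumes a: "mer a" "mirror a = (\<lambda>z. - a z)" and b: "mer b"
    and nz: "\<not> (a \<doteq> (\<lambda>_. 0) \<and> b \<doteq> (\<lambda>_. 0))"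
  shows "\<exists>W\<in>carrier (SEM \<Omega>). W \<otimes>\<^bsub>SEM \<Omega>\<^esub> cls a b \<oplus>\<^bsub>SEM \<Omega>\<^esub> cls a b \<otimes>\<^bsub>SEM \<Omega>\<^esub> W = \<one>\<^bsub>SEM \<Omega>\<^esub>"
proof -
  have sum: "cls c d \<otimes>\<^bsub>SEM \<Omega>\<^esub> cls a b \<oplus>\<^bsub>SEM \<Omega>\<^esub> cls a b \<otimes>\<^bsub>SEM \<Omega>\<^esub> cls c d = \<one>\<^bsub>SEM \<Omega>\<^esub>"
    if "mer c" "mer d" "(\<lambda>z. prod_fst c d a b z + prod_fst a b c d z) \<doteq> (\<lambda>_. 1)"
      "(\<lambda>z. prod_snd c d a b z + prod_snd a b c d z) \<doteq> (\<lambda>_. 0)" for c d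
    using that a b by (simp add: mult_cls add_cls mer_prod one_SEM cls_eq_iff mer_const meromorphic_on_add)
  consider "\<not> a \<doteq> (\<lambda>_. 0)" | "\<not> (\<lambda>z. b z + mirror b z) \<doteq> (\<lambda>_. 0)"
    | "\<not> (\<lambda>z. \<i> * (b z - mirror b z)) \<doteq> (\<lambda>_. 0)"
  proof -
    have "b \<doteq> (\<lambda>_. 0)" if "(\<lambda>z. b z + mirror b z) \<doteq> (\<lambda>_. 0)" "(\<lambda>z. \<i> * (b z - mirror b z)) \<doteq> (\<lambda>_. 0)"
      using that unfolding ae_eq_def by eventually_elim (simp add: add_eq_0_iff)
    then show ?thesis
      using nz that by blast
  qed
  then show ?thesis
  proof cases
    case 1
    define c where "c z = 1 / (2 * a z)" for z
    have "\<not> (\<lambda>z. \<i> * a z) \<doteq> (\<lambda>_. 0)"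
      using 1 by (simp add: ae_eq_def)
    then have "\<forall>\<^sub>F z in cosparse D. \<i> * a z \<noteq> 0"
      using a by (intro nonzero_of_mirror_invariant meromorphic_on_mult mer_const) simp_all
    then have "\<forall>\<^sub>F z in cosparse D. a z \<noteq> 0"
      by simp
    then have "(\<lambda>z. prod_fst c (\<lambda>_. 0) a b z + prod_fst a b c (\<lambda>_. 0) z) \<doteq> (\<lambda>_. 1)"
      "(\<lambda>z. prod_snd c (\<lambda>_. 0) a b z + prod_snd a b c (\<lambda>_. 0) z) \<doteq> (\<lambda>_. 0)"
      unfolding ae_eq_def
      by (eventually_elim, simp add: prod_fst_def prod_snd_def c_def[abs_def] a(2))+
    moreover have "mer c"
      unfolding c_def[abs_def] using a(1) by (intro meromorphic_intros mer_const)
    ultimately show ?thesis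
      using sum[of c "\<lambda>_. 0"] cls_closed mer_const by blast
  next
    case 2
    define d where "d z = - (1 / (b z + mirror b z))" for z
    have "mirror (\<lambda>z. b z + mirror b z) = (\<lambda>z. b z + mirror b z)"
      by (simp add: add.commute)
    then have "\<forall>\<^sub>F z in cosparse D. b z + mirror b z \<noteq> 0"
      using 2 b by (intro nonzero_of_mirror_invariant meromorphic_on_add mer_mirror)
    then have "(\<lambda>z. prod_fst (\<lambda>_. 0) d a b z + prod_fst a b (\<lambda>_. 0) d z) \<doteq> (\<lambda>_. 1)"
      unfolding ae_eq_def
    proof eventually_elim
      case (elim z)
      have "mirror d z = d z"
        by (simp add: d_def[abs_def] add.commute)
      then have "prod_fst (\<lambda>_. 0) d a b z + prod_fst a b (\<lambda>_. 0) d z = - (d z * (b z + mirror b z))"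
        by (simp add: prod_fst_def algebra_simps)
      then show ?case
        using elim by (simp add: d_def)
    qed
    moreover have "(\<lambda>z. prod_snd (\<lambda>_. 0) d a b z + prod_snd a b (\<lambda>_. 0) d z) \<doteq> (\<lambda>_. 0)"
      by (simp add: prod_snd_def a(2))
    moreover have "mer d"
      unfolding d_def[abs_def] using b by (intro meromorphic_intros mer_const mer_mirror)
    ultimately show ?thesis
      using sum[of "\<lambda>_. 0" d] cls_closed mer_const by blast
  next
    case 3
    define d where "d z = \<i> / (\<i> * (b z - mirror b z))" for z
    have "mirror (\<lambda>z. \<i> * (b z - mirror b z)) = (\<lambda>z. \<i> * (b z - mirror b z))"
      by (simp add: algebra_simps)
    then have "\<forall>\<^sub>F z in cosparse D. \<i> * (b z - mirror b z) \<noteq> 0"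
      using 3 b by (intro nonzero_of_mirror_invariant meromorphic_on_mult meromorphic_on_diff mer_mirror mer_const)
    then have "(\<lambda>z. prod_fst (\<lambda>_. 0) d a b z + prod_fst a b (\<lambda>_. 0) d z) \<doteq> (\<lambda>_. 1)"
      unfolding ae_eq_def
    proof eventually_elim
      case (elim z)
      have "mirror d z = - d z"
        by (simp add: d_def[abs_def]) (metis minus_diff_eq minus_divide_right)
      then have "prod_fst (\<lambda>_. 0) d a b z + prod_fst a b (\<lambda>_. 0) d z = d z * (b z - mirror b z)"
        by (simp add: prod_fst_def algebra_simps)
      then show ?case
        using elim by (simp add: d_def)
    qed
    moreover have "(\<lambda>z. prod_snd (\<lambda>_. 0) d a b z + prod_snd a b (\<lambda>_. 0) d z) \<doteq> (\<lambda>_. 0)"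
      by (simp add: prod_snd_def a(2))
    moreover have "mer d"
      unfolding d_def[abs_def] using b by (intro meromorphic_intros mer_const mer_mirror)
    ultimately show ?thesis
      using sum[of "\<lambda>_. 0" d] cls_closed mer_const by blast
  qed
qed

end

section \<open>The Sylvester operator\<close>

context circular_domain
begin

interpretation ring "SEM \<Omega>"
  by (rule ring_SEM)

text \<open>
  The square of a vectorial element is central, since for \<open>mirror a = - a\<close> the second member
  \<open>a b + b (mirror a)\<close> of the square vanishes.
\<close>
lemma sem_vec_square:
  assumes "f \<in> carrier (SEM \<Omega>)"
  shows "\<exists>c. mer c \<and> mirror c = c \<and>
    \<one>\<^bsub>SEM \<Omega>\<^esub> \<ominus>\<^bsub>SEM \<Omega>\<^esub> sem_vec \<Omega> f \<otimes>\<^bsub>SEM \<Omega>\<^esub> sem_vec \<Omega> f = scal c"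
proof -
  obtain a0 b where f: "mer a0" "mer b" "f = cls a0 b"
    using assms by (auto simp: carrier_SEM_iff)
  define a where "a z = a0 z - re_part a0 z" for z
  have a: "mer a" "mirror a = (\<lambda>z. - a z)" "sem_vec \<Omega> f = cls a b"
    using f by (simp_all only: a_def[abs_def] mer_vec mirror_vec sem_vec_cls)
  have eq: "prod_fst a b a b = (\<lambda>z. a z * a z - b z * mirror b z)" "prod_snd a b a b = (\<lambda>_. 0)"
    by (simp_all add: fun_eq_iff prod_fst_def prod_snd_def a(2))
  have "\<one>\<^bsub>SEM \<Omega>\<^esub> \<ominus>\<^bsub>SEM \<Omega>\<^esub> cls a b \<otimes>\<^bsub>SEM \<Omega>\<^esub> cls a b = scal (\<lambda>z. 1 - (a z * a z - b z * mirror b z))"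
    using a(1) f(2) mer_prod(1)[OF a(1) f(2) a(1) f(2)]
    by (simp add: mult_cls one_SEM minus_cls mer_const eq)
  moreover have "mirror (\<lambda>z. 1 - (a z * a z - b z * mirror b z)) = (\<lambda>z. 1 - (a z * a z - b z * mirror b z))"
    by (simp add: a(2) mult.commute)
  moreover have "mer (\<lambda>z. 1 - (a z * a z - b z * mirror b z))"
    using a(1) f(2) by (intro meromorphic_intros mer_mirror mer_const)
  ultimately show ?thesis
    unfolding a(3) by blast
qed

lemma sem_vec_closed: "f \<in> carrier (SEM \<Omega>) \<Longrightarrow> sem_vec \<Omega> f \<in> carrier (SEM \<Omega>)"
proof -
  assume "f \<in> carrier (SEM \<Omega>)"
  then obtain a b where "mer a" "mer b" "f = cls a b"
    by (auto simp: carrier_SEM_iff)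
  then show ?thesis
    by (simp add: sem_vec_cls cls_closed mer_vec)
qed

lemma sem_Re_closed: "f \<in> carrier (SEM \<Omega>) \<Longrightarrow> sem_Re \<Omega> f \<in> carrier (SEM_R \<Omega>)"
  by (auto simp: carrier_SEM_iff sem_Re_cls intro!: scal_mem_SEM_R mer_parts)

text \<open>The central real parts add up to \<open>1\<close> and can be collected on the left of \<open>X\<close>.\<close>
lemma sylvester_eq:
  assumes f: "f \<in> carrier (SEM \<Omega>)" and g: "g \<in> carrier (SEM \<Omega>)"
    and re: "sem_Re \<Omega> f \<oplus>\<^bsub>SEM \<Omega>\<^esub> sem_Re \<Omega> g = \<one>\<^bsub>SEM \<Omega>\<^esub>" and X: "X \<in> carrier (SEM \<Omega>)"
  shows "sylvester \<Omega> f g X =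
    (\<one>\<^bsub>SEM \<Omega>\<^esub> \<oplus>\<^bsub>SEM \<Omega>\<^esub> sem_vec \<Omega> f) \<otimes>\<^bsub>SEM \<Omega>\<^esub> X \<oplus>\<^bsub>SEM \<Omega>\<^esub> X \<otimes>\<^bsub>SEM \<Omega>\<^esub> sem_vec \<Omega> g"
proof -
  have cl: "sem_Re \<Omega> h \<in> carrier (SEM \<Omega>)" "sem_vec \<Omega> h \<in> carrier (SEM \<Omega>)"
    and split: "h = sem_Re \<Omega> h \<oplus>\<^bsub>SEM \<Omega>\<^esub> sem_vec \<Omega> h" if "h \<in> carrier (SEM \<Omega>)" for h
  proof -
    show *: "sem_Re \<Omega> h \<in> carrier (SEM \<Omega>)" "sem_vec \<Omega> h \<in> carrier (SEM \<Omega>)"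
      using that sem_Re_closed SEM_R_subset sem_vec_closed by blast+
    have "h = sem_Re \<Omega> h \<oplus>\<^bsub>SEM \<Omega>\<^esub> (h \<ominus>\<^bsub>SEM \<Omega>\<^esub> sem_Re \<Omega> h)"
      using that *(1) by algebra
    then show "h = sem_Re \<Omega> h \<oplus>\<^bsub>SEM \<Omega>\<^esub> sem_vec \<Omega> h"
      by (simp add: sem_vec_def)
  qed
  define f0 fv g0 gv where d: "f0 = sem_Re \<Omega> f" "fv = sem_vec \<Omega> f" "g0 = sem_Re \<Omega> g" "gv = sem_vec \<Omega> g"
  have c: "f0 \<in> carrier (SEM \<Omega>)" "fv \<in> carrier (SEM \<Omega>)" "g0 \<in> carrier (SEM \<Omega>)" "gv \<in> carrier (SEM \<Omega>)"
    using cl f g by (simp_all add: d)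
  have g0X: "X \<otimes>\<^bsub>SEM \<Omega>\<^esub> g0 = g0 \<otimes>\<^bsub>SEM \<Omega>\<^esub> X"
    unfolding d by (rule SEM_R_central[OF sem_Re_closed[OF g] X, symmetric])
  have "sylvester \<Omega> f g X = (f0 \<oplus>\<^bsub>SEM \<Omega>\<^esub> fv) \<otimes>\<^bsub>SEM \<Omega>\<^esub> X \<oplus>\<^bsub>SEM \<Omega>\<^esub> X \<otimes>\<^bsub>SEM \<Omega>\<^esub> (g0 \<oplus>\<^bsub>SEM \<Omega>\<^esub> gv)"
    unfolding sylvester_def d using split[OF f] split[OF g] by simp
  also have "\<dots> = f0 \<otimes>\<^bsub>SEM \<Omega>\<^esub> X \<oplus>\<^bsub>SEM \<Omega>\<^esub> fv \<otimes>\<^bsub>SEM \<Omega>\<^esub> X \<oplus>\<^bsub>SEM \<Omega>\<^esub>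
      (g0 \<otimes>\<^bsub>SEM \<Omega>\<^esub> X \<oplus>\<^bsub>SEM \<Omega>\<^esub> X \<otimes>\<^bsub>SEM \<Omega>\<^esub> gv)"
    using c X by (simp add: l_distr r_distr g0X)
  also have "\<dots> = f0 \<otimes>\<^bsub>SEM \<Omega>\<^esub> X \<oplus>\<^bsub>SEM \<Omega>\<^esub> g0 \<otimes>\<^bsub>SEM \<Omega>\<^esub> X \<oplus>\<^bsub>SEM \<Omega>\<^esub>
      (fv \<otimes>\<^bsub>SEM \<Omega>\<^esub> X \<oplus>\<^bsub>SEM \<Omega>\<^esub> X \<otimes>\<^bsub>SEM \<Omega>\<^esub> gv)"
    using c X by (intro add_swap) simp_all
  also have "f0 \<otimes>\<^bsub>SEM \<Omega>\<^esub> X \<oplus>\<^bsub>SEM \<Omega>\<^esub> g0 \<otimes>\<^bsub>SEM \<Omega>\<^esub> X = X"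
    using c X re l_distr[of f0 g0 X] by (simp add: d)
  also have "X \<oplus>\<^bsub>SEM \<Omega>\<^esub> (fv \<otimes>\<^bsub>SEM \<Omega>\<^esub> X \<oplus>\<^bsub>SEM \<Omega>\<^esub> X \<otimes>\<^bsub>SEM \<Omega>\<^esub> gv) =
      (\<one>\<^bsub>SEM \<Omega>\<^esub> \<oplus>\<^bsub>SEM \<Omega>\<^esub> fv) \<otimes>\<^bsub>SEM \<Omega>\<^esub> X \<oplus>\<^bsub>SEM \<Omega>\<^esub> X \<otimes>\<^bsub>SEM \<Omega>\<^esub> gv"
    using c X by (simp add: l_distr a_assoc)
  finally show ?thesis
    by (simp add: d)
qed

lemma sylvester_module_iso:
  assumes f: "f \<in> carrier (SEM \<Omega>)" and g: "g \<in> carrier (SEM \<Omega>)"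
    and bij: "bij_betw (sylvester \<Omega> f g) (carrier (SEM \<Omega>)) (carrier (SEM \<Omega>))"
  shows "sylvester \<Omega> f g \<in> module_iso (SEM_R \<Omega>) (SEM \<Omega>) (SEM \<Omega>)"
proof -
  have "sylvester \<Omega> f g (X \<oplus>\<^bsub>SEM \<Omega>\<^esub> Y) = sylvester \<Omega> f g X \<oplus>\<^bsub>SEM \<Omega>\<^esub> sylvester \<Omega> f g Y"
    if X: "X \<in> carrier (SEM \<Omega>)" and Y: "Y \<in> carrier (SEM \<Omega>)" for X Y
    unfolding sylvester_def using f g X Y
      add_swap[of "f \<otimes>\<^bsub>SEM \<Omega>\<^esub> X" "f \<otimes>\<^bsub>SEM \<Omega>\<^esub> Y" "X \<otimes>\<^bsub>SEM \<Omega>\<^esub> g" "Y \<otimes>\<^bsub>SEM \<Omega>\<^esub> g"]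
    by (simp only: l_distr r_distr m_closed)
  moreover have "sylvester \<Omega> f g (A \<odot>\<^bsub>SEM \<Omega>\<^esub> X) = A \<odot>\<^bsub>SEM \<Omega>\<^esub> sylvester \<Omega> f g X"
    if A: "A \<in> carrier (SEM_R \<Omega>)" and X: "X \<in> carrier (SEM \<Omega>)" for A X
  proof -
    have A': "A \<in> carrier (SEM \<Omega>)"
      by (rule SEM_R_subset[OF A])
    have "f \<otimes>\<^bsub>SEM \<Omega>\<^esub> (A \<otimes>\<^bsub>SEM \<Omega>\<^esub> X) = f \<otimes>\<^bsub>SEM \<Omega>\<^esub> A \<otimes>\<^bsub>SEM \<Omega>\<^esub> X"
      by (rule m_assoc[symmetric, OF f A' X])
    also have "f \<otimes>\<^bsub>SEM \<Omega>\<^esub> A = A \<otimes>\<^bsub>SEM \<Omega>\<^esub> f"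
      by (rule SEM_R_central[OF A f, symmetric])
    finally show ?thesis
      unfolding sylvester_def smult_SEM using f g A' X by (simp add: r_distr m_assoc)
  qed
  ultimately show ?thesis
    using bij bij_betw_imp_funcset[OF bij] by (auto simp: module_iso_def iso_def hom_def)
qed

text \<open>
  Otherwise \<open>(1 + v) (1 - v) = 1 - v v\<close> would be a nonzero central element, hence invertible, and
  with it \<open>1 + v\<close>.
\<close>
lemma sem_vec_square_eq_one:
  assumes f: "f \<in> carrier (SEM \<Omega>)" and g: "g \<in> carrier (SEM \<Omega>)"
    and re: "sem_Re \<Omega> f \<oplus>\<^bsub>SEM \<Omega>\<^esub> sem_Re \<Omega> g = \<one>\<^bsub>SEM \<Omega>\<^esub>"
    and nil: "sem_vec \<Omega> g \<otimes>\<^bsub>SEM \<Omega>\<^esub> sem_vec \<Omega> g = \<zero>\<^bsub>SEM \<Omega>\<^esub>"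
    and not_iso: "sylvester \<Omega> f g \<notin> module_iso (SEM_R \<Omega>) (SEM \<Omega>) (SEM \<Omega>)"
  shows "sem_vec \<Omega> f \<otimes>\<^bsub>SEM \<Omega>\<^esub> sem_vec \<Omega> f = \<one>\<^bsub>SEM \<Omega>\<^esub>"
proof (rule ccontr)
  assume ne: "sem_vec \<Omega> f \<otimes>\<^bsub>SEM \<Omega>\<^esub> sem_vec \<Omega> f \<noteq> \<one>\<^bsub>SEM \<Omega>\<^esub>"
  define v n where "v = sem_vec \<Omega> f" and "n = sem_vec \<Omega> g"
  have v: "v \<in> carrier (SEM \<Omega>)" and n: "n \<in> carrier (SEM \<Omega>)"
    using f g by (simp_all add: v_def n_def sem_vec_closed)
  obtain c where c: "mer c" "mirror c = c" and vv: "\<one>\<^bsub>SEM \<Omega>\<^esub> \<ominus>\<^bsub>SEM \<Omega>\<^esub> v \<otimes>\<^bsub>SEM \<Omega>\<^esub> v = scal c"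
    using sem_vec_square[OF f] unfolding v_def by blast
  have "\<not> c \<doteq> (\<lambda>_. 0)"
  proof
    assume "c \<doteq> (\<lambda>_. 0)"
    then have "\<one>\<^bsub>SEM \<Omega>\<^esub> \<ominus>\<^bsub>SEM \<Omega>\<^esub> v \<otimes>\<^bsub>SEM \<Omega>\<^esub> v = \<zero>\<^bsub>SEM \<Omega>\<^esub>"
      using c(1) by (simp add: vv zero_SEM cls_eq_iff mer_const)
    moreover have "\<one>\<^bsub>SEM \<Omega>\<^esub> = (\<one>\<^bsub>SEM \<Omega>\<^esub> \<ominus>\<^bsub>SEM \<Omega>\<^esub> y) \<oplus>\<^bsub>SEM \<Omega>\<^esub> y" if "y \<in> carrier (SEM \<Omega>)" for y
      using that by algebra
    ultimately have "\<one>\<^bsub>SEM \<Omega>\<^esub> = v \<otimes>\<^bsub>SEM \<Omega>\<^esub> v"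
      using v by (metis l_zero m_closed)
    then show False
      using ne by (simp add: v_def)
  qed
  note inv = scal_inverse[OF c this]
  define d where "d = scal (\<lambda>z. 1 / c z)"
  have d: "d \<in> carrier (SEM_R \<Omega>)"
    unfolding d_def using c by (intro scal_mem_SEM_R meromorphic_on_divide mer_const) simp_all
  have d': "d \<in> carrier (SEM \<Omega>)"
    by (rule SEM_R_subset[OF d])
  define p q where "p = \<one>\<^bsub>SEM \<Omega>\<^esub> \<oplus>\<^bsub>SEM \<Omega>\<^esub> v" and "q = \<one>\<^bsub>SEM \<Omega>\<^esub> \<ominus>\<^bsub>SEM \<Omega>\<^esub> v"
  have pq: "p \<in> carrier (SEM \<Omega>)" "q \<in> carrier (SEM \<Omega>)"
    using v by (simp_all add: p_def q_def)
  have prods: "p \<otimes>\<^bsub>SEM \<Omega>\<^esub> q = scal c" "q \<otimes>\<^bsub>SEM \<Omega>\<^esub> p = scal c"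
    unfolding vv[symmetric] p_def q_def using v diff_squares[OF v] by simp_all
  have dpq: "d \<otimes>\<^bsub>SEM \<Omega>\<^esub> q \<otimes>\<^bsub>SEM \<Omega>\<^esub> p = \<one>\<^bsub>SEM \<Omega>\<^esub>"
    using m_assoc[OF d' pq(2,1)] inv by (simp add: prods d_def)
  have pdq: "p \<otimes>\<^bsub>SEM \<Omega>\<^esub> (d \<otimes>\<^bsub>SEM \<Omega>\<^esub> q) = \<one>\<^bsub>SEM \<Omega>\<^esub>"
  proof -
    have "p \<otimes>\<^bsub>SEM \<Omega>\<^esub> (d \<otimes>\<^bsub>SEM \<Omega>\<^esub> q) = p \<otimes>\<^bsub>SEM \<Omega>\<^esub> d \<otimes>\<^bsub>SEM \<Omega>\<^esub> q"
      by (rule m_assoc[symmetric, OF pq(1) d' pq(2)])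
    also have "p \<otimes>\<^bsub>SEM \<Omega>\<^esub> d = d \<otimes>\<^bsub>SEM \<Omega>\<^esub> p"
      by (rule SEM_R_central[OF d pq(1), symmetric])
    also have "d \<otimes>\<^bsub>SEM \<Omega>\<^esub> p \<otimes>\<^bsub>SEM \<Omega>\<^esub> q = d \<otimes>\<^bsub>SEM \<Omega>\<^esub> (p \<otimes>\<^bsub>SEM \<Omega>\<^esub> q)"
      by (rule m_assoc[OF d' pq])
    finally show ?thesis
      using inv by (simp add: prods d_def)
  qed
  have "bij_betw (\<lambda>x. p \<otimes>\<^bsub>SEM \<Omega>\<^esub> x \<oplus>\<^bsub>SEM \<Omega>\<^esub> x \<otimes>\<^bsub>SEM \<Omega>\<^esub> n) (carrier (SEM \<Omega>)) (carrier (SEM \<Omega>))"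
    unfolding p_def
    by (rule sylvester_bij_of_inverse[OF v n nil[folded n_def], of "d \<otimes>\<^bsub>SEM \<Omega>\<^esub> q"])
       (use d' pq dpq pdq in \<open>simp_all add: p_def\<close>)
  then have "bij_betw (sylvester \<Omega> f g) (carrier (SEM \<Omega>)) (carrier (SEM \<Omega>))"
    by (rule bij_betw_cong[THEN iffD1, rotated])
       (simp add: sylvester_eq[OF f g re] p_def v_def n_def)
  then show False
    using sylvester_module_iso[OF f g] not_iso by blast
qed

theorem sylvester_singular:
  assumes f: "f \<in> carrier (SEM \<Omega>)" and g: "g \<in> carrier (SEM \<Omega>) - carrier (SEM_R \<Omega>)"
    and re: "sem_Re \<Omega> f \<oplus>\<^bsub>SEM \<Omega>\<^esub> sem_Re \<Omega> g = \<one>\<^bsub>SEM \<Omega>\<^esub>"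
    and not_iso: "sylvester \<Omega> f g \<notin> module_iso (SEM_R \<Omega>) (SEM \<Omega>) (SEM \<Omega>)"
    and symm: "sem_symm \<Omega> (sem_vec \<Omega> g) = \<zero>\<^bsub>SEM \<Omega>\<^esub>"
  shows "a_kernel (SEM \<Omega>) (SEM \<Omega>) (sylvester \<Omega> f g) =
      {(\<one>\<^bsub>SEM \<Omega>\<^esub> \<ominus>\<^bsub>SEM \<Omega>\<^esub> sem_vec \<Omega> f) \<otimes>\<^bsub>SEM \<Omega>\<^esub> X \<otimes>\<^bsub>SEM \<Omega>\<^esub> sem_vec \<Omega> g | X. X \<in> carrier (SEM \<Omega>)}"
    and "b \<in> carrier (SEM \<Omega>) \<Longrightarrow> (\<exists>h\<in>carrier (SEM \<Omega>). sylvester \<Omega> f g h = b) \<longleftrightarrow>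
      (\<one>\<^bsub>SEM \<Omega>\<^esub> \<ominus>\<^bsub>SEM \<Omega>\<^esub> sem_vec \<Omega> f) \<otimes>\<^bsub>SEM \<Omega>\<^esub> b \<otimes>\<^bsub>SEM \<Omega>\<^esub> sem_vec \<Omega> g = \<zero>\<^bsub>SEM \<Omega>\<^esub>"
proof -
  have g': "g \<in> carrier (SEM \<Omega>)"
    using g by blast
  obtain a0 b0 where g_eq: "mer a0" "mer b0" "g = cls a0 b0"
    using g' by (auto simp: carrier_SEM_iff)
  define a where "a z = a0 z - re_part a0 z" for z
  have a: "mer a" "mirror a = (\<lambda>z. - a z)" "sem_vec \<Omega> g = cls a b0"
    using g_eq by (simp_all only: a_def[abs_def] mer_vec mirror_vec sem_vec_cls)
  define n where "n = sem_vec \<Omega> g"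
  have n: "n \<in> carrier (SEM \<Omega>)"
    using g' by (simp add: n_def sem_vec_closed)
  have "\<ominus>\<^bsub>SEM \<Omega>\<^esub> (n \<otimes>\<^bsub>SEM \<Omega>\<^esub> n) = \<zero>\<^bsub>SEM \<Omega>\<^esub>"
    using symm sem_symm_vec[OF a(1,2) g_eq(2)] by (simp add: a(3) n_def)
  then have nn: "n \<otimes>\<^bsub>SEM \<Omega>\<^esub> n = \<zero>\<^bsub>SEM \<Omega>\<^esub>"
    using n by (metis m_closed minus_minus minus_zero)
  have "\<not> (a \<doteq> (\<lambda>_. 0) \<and> b0 \<doteq> (\<lambda>_. 0))"
  proof
    assume *: "a \<doteq> (\<lambda>_. 0) \<and> b0 \<doteq> (\<lambda>_. 0)"
    have "a0 \<doteq> re_part a0"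
      using conjunct1[OF *] by (simp add: ae_eq_def a_def)
    then have "g = scal (re_part a0)"
      using * g_eq by (simp add: cls_eq_iff mer_parts mer_const)
    then show False
      using g scal_mem_SEM_R[of "re_part a0"] g_eq by (simp add: mer_parts)
  qed
  then obtain w where w: "w \<in> carrier (SEM \<Omega>)" "w \<otimes>\<^bsub>SEM \<Omega>\<^esub> n \<oplus>\<^bsub>SEM \<Omega>\<^esub> n \<otimes>\<^bsub>SEM \<Omega>\<^esub> w = \<one>\<^bsub>SEM \<Omega>\<^esub>"
    using vec_anticommutator_one[OF a(1,2) g_eq(2)] unfolding a(3) n_def by blast
  define v where "v = sem_vec \<Omega> f"
  have v: "v \<in> carrier (SEM \<Omega>)" "v \<otimes>\<^bsub>SEM \<Omega>\<^esub> v = \<one>\<^bsub>SEM \<Omega>\<^esub>"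
    using f sem_vec_square_eq_one[OF f g' re nn[unfolded n_def] not_iso] by (simp_all add: v_def sem_vec_closed)
  define h where "h = scal (\<lambda>_. 1 / 2)"
  have h_R: "h \<in> carrier (SEM_R \<Omega>)"
    unfolding h_def by (intro scal_mem_SEM_R mer_const) simp
  have h: "h \<in> carrier (SEM \<Omega>)" "h \<oplus>\<^bsub>SEM \<Omega>\<^esub> h = \<one>\<^bsub>SEM \<Omega>\<^esub>"
    "\<forall>x\<in>carrier (SEM \<Omega>). h \<otimes>\<^bsub>SEM \<Omega>\<^esub> x = x \<otimes>\<^bsub>SEM \<Omega>\<^esub> h"
    using SEM_R_subset[OF h_R] SEM_R_central[OF h_R] by (simp_all add: h_def add_cls mer_const one_SEM)
  note main = sylvester_kernel_and_range[OF v n nn w h]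
  have S: "sylvester \<Omega> f g X = (\<one>\<^bsub>SEM \<Omega>\<^esub> \<oplus>\<^bsub>SEM \<Omega>\<^esub> v) \<otimes>\<^bsub>SEM \<Omega>\<^esub> X \<oplus>\<^bsub>SEM \<Omega>\<^esub> X \<otimes>\<^bsub>SEM \<Omega>\<^esub> n"
    if "X \<in> carrier (SEM \<Omega>)" for X
    using sylvester_eq[OF f g' re that] by (simp add: v_def n_def)
  show "a_kernel (SEM \<Omega>) (SEM \<Omega>) (sylvester \<Omega> f g) =
      {(\<one>\<^bsub>SEM \<Omega>\<^esub> \<ominus>\<^bsub>SEM \<Omega>\<^esub> sem_vec \<Omega> f) \<otimes>\<^bsub>SEM \<Omega>\<^esub> X \<otimes>\<^bsub>SEM \<Omega>\<^esub> sem_vec \<Omega> g | X. X \<in> carrier (SEM \<Omega>)}"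
    using main(1) S unfolding a_kernel_def' v_def n_def by (simp cong: conj_cong)
  show "(\<exists>h\<in>carrier (SEM \<Omega>). sylvester \<Omega> f g h = b) \<longleftrightarrow>
      (\<one>\<^bsub>SEM \<Omega>\<^esub> \<ominus>\<^bsub>SEM \<Omega>\<^esub> sem_vec \<Omega> f) \<otimes>\<^bsub>SEM \<Omega>\<^esub> b \<otimes>\<^bsub>SEM \<Omega>\<^esub> sem_vec \<Omega> g = \<zero>\<^bsub>SEM \<Omega>\<^esub>"
    if "b \<in> carrier (SEM \<Omega>)"
    using main(2)[OF that] S unfolding v_def n_def by (simp cong: bex_cong)
qed

end

theorem proposition9p4:
  fixes \<Omega> :: "quat set" and f g :: sem
  assumes "open \<Omega>" and "connected \<Omega>" and "circular \<Omega>"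
    and "f \<in> carrier (SEM \<Omega>) - carrier (SEM_R \<Omega>)"
    and "g \<in> carrier (SEM \<Omega>) - carrier (SEM_R \<Omega>)"
    and "sem_Re \<Omega> f \<oplus>\<^bsub>SEM \<Omega>\<^esub> sem_Re \<Omega> g = \<one>\<^bsub>SEM \<Omega>\<^esub>"
    and "sylvester \<Omega> f g \<notin> module_iso (SEM_R \<Omega>) (SEM \<Omega>) (SEM \<Omega>)"
    and "sem_symm \<Omega> (sem_vec \<Omega> g) = \<zero>\<^bsub>SEM \<Omega>\<^esub>"
  shows "(a_kernel (SEM \<Omega>) (SEM \<Omega>) (sylvester \<Omega> f g) =
           {(\<one>\<^bsub>SEM \<Omega>\<^esub> \<ominus>\<^bsub>SEM \<Omega>\<^esub> sem_vec \<Omega> f) \<otimes>\<^bsub>SEM \<Omega>\<^esub> X \<otimes>\<^bsub>SEM \<Omega>\<^esub> sem_vec \<Omega> g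
             | X. X \<in> carrier (SEM \<Omega>)}) \<and>
         (\<forall>b\<in>carrier (SEM \<Omega>).
           (\<exists>h\<in>carrier (SEM \<Omega>). sylvester \<Omega> f g h = b) \<longleftrightarrow>
           (\<one>\<^bsub>SEM \<Omega>\<^esub> \<ominus>\<^bsub>SEM \<Omega>\<^esub> sem_vec \<Omega> f) \<otimes>\<^bsub>SEM \<Omega>\<^esub> b \<otimes>\<^bsub>SEM \<Omega>\<^esub> sem_vec \<Omega> g = \<zero>\<^bsub>SEM \<Omega>\<^esub>)"
proof -
  interpret circular_domain \<Omega>
    using assms(1-3) by unfold_locales
  have f: "f \<in> carrier (SEM \<Omega>)"
    using assms(4) by blast
  show ?thesis
    using sylvester_singular[OF f assms(5-8)] by blast
qed

end
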